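(* Let $\Omega$ be an interpolation data set with associated matrices $P,X,E,C$, and let $w$ be a function meromorphic on $\mathbb{C}^+$. If $P$ is invertible, then $w$ is a solution of the Master Boundary Interpolation Problem for $\Omega$ if and only if it is of the form $$w(z)=\mathbf{T}_\Theta[\varphi](z):=\frac{\Theta_{11}(z)\varphi(z)+\Theta_{12}(z)}{\Theta_{21}(z)\varphi(z)+\Theta_{22}(z)}$$ for some function $\varphi\in\widetilde{\mathbf{N}}_0$.
   Context: Classes. $\mathbb{C}^+$ is the open upper half plane. For $w$ meromorphic on $\mathbb{C}^+$, $\rho(w)\subset\mathbb{C}^+$ is its domain of analyticity and $K_w(z,\zeta)=\frac{w(z)-\overline{w(\zeta)}}{z-\bar\zeta}$ for $z,\zeta\in\rho(w)$. For an integer $\kappa\ge 0$, $\mathbf{N}_\kappa$ is the set of $w$ meromorphic on $\mathbb{C}^+$ such that all matrices $[K_w(z_j,z_i)]_{i,j=1}^m$ ($m\ge1$, $z_i\in\rho(w)$) have at most $\kappa$ negative eigenvalues, and at least one has exactly $\kappa$. $\mathbf{N}_0$ is the Nevanlinna class (functions analytic on $\mathbb{C}^+$ with nonnegative imaginary part). $\widetilde{\mathbf{N}}_\kappa=\mathbf{N}_\kappa\cup\{\infty\}$, where $\infty$ is the function identically $\infty$. $\mathrm{sq}_-A$ is the number of negative eigenvalues (with multiplicity) of a Hermitian matrix $A$. Boundary limits. For $x\in\mathbb{R}$, $w(x)$, $w'(x)$ and $w_{-1}(x)$ denote the nontangential limits, as $z\to x$ from $\mathbb{C}^+$, of $w(z)$,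 $w'(z)$ and $(z-x)w(z)$ respectively, whenever these limits exist. Data. $\Omega=\{\{x_i\}_{i=1}^n,\{w_j\}_{j=1}^\ell,\{\gamma_j\}_{j=1}^\ell,\{\xi_k\}_{k=\ell+1}^n\}$, $0\le\ell\le n$, where $x_i$ are distinct real numbers, $w_j,\gamma_j\in\mathbb{R}$, $\xi_k\in\mathbb{R}\setminus\{0\}$. The Pick matrix $P=[p_{ij}]_{i,j=1}^n$ is the real symmetric matrix with: $p_{ij}=\frac{w_j-w_i}{x_j-x_i}$ for $i\ne j$ and $p_{ii}=\gamma_i$, for $i,j\le\ell$; $p_{ij}=p_{ji}=\frac{\xi_j}{x_j-x_i}$ for $i\le\ell<j$; $p_{ii}=-\xi_i$ and $p_{ij}=0$ $(i\neq j)$ for $i,j>\ell$. Also $X=\mathrm{diag}(x_1,\dots,x_n)$, $C=[w_1\ \cdots\ w_\ell\ \xi_{\ell+1}\ \cdots\ \xi_n]$, $E=[1\ \cdots\ 1\ 0\ \cdots\ 0]$ ($\ell$ ones), $J=\begin{bmatrix}0&-i\\ i&0\end{bmatrix}$. When $P$ is invertible, $\Theta(z)=\begin{bmatrix}\Theta_{11}(z)&\Theta_{12}(z)\\ \Theta_{21}(z)&\Theta_{22}(z)\end{bmatrix}=I_2-i\begin{bmatrix}C\\ E\end{bmatrix}(zI-X)^{-1}P^{-1}\begin{bmatrix}C^*&E^*\end{bmatrix}J$. For $\varphi\equiv\infty$ the formula is read projectively: $\mathbf{T}_\Theta[\infty]=\Theta_{11}/\Theta_{21}$. Interpolation conditions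 with inequalities at $x_i$: for $i\le\ell$: $w(x_i)=w_i$ and $-\infty<w'(x_i)\le\gamma_i$; for $i>\ell$: $-\infty<-\frac1{w_{-1}(x_i)}\le-\frac1{\xi_i}$. Master Boundary Interpolation Problem: with $\kappa:=\mathrm{sq}_-P$, find all functions $w\in\mathbf{N}_{\kappa'}$, for $\kappa'\le\kappa$, such that these conditions are satisfied at all but $\kappa-\kappa'$ of the points $x_1,\dots,x_n$. *)

theory Defs
  imports
    "HOL-Complex_Analysis.Complex_Analysis"
    "Jordan_Normal_Form.Char_Poly"
    "Jordan_Normal_Form.Gauss_Jordan_Elimination"
    "Jordan_Normal_Form.Schur_Decomposition"
begin

text \<open>
  A meromorphic function on the upper half plane is represented by a total function that is
  \<open>nicely_meromorphic_on\<close> it: removable singularities are removed, and the value at a pole is the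
  dummy \<open>0\<close>. Its values outside the open upper half plane are irrelevant.
\<close>

definition upper_half_plane :: "complex set" where
  "upper_half_plane = {z. Im z > 0}"

definition analyticity_domain :: "(complex \<Rightarrow> complex) \<Rightarrow> complex set" where
  "analyticity_domain w = {z \<in> upper_half_plane. w analytic_on {z}}"

definition nevanlinna_kernel :: "(complex \<Rightarrow> complex) \<Rightarrow> complex \<Rightarrow> complex \<Rightarrow> complex" where
  "nevanlinna_kernel w z \<zeta> = (w z - cnj (w \<zeta>)) / (z - cnj \<zeta>)"

definition kernel_matrix :: "(complex \<Rightarrow> complex) \<Rightarrow> nat \<Rightarrow> (nat \<Rightarrow> complex) \<Rightarrow> complex mat" where
  "kernel_matrix w m z = Matrix.mat m m (\<lambda>(i, j). nevanlinna_kernel w (z j) (z i))"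

text \<open>
  Number of negative eigenvalues of a Hermitian matrix. For such a matrix, the multiplicity of an
  eigenvalue is its order as a root of the characteristic polynomial.
\<close>

definition sq_neg :: "complex mat \<Rightarrow> nat" where
  "sq_neg A =
     (\<Sum>t\<in>{t::real. t < 0 \<and> eigenvalue A (complex_of_real t)}.
        Polynomial.order (complex_of_real t) (char_poly A))"

definition gen_nevanlinna :: "nat \<Rightarrow> (complex \<Rightarrow> complex) set" where
  "gen_nevanlinna \<kappa> = {w. w nicely_meromorphic_on upper_half_plane \<and>
     (\<forall>m\<ge>1. \<forall>z. (\<forall>i<m. z i \<in> analyticity_domain w) \<longrightarrow> sq_neg (kernel_matrix w m z) \<le> \<kappa>) \<and>
     (\<exists>m\<ge>1. \<exists>z. (\<forall>i<m. z i \<in> analyticity_domain w) \<and> sq_neg (kernel_matrix w m z) = \<kappa>)}"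

text \<open>\<open>None\<close> stands for the function identically equal to \<open>\<infinity>\<close>.\<close>

definition ext_gen_nevanlinna :: "nat \<Rightarrow> (complex \<Rightarrow> complex) option set" where
  "ext_gen_nevanlinna \<kappa> = insert None (Some ` gen_nevanlinna \<kappa>)"

definition stolz_angle :: "real \<Rightarrow> real \<Rightarrow> complex set" where
  "stolz_angle x a = {z. Im z > 0 \<and> \<bar>Re z - x\<bar> \<le> a * Im z}"

text \<open>
  With \<open>F = nhds c\<close> this says that \<open>c\<close> is the nontangential limit of \<open>f\<close> at \<open>x\<close>, with
  \<open>F = at_infinity\<close> that the nontangential limit is \<open>\<infinity>\<close>.
\<close>

definition nontangential_limit :: "(complex \<Rightarrow> complex) \<Rightarrow> real \<Rightarrow> complex filter \<Rightarrow> bool" where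
  "nontangential_limit f x F \<longleftrightarrow>
     (\<forall>a>0. filterlim f F (at (complex_of_real x) within stolz_angle x a))"

text \<open>
  Indices are shifted to start from \<open>0\<close>: the regular nodes are those with index \<open>i < n_reg\<close>,
  the singular ones those with \<open>n_reg \<le> i < n_pts\<close>. The value of \<open>val\<close> and \<open>slope\<close> at a singular
  index, and of \<open>resid\<close> at a regular index, is never used.
\<close>

record interp_data =
  n_pts :: nat
  n_reg :: nat
  node  :: "nat \<Rightarrow> real"  \<comment> \<open>\<open>x\<close>\<close>
  val   :: "nat \<Rightarrow> real"  \<comment> \<open>\<open>w\<close>\<close>
  slope :: "nat \<Rightarrow> real"  \<comment> \<open>\<open>\<gamma>\<close>\<close>
  resid :: "nat \<Rightarrow> real"  \<comment> \<open>\<open>\<xi>\<close>\<close>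

definition valid_data :: "interp_data \<Rightarrow> bool" where
  "valid_data \<Omega> \<longleftrightarrow> n_reg \<Omega> \<le> n_pts \<Omega> \<and> inj_on (node \<Omega>) {..<n_pts \<Omega>} \<and>
     (\<forall>k\<in>{n_reg \<Omega>..<n_pts \<Omega>}. resid \<Omega> k \<noteq> 0)"

definition pick_entry :: "interp_data \<Rightarrow> nat \<Rightarrow> nat \<Rightarrow> real" where
  "pick_entry \<Omega> i j =
     (if i < n_reg \<Omega> \<and> j < n_reg \<Omega> then
        if i = j then slope \<Omega> i else (val \<Omega> j - val \<Omega> i) / (node \<Omega> j - node \<Omega> i)
      else if i < n_reg \<Omega> then resid \<Omega> j / (node \<Omega> j - node \<Omega> i)
      else if j < n_reg \<Omega> then resid \<Omega> i / (node \<Omega> i - node \<Omega> j)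
      else if i = j then - resid \<Omega> i else 0)"

definition pick_matrix :: "interp_data \<Rightarrow> complex mat" where
  "pick_matrix \<Omega> =
     Matrix.mat (n_pts \<Omega>) (n_pts \<Omega>) (\<lambda>(i, j). complex_of_real (pick_entry \<Omega> i j))"

definition X_matrix :: "interp_data \<Rightarrow> complex mat" where
  "X_matrix \<Omega> =
     Matrix.mat (n_pts \<Omega>) (n_pts \<Omega>) (\<lambda>(i, j). if i = j then complex_of_real (node \<Omega> i) else 0)"

definition C_matrix :: "interp_data \<Rightarrow> complex mat" where
  "C_matrix \<Omega> =
     Matrix.mat 1 (n_pts \<Omega>) (\<lambda>(_, j). complex_of_real (if j < n_reg \<Omega> then val \<Omega> j else resid \<Omega> j))"

definition E_matrix :: "interp_data \<Rightarrow> complex mat" where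
  "E_matrix \<Omega> = Matrix.mat 1 (n_pts \<Omega>) (\<lambda>(_, j). if j < n_reg \<Omega> then 1 else 0)"

definition J_matrix :: "complex mat" where
  "J_matrix = mat_of_rows_list 2 [[0, - \<i>], [\<i>, 0]]"

text \<open>The inverse of an invertible matrix; unspecified for other matrices.\<close>

definition matinv :: "complex mat \<Rightarrow> complex mat" where
  "matinv A = the (mat_inverse A)"

text \<open>The block row \<open>[C\<^sup>* E\<^sup>*]\<close> is the adjoint of the block column of \<open>C\<close> over \<open>E\<close>.\<close>

definition Theta :: "interp_data \<Rightarrow> complex \<Rightarrow> complex mat" where
  "Theta \<Omega> z =
     (let CE = append_rows (C_matrix \<Omega>) (E_matrix \<Omega>)
      in 1\<^sub>m 2 - \<i> \<cdot>\<^sub>m (CE * matinv (z \<cdot>\<^sub>m 1\<^sub>m (n_pts \<Omega>) - X_matrix \<Omega>) * matinv (pick_matrix \<Omega>)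
                        * mat_adjoint CE * J_matrix))"

fun lft_num :: "(complex \<Rightarrow> complex mat) \<Rightarrow> (complex \<Rightarrow> complex) option \<Rightarrow> complex \<Rightarrow> complex" where
  "lft_num \<Theta> (Some \<phi>) z = \<Theta> z $$ (0, 0) * \<phi> z + \<Theta> z $$ (0, 1)"
| "lft_num \<Theta> None z = \<Theta> z $$ (0, 0)"

fun lft_den :: "(complex \<Rightarrow> complex mat) \<Rightarrow> (complex \<Rightarrow> complex) option \<Rightarrow> complex \<Rightarrow> complex" where
  "lft_den \<Theta> (Some \<phi>) z = \<Theta> z $$ (1, 0) * \<phi> z + \<Theta> z $$ (1, 1)"
| "lft_den \<Theta> None z = \<Theta> z $$ (1, 0)"

text \<open>
  Equality \<open>w = T\<^sub>\<Theta>[\<phi>]\<close> of meromorphic functions, i.e. off a set without limit points in the upper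
  half plane. The denominator must not vanish identically: in that case \<open>T\<^sub>\<Theta>[\<phi>] \<equiv> \<infinity>\<close>, which is not
  a meromorphic function.
\<close>

definition is_lft ::
  "(complex \<Rightarrow> complex) \<Rightarrow> (complex \<Rightarrow> complex mat) \<Rightarrow> (complex \<Rightarrow> complex) option \<Rightarrow> bool" where
  "is_lft w \<Theta> \<phi> \<longleftrightarrow>
     (\<forall>\<^sub>\<approx>z\<in>upper_half_plane. lft_den \<Theta> \<phi> z \<noteq> 0 \<and> w z = lft_num \<Theta> \<phi> z / lft_den \<Theta> \<phi> z)"

text \<open>
  At a singular node, \<open>w\<^sub>-\<^sub>1(x\<^sub>i)\<close> may be \<open>\<infinity>\<close>, and then \<open>-1/w\<^sub>-\<^sub>1(x\<^sub>i) = 0\<close>. For instance,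
  \<open>w(z) = 1/z\<^sup>2\<close> satisfies the condition at \<open>x\<^sub>i = 0\<close> if \<open>\<xi>\<^sub>i < 0\<close>. On the other hand
  \<open>w\<^sub>-\<^sub>1(x\<^sub>i) = 0\<close> violates it, as then \<open>-1/w\<^sub>-\<^sub>1(x\<^sub>i)\<close> is not finite.
\<close>

definition interp_cond :: "interp_data \<Rightarrow> (complex \<Rightarrow> complex) \<Rightarrow> nat \<Rightarrow> bool" where
  "interp_cond \<Omega> w i \<longleftrightarrow>
     (let x = node \<Omega> i in
      if i < n_reg \<Omega> then
        nontangential_limit w x (nhds (complex_of_real (val \<Omega> i))) \<and>
        (\<exists>d::real. nontangential_limit (deriv w) x (nhds (complex_of_real d)) \<and> d \<le> slope \<Omega> i)
      else
        (\<exists>r::real. r \<noteq> 0 \<and>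
           nontangential_limit (\<lambda>z. (z - complex_of_real x) * w z) x (nhds (complex_of_real r)) \<and>
           - 1 / r \<le> - 1 / resid \<Omega> i) \<or>
        (nontangential_limit (\<lambda>z. (z - complex_of_real x) * w z) x at_infinity \<and>
           0 \<le> - 1 / resid \<Omega> i))"

definition master_solution :: "interp_data \<Rightarrow> (complex \<Rightarrow> complex) \<Rightarrow> bool" where
  "master_solution \<Omega> w \<longleftrightarrow>
     (let \<kappa> = sq_neg (pick_matrix \<Omega>) in
      \<exists>\<kappa>'\<le>\<kappa>. w \<in> gen_nevanlinna \<kappa>' \<and> card {i. i < n_pts \<Omega> \<and> \<not> interp_cond \<Omega> w i} = \<kappa> - \<kappa>')"

end

theory Submission
  imports Defs
begin

text \<open>
  Let \<open>g(z) = (zI - X)\<^sup>-\<^sup>1(E\<^sup>*w(z) - C\<^sup>*)\<close>. Since \<open>P\<close> satisfies the Lyapunov identity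
  \<open>PX - XP = E\<^sup>*C - C\<^sup>*E\<close>, solving \<open>w = T\<^sub>\<Theta>[\<phi>]\<close> for \<open>\<phi>\<close> turns the Nevanlinna kernel of \<open>\<phi>\<close>
  into the Schur complement \<open>K\<^sub>w - g\<^sup>*P\<^sup>-\<^sup>1g\<close>, up to a rank-one factor. So \<open>w\<close> is a linear fractional transform
  of some \<open>\<phi>\<close> in the extended class \<open>N\<^sub>0\<close> iff \<open>K\<^sub>w\<close> bordered by \<open>P\<close> and \<open>g\<close> has \<open>\<kappa>\<close>
  negative squares.

  If \<open>w \<in> N\<^sub>\<kappa>\<^sub>'\<close> satisfies the interpolation conditions at all but \<open>k\<close> nodes, then moving points of
  the kernel vertically into the good nodes borders \<open>K\<^sub>w\<close> by these nodes without a new negative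
  square, and each of the remaining \<open>k\<close> nodes adds at most one; hence the bordered kernel has at
  most \<open>\<kappa>' + k\<close> negative squares. Conversely, if bordering by one more node \<open>f\<close> does not raise the
  number of negative squares, then the Schur complement with respect to a maximal negative subspace
  is positive semidefinite, and a Caratheodory-Julia argument for it shows that the interpolation
  condition holds at \<open>f\<close>. So every node violating its condition accounts for exactly one negative
  square, which gives \<open>k = \<kappa> - \<kappa>'\<close>.
\<close>

subsection \<open>Hermitian forms and their negative squares\<close>

text \<open>Only upper bounds on the number of negative squares are carried along: the bordered
  kernel contains the block \<open>P\<close>, so it never has fewer than \<kappa> of them, and an
  upper bound passes to finite subsets, rescalings and limits. Eigenvalues enter only where
  \<open>sq_neg\<close> is translated.

  A Caratheodory-Julia argument rests on the Cauchy-Schwarz inequality, while the kernel of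
  \<open>w\<close> is indefinite. The Schur complement restores positivity at the price of finitely
  many rank-one terms. As the negative subspace is spanned without using the node \<open>f\<close>
  itself, these terms are combinations of the two projective coordinates of \<open>w\<close> with
  coefficients continuous at \<open>f\<close>, and near \<open>f\<close> they can be absorbed into
  the classical estimates. Such a subspace is available exactly when removing \<open>f\<close> does
  not lower the number of negative squares; a violated condition therefore forces the number to
  drop.

  The conditions speak of boundary limits, so \<open>w\<close> has to be analytic at the points of
  the half plane close to the nodes. This is why a bound on the negative squares is turned into a
  bound on the number of poles.\<close>

definition hform :: "('a \<Rightarrow> 'a \<Rightarrow> complex) \<Rightarrow> 'a set \<Rightarrow> ('a \<Rightarrow> complex) \<Rightarrow> ('a \<Rightarrow> complex) \<Rightarrow> complex" where
  "hform H I u v = (\<Sum>i\<in>I. \<Sum>j\<in>I. cnj (u i) * H i j * v j)"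

text \<open>Symmetry is asked of all pairs of indices, so that no index set has to be carried along;
  a matrix or kernel given on part of the type is extended by 0, as in \<open>ent\<close>.\<close>

definition herm :: "('a \<Rightarrow> 'a \<Rightarrow> complex) \<Rightarrow> bool" where
  "herm H \<longleftrightarrow> (\<forall>i j. H j i = cnj (H i j))"

text \<open>\<open>neg_le H I k\<close>: the form has at most \<open>k\<close> negative squares, phrased by \<open>k\<close> functionals so that
  adding an index visibly costs at most one. \<open>neg_system H I m v\<close> witnesses at least \<open>m\<close> of them.\<close>

definition neg_le :: "('a \<Rightarrow> 'a \<Rightarrow> complex) \<Rightarrow> 'a set \<Rightarrow> nat \<Rightarrow> bool" where
  "neg_le H I k \<longleftrightarrow> (\<exists>l::nat \<Rightarrow> 'a \<Rightarrow> complex.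
     \<forall>x. (\<forall>r<k. (\<Sum>i\<in>I. l r i * x i) = 0) \<longrightarrow> 0 \<le> Re (hform H I x x))"

definition neg_system :: "('a \<Rightarrow> 'a \<Rightarrow> complex) \<Rightarrow> 'a set \<Rightarrow> nat \<Rightarrow> (nat \<Rightarrow> 'a \<Rightarrow> complex) \<Rightarrow> bool" where
  "neg_system H I m v \<longleftrightarrow> (\<forall>j<m. \<forall>k<m. hform H I (v j) (v k) = (if j = k then -1 else 0))"

lemma hform_eq: "hform H I u v = (\<Sum>i\<in>I. cnj (u i) * (\<Sum>j\<in>I. H i j * v j))"
  by (simp add: hform_def sum_distrib_left mult.assoc)

lemma hform_cong:
  "(\<And>i j. i \<in> I \<Longrightarrow> j \<in> I \<Longrightarrow> H i j = H' i j) \<Longrightarrow> (\<And>i. i \<in> I \<Longrightarrow> u i = u' i) \<Longrightarrow>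
   (\<And>i. i \<in> I \<Longrightarrow> v i = v' i) \<Longrightarrow> hform H I u v = hform H' I u' v'"
  by (auto simp: hform_def intro!: sum.cong)

lemma hform_add_right: "hform H I u (\<lambda>i. v i + w i) = hform H I u v + hform H I u w"
  by (simp add: hform_def algebra_simps sum.distrib)

lemma hform_add_left: "hform H I (\<lambda>i. v i + w i) u = hform H I v u + hform H I w u"
  by (simp add: hform_def algebra_simps sum.distrib)

lemma hform_scale_right: "hform H I u (\<lambda>i. c * v i) = c * hform H I u v"
  by (simp add: hform_def sum_distrib_left mult_ac)

lemma hform_scale_left: "hform H I (\<lambda>i. c * v i) u = cnj c * hform H I v u"
  by (simp add: hform_def sum_distrib_left mult_ac)

lemma hform_zero_right [simp]: "hform H I u (\<lambda>i. 0) = 0"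
  by (simp add: hform_def)

lemma hform_zero_left [simp]: "hform H I (\<lambda>i. 0) u = 0"
  by (simp add: hform_def)

lemma hform_sum_right:
  "finite J \<Longrightarrow> hform H I u (\<lambda>i. \<Sum>j\<in>J. c j * v j i) = (\<Sum>j\<in>J. c j * hform H I u (v j))"
  by (induction J rule: finite_induct) (auto simp: hform_add_right hform_scale_right)

lemma hform_sum_left:
  "finite J \<Longrightarrow> hform H I (\<lambda>i. \<Sum>j\<in>J. c j * v j i) u = (\<Sum>j\<in>J. cnj (c j) * hform H I (v j) u)"
  by (induction J rule: finite_induct) (auto simp: hform_add_left hform_scale_left)

lemma hform_comb:
  "hform H I (\<lambda>i. \<Sum>j<m. a j * v j i) (\<lambda>i. \<Sum>j<m. b j * v j i)
     = (\<Sum>j<m. \<Sum>k<m. cnj (a j) * b k * hform H I (v j) (v k))" for m :: nat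
  by (subst hform_sum_left, simp, subst hform_sum_right, simp)
     (simp add: sum_distrib_left mult.assoc)

lemma hform_cnj: "herm H \<Longrightarrow> hform H I v u = cnj (hform H I u v)"
proof -
  assume "herm H"
  hence *: "cnj (H i j) = H j i" for i j by (metis herm_def)
  have "cnj (hform H I u v) = (\<Sum>i\<in>I. \<Sum>j\<in>I. cnj (v j) * H j i * u i)"
    unfolding hform_def by (simp add: * mult_ac)
  also have "\<dots> = hform H I v u" unfolding hform_def by (rule sum.swap)
  finally show ?thesis by simp
qed

lemma hform_real: "herm H \<Longrightarrow> hform H I u u = of_real (Re (hform H I u u))"
  using hform_cnj[of H I u u] by (simp add: complex_eq_iff)

text \<open>Padding the system with zero rows gives a square matrix. Its row \<open>k\<close> is
  zero, so the transpose kills \<open>unit_vec m k\<close> and the determinant vanishes.\<close>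

lemma homogeneous_solution:
  fixes l :: "nat \<Rightarrow> nat \<Rightarrow> complex"
  assumes "k < m"
  obtains y where "\<exists>j<m. y j \<noteq> 0" "\<And>r. r < k \<Longrightarrow> (\<Sum>j<m. l r j * y j) = 0"
proof -
  define A where "A = Matrix.mat m m (\<lambda>(r, j). if r < k then l r j else 0)"
  have A: "A \<in> carrier_mat m m" by (simp add: A_def)
  have "transpose_mat A *\<^sub>v unit_vec m k = 0\<^sub>v m"
    using assms by (intro eq_vecI) (auto simp: A_def scalar_prod_def unit_vec_def)
  moreover have "unit_vec m k \<noteq> (0\<^sub>v m :: complex Matrix.vec)"
    using assms unit_vec_nonzero by blast
  ultimately have "Determinant.det (transpose_mat A) = 0"
    using det_0_iff_vec_prod_zero_field[of "transpose_mat A" m] A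
    by (metis transpose_carrier_mat unit_vec_carrier)
  hence "Determinant.det A = 0" using Determinant.det_transpose[OF A] by simp
  then obtain v where v: "v \<in> carrier_vec m" "v \<noteq> 0\<^sub>v m" "A *\<^sub>v v = 0\<^sub>v m"
    using det_0_iff_vec_prod_zero_field[OF A] by auto
  show ?thesis
  proof
    show "\<exists>j<m. Matrix.vec_index v j \<noteq> 0" using v(1,2) by (auto intro!: eq_vecI)
    fix r assume r: "r < k"
    have "Matrix.vec_index (A *\<^sub>v v) r = (\<Sum>j<m. l r j * Matrix.vec_index v j)"
      using r assms v(1) by (auto simp: A_def scalar_prod_def lessThan_atLeast0 intro!: sum.cong)
    thus "(\<Sum>j<m. l r j * Matrix.vec_index v j) = 0" using v(3) r assms by simp
  qed
qed

text \<open>A dimension count: if \<open>k < m\<close>, some nonzero combination of the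
  \<open>m\<close> vectors is annihilated by all \<open>k\<close> functionals, and the form would be
  both negative and nonnegative on it.\<close>

lemma neg_le_strict_bound:
  assumes le: "neg_le H I k"
    and neg: "\<And>y. \<exists>j<m. y j \<noteq> 0 \<Longrightarrow> Re (hform H I (\<lambda>i. \<Sum>j<m. y j * v j i) (\<lambda>i. \<Sum>j<m. y j * v j i)) < 0"
  shows "m \<le> k"
proof (rule ccontr)
  assume "\<not> m \<le> k"
  hence "k < m" by simp
  obtain l where l: "\<And>x. (\<And>r. r < k \<Longrightarrow> (\<Sum>i\<in>I. l r i * x i) = 0) \<Longrightarrow> 0 \<le> Re (hform H I x x)"
    using le unfolding neg_le_def by auto
  obtain y where y: "\<exists>j<m. y j \<noteq> 0" "\<And>r. r < k \<Longrightarrow> (\<Sum>j<m. (\<Sum>i\<in>I. l r i * v j i) * y j) = 0"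
    using homogeneous_solution[OF \<open>k < m\<close>, of "\<lambda>r j. \<Sum>i\<in>I. l r i * v j i"] by blast
  have "(\<Sum>i\<in>I. l r i * (\<Sum>j<m. y j * v j i)) = (\<Sum>j<m. (\<Sum>i\<in>I. l r i * v j i) * y j)" for r
    by (simp add: sum_distrib_left sum_distrib_right mult_ac sum.swap[of _ _ I])
  hence "0 \<le> Re (hform H I (\<lambda>i. \<Sum>j<m. y j * v j i) (\<lambda>i. \<Sum>j<m. y j * v j i))"
    using y(2) by (intro l) simp
  with neg[OF y(1)] show False by simp
qed

lemma mult_cnj_eq: "z * cnj z = (complex_of_real (cmod z))\<^sup>2"
  by (metis complex_norm_square of_real_power)

lemma sum_norm_sq_pos:
  fixes y :: "nat \<Rightarrow> complex"
  shows "\<exists>j<m. y j \<noteq> 0 \<Longrightarrow> 0 < (\<Sum>j<m. (cmod (y j))\<^sup>2)"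
  by (auto intro!: sum_pos2)

lemma neg_system_comb:
  assumes "neg_system H I m v"
  shows "hform H I (\<lambda>i. \<Sum>j<m. y j * v j i) (\<lambda>i. \<Sum>j<m. y j * v j i)
           = - of_real (\<Sum>j<m. (cmod (y j))\<^sup>2)"
proof -
  have "hform H I (\<lambda>i. \<Sum>j<m. y j * v j i) (\<lambda>i. \<Sum>j<m. y j * v j i)
     = (\<Sum>j<m. \<Sum>k<m. cnj (y j) * y k * (if j = k then -1 else 0))"
    unfolding hform_comb using assms by (auto simp: neg_system_def intro!: sum.cong)
  also have "\<dots> = (\<Sum>j<m. - (cnj (y j) * y j))"
    by (auto intro!: sum.cong simp: if_distrib cong: if_cong)
  also have "\<dots> = - of_real (\<Sum>j<m. (cmod (y j))\<^sup>2)"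
    by (simp add: sum_negf mult_cnj_eq mult.commute[of "cnj _"])
  finally show ?thesis .
qed

lemma neg_le_system_bound:
  assumes "neg_le H I k" "neg_system H I m v"
  shows "m \<le> k"
proof (rule neg_le_strict_bound[OF assms(1)])
  fix y :: "nat \<Rightarrow> complex" assume "\<exists>j<m. y j \<noteq> 0"
  from sum_norm_sq_pos[OF this] show "Re (hform H I (\<lambda>i. \<Sum>j<m. y j * v j i) (\<lambda>i. \<Sum>j<m. y j * v j i)) < 0"
    unfolding neg_system_comb[OF assms(2)] by simp
qed

lemma neg_system_extend:
  assumes "herm H" "neg_system H I m v" "\<And>j. j < m \<Longrightarrow> hform H I (v j) x = 0"
    and neg: "Re (hform H I x x) < 0"
  shows "neg_system H I (Suc m) (v(m := \<lambda>i. of_real (1 / sqrt (- Re (hform H I x x))) * x i))"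
proof -
  define s where "s = 1 / sqrt (- Re (hform H I x x))"
  have s: "s * s * Re (hform H I x x) = -1"
    using neg by (simp add: s_def field_simps real_sqrt_mult_self flip: power2_eq_square)
  have "complex_of_real s * (of_real s * hform H I x x) = of_real (s * s * Re (hform H I x x))"
    by (subst hform_real[OF assms(1)]) simp
  hence 1: "complex_of_real s * (of_real s * hform H I x x) = -1" by (simp only: s) simp
  have 2: "hform H I x (v j) = 0" if "j < m" for j
    using hform_cnj[OF assms(1), of I x "v j"] assms(3)[OF that] by simp
  show ?thesis
    unfolding neg_system_def s_def[symmetric]
    using assms(2,3) 1 2
    by (auto simp: neg_system_def less_Suc_eq hform_scale_left hform_scale_right)
qed

lemma neg_system_exists:
  assumes "herm H" "\<not> neg_le H I k" "m \<le> Suc k"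
  shows "\<exists>v. neg_system H I m v"
  using assms(3)
proof (induction m)
  case 0
  show ?case by (auto simp: neg_system_def)
next
  case (Suc m)
  then obtain v where v: "neg_system H I m v" by auto
  \<comment> \<open>Orthogonality to the vectors found so far is a system of
    \<open>m \<le> k\<close> functionals; padded by zeros to \<open>k\<close> of them, it is the
    test family against which \<open>neg_le\<close> fails.\<close>
  define l where "l r j = (if r < m then \<Sum>i\<in>I. cnj (v r i) * H i j else 0)" for r j
  have l: "(\<Sum>j\<in>I. l r j * x j) = hform H I (v r) x" if "r < m" for r x
    using that by (simp add: l_def hform_def sum_distrib_right) (rule sum.swap)
  obtain x where x: "\<forall>r<k. (\<Sum>i\<in>I. l r i * x i) = 0" "Re (hform H I x x) < 0"
    using assms(2) unfolding neg_le_def by (metis not_le)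
  have "hform H I (v r) x = 0" if "r < m" for r
    using x(1) l[OF that, of x] that Suc.prems by auto
  from neg_system_extend[OF assms(1) v this x(2)] show ?case by blast
qed

lemma neg_le_mono: "neg_le H I k \<Longrightarrow> k \<le> k' \<Longrightarrow> neg_le H I k'"
  unfolding neg_le_def by (meson order_less_le_trans)

lemma neg_le_iff: "herm H \<Longrightarrow> neg_le H I k \<longleftrightarrow> \<not> (\<exists>v. neg_system H I (Suc k) v)"
  using neg_system_exists[of H I k "Suc k"] neg_le_system_bound[of H I k "Suc k"] by fastforce

text \<open>The expression is the value of the form at the component of \<open>u\<close> orthogonal
  to the system. As the vectors have square -1, this component is \<open>u\<close> plus, not minus,
  the sum of the \<open>hform H I (v j) u\<close> times \<open>v j\<close>. A negative value would
  extend the system to \<open>m + 1\<close> vectors.\<close>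

lemma neg_system_projection:
  assumes "herm H" "neg_system H I m v" "neg_le H I m"
  shows "0 \<le> Re (hform H I u u) + (\<Sum>j<m. (cmod (hform H I (v j) u))\<^sup>2)"
proof (rule ccontr)
  assume neg: "\<not> ?thesis"
  define b where "b j = hform H I (v j) u" for j
  define p where "p i = (\<Sum>j<m. b j * v j i)" for i
  have vp: "hform H I (v k) p = - b k" if "k < m" for k
  proof -
    have "hform H I (v k) p = (\<Sum>j<m. b j * (if k = j then -1 else 0))"
      unfolding p_def using assms(2) that
      by (subst hform_sum_right) (auto simp: neg_system_def intro!: sum.cong)
    thus ?thesis using that by (simp add: if_distrib cong: if_cong)
  qed
  have up: "hform H I u p = of_real (\<Sum>j<m. (cmod (b j))\<^sup>2)"
    unfolding p_def
    by (subst hform_sum_right)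
       (auto simp: mult_cnj_eq b_def hform_cnj[OF assms(1), of I u] intro!: sum.cong)
  have pu: "hform H I p u = of_real (\<Sum>j<m. (cmod (b j))\<^sup>2)"
    by (subst hform_cnj[OF assms(1)]) (simp add: up)
  have pp: "hform H I p p = - of_real (\<Sum>j<m. (cmod (b j))\<^sup>2)"
    unfolding p_def by (rule neg_system_comb[OF assms(2)])
  have orth: "hform H I (v k) (\<lambda>i. u i + p i) = 0" if "k < m" for k
    by (simp add: hform_add_right vp[OF that]) (simp add: b_def)
  have "hform H I (\<lambda>i. u i + p i) (\<lambda>i. u i + p i) = hform H I u u + of_real (\<Sum>j<m. (cmod (b j))\<^sup>2)"
    by (simp add: hform_add_right hform_add_left up pu pp)
  hence "Re (hform H I (\<lambda>i. u i + p i) (\<lambda>i. u i + p i)) < 0"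
    using neg by (simp add: b_def)
  from neg_le_system_bound[OF assms(3) neg_system_extend[OF assms(1,2) orth this]]
  show False by simp
qed

text \<open>The functionals for \<open>G t\<close> need not converge, so the bound is passed to the
  limit by contradiction: \<open>k + 1\<close> normalised negative vectors for \<open>H\<close> are
  kept fixed and stay negative for every \<open>G t\<close> that is entrywise close to
  \<open>H\<close>.\<close>

lemma neg_le_limit:
  assumes "finite I" "herm H" "F \<noteq> bot"
    and lim: "\<And>i j. i \<in> I \<Longrightarrow> j \<in> I \<Longrightarrow> ((\<lambda>t. G t i j) \<longlongrightarrow> H i j) F"
    and le: "\<forall>\<^sub>F t in F. neg_le (G t) I k"
  shows "neg_le H I k"
proof (rule ccontr)
  assume "\<not> neg_le H I k"
  then obtain v where v: "neg_system H I (Suc k) v"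
    using neg_system_exists[OF assms(2)] by blast
  \<comment> \<open>By Cauchy-Schwarz an entrywise error \<open>e\<close> perturbs the form by at
    most \<open>e * (k + 1)\<close> times the sum of the squares of the coefficients; this
    \<open>e\<close> makes it half of that sum.\<close>
  define e where "e = 1 / (2 * real (Suc k))"
  have e: "e > 0" by (simp add: e_def)
  have conv: "((\<lambda>t. hform (G t) I (v a) (v b)) \<longlongrightarrow> hform H I (v a) (v b)) F" for a b
    unfolding hform_def by (intro tendsto_sum tendsto_mult tendsto_const lim)
  have "\<forall>\<^sub>F t in F. \<forall>a\<in>{..k}. \<forall>b\<in>{..k}. dist (hform (G t) I (v a) (v b)) (hform H I (v a) (v b)) < e"
    by (intro eventually_ball_finite ballI finite_atMost tendstoD[OF conv e])
  with le have "\<forall>\<^sub>F t in F. neg_le (G t) I k \<and>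
      (\<forall>a\<in>{..k}. \<forall>b\<in>{..k}. dist (hform (G t) I (v a) (v b)) (hform H I (v a) (v b)) < e)"
    by eventually_elim auto
  from eventually_happens'[OF assms(3) this] obtain t where t: "neg_le (G t) I k"
      "\<And>a b. a \<le> k \<Longrightarrow> b \<le> k \<Longrightarrow> cmod (hform (G t) I (v a) (v b) - hform H I (v a) (v b)) < e"
    by (auto simp: dist_norm)
  have "Suc k \<le> k"
  proof (rule neg_le_strict_bound[OF t(1)])
    fix y :: "nat \<Rightarrow> complex" assume y: "\<exists>j<Suc k. y j \<noteq> 0"
    let ?x = "\<lambda>i. \<Sum>j<Suc k. y j * v j i"
    define N where "N = (\<Sum>j<Suc k. (cmod (y j))\<^sup>2)"
    have "N > 0" unfolding N_def by (rule sum_norm_sq_pos[OF y])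
    have "hform (G t) I ?x ?x - hform H I ?x ?x
       = (\<Sum>a<Suc k. \<Sum>b<Suc k. cnj (y a) * y b * (hform (G t) I (v a) (v b) - hform H I (v a) (v b)))"
      unfolding hform_comb by (simp only: sum_subtractf right_diff_distrib)
    also have "cmod \<dots> \<le> (\<Sum>a<Suc k. \<Sum>b<Suc k. cmod (y a) * cmod (y b) * e)"
    proof (intro order_trans[OF norm_sum] sum_mono)
      fix a b assume "a \<in> {..<Suc k}" "b \<in> {..<Suc k}"
      hence "cmod (hform (G t) I (v a) (v b) - hform H I (v a) (v b)) \<le> e"
        using t(2)[of a b] by simp
      thus "cmod (cnj (y a) * y b * (hform (G t) I (v a) (v b) - hform H I (v a) (v b)))
         \<le> cmod (y a) * cmod (y b) * e"
        by (simp add: norm_mult mult_left_mono)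
    qed
    also have "\<dots> = e * (\<Sum>a<Suc k. cmod (y a))\<^sup>2"
      by (simp only: power2_eq_square sum_product sum_distrib_left mult_ac)
    also have "\<dots> \<le> e * (real (Suc k) * N)"
    proof (intro mult_left_mono)
      show "(\<Sum>a<Suc k. cmod (y a))\<^sup>2 \<le> real (Suc k) * N"
        unfolding N_def using sum_squared_le_sum_of_squares[of "\<lambda>a. cmod (y a)" "{..<Suc k}"]
        by (simp add: mult.commute)
    qed (use e in auto)
    also have "\<dots> = N / 2" by (simp add: e_def field_simps)
    finally have "cmod (hform (G t) I ?x ?x - hform H I ?x ?x) \<le> N / 2" .
    moreover have "Re (hform H I ?x ?x) = - N"
      unfolding neg_system_comb[OF v] N_def by simp
    ultimately show "Re (hform (G t) I ?x ?x) < 0"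
      using abs_Re_le_cmod[of "hform (G t) I ?x ?x - hform H I ?x ?x"] \<open>N > 0\<close> by (simp add: abs_le_iff)
  qed
  thus False by simp
qed

subsection \<open>Negative eigenvalues of Hermitian matrices\<close>

lemma order_prod_linear:
  fixes c :: "'a \<Rightarrow> complex"
  assumes "finite A"
  shows "Polynomial.order t (\<Prod>a\<in>A. [:- c a, 1:]) = card {a\<in>A. c a = t}"
  using assms
proof (induction A rule: finite_induct)
  case empty
  show ?case by (simp add: order_0I)
next
  case (insert x A)
  have "{a \<in> insert x A. c a = t} = (if c x = t then insert x {a\<in>A. c a = t} else {a\<in>A. c a = t})"
    by auto
  moreover have "Polynomial.order t [:- c x, 1:] = (if c x = t then 1 else 0)"
    using order_power_n_n[of t 1] by (auto intro: order_0I)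
  moreover have "[:- c x, 1:] * (\<Prod>a\<in>A. [:- c a, 1:]) \<noteq> 0"
    using insert.hyps unfolding mult_eq_0_iff by (simp add: prod_zero_iff)
  ultimately show ?case
    using insert by (simp add: order_mult del: mult_pCons_left)
qed

section \<open>Spectral theorem for Hermitian matrices\<close>

locale hermitian_matrix =
  fixes A :: "complex mat" and n :: nat
  assumes A: "A \<in> carrier_mat n n"
    and herm: "\<And>i j. i < n \<Longrightarrow> j < n \<Longrightarrow> A $$ (j, i) = cnj (A $$ (i, j))"
begin

definition ent :: "nat \<Rightarrow> nat \<Rightarrow> complex" where
  "ent i j = (if i < n \<and> j < n then A $$ (i, j) else 0)"

definition dot :: "(nat \<Rightarrow> complex) \<Rightarrow> (nat \<Rightarrow> complex) \<Rightarrow> complex" where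
  "dot x y = (\<Sum>i<n. cnj (x i) * y i)"

definition app :: "(nat \<Rightarrow> complex) \<Rightarrow> nat \<Rightarrow> complex" where
  "app x i = (\<Sum>j<n. ent i j * x j)"

lemma herm_ent: "herm ent"
  unfolding herm_def ent_def
proof (intro allI)
  fix i j
  show "(if j < n \<and> i < n then A $$ (j, i) else 0) = cnj (if i < n \<and> j < n then A $$ (i, j) else 0)"
    using herm[of i j] by (cases "i < n"; cases "j < n") simp_all
qed

lemma dot_cong: "(\<And>i. i < n \<Longrightarrow> x i = x' i) \<Longrightarrow> (\<And>i. i < n \<Longrightarrow> y i = y' i) \<Longrightarrow> dot x y = dot x' y'"
  by (simp add: dot_def)

lemma dot_add: "dot x (\<lambda>i. y i + z i) = dot x y + dot x z"
  by (simp add: dot_def algebra_simps sum.distrib)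

lemma dot_diff: "dot x (\<lambda>i. y i - z i) = dot x y - dot x z"
  by (simp add: dot_def algebra_simps sum_subtractf)

lemma dot_scale: "dot x (\<lambda>i. c * y i) = c * dot x y"
  by (simp add: dot_def sum_distrib_left mult_ac)

lemma dot_scale_left: "dot (\<lambda>i. c * y i) x = cnj c * dot y x"
  by (simp add: dot_def sum_distrib_left mult_ac)

lemma dot_sum: "finite J \<Longrightarrow> dot x (\<lambda>i. \<Sum>j\<in>J. c j * v j i) = (\<Sum>j\<in>J. c j * dot x (v j))"
  by (simp add: dot_def sum_distrib_left sum_distrib_right mult_ac) (rule sum.swap)

lemma dot_orthonormal_sum:
  fixes m :: nat
  assumes "a < m" and "\<And>b. b < m \<Longrightarrow> dot (u a) (u b) = (if a = b then 1 else 0)"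
  shows "dot (u a) (\<lambda>i. \<Sum>b<m. s b * u b i) = s a"
proof -
  have "dot (u a) (\<lambda>i. \<Sum>b<m. s b * u b i) = (\<Sum>b<m. s b * (if a = b then 1 else 0))"
    by (subst dot_sum) (auto simp: assms(2) intro!: sum.cong)
  thus ?thesis using assms(1) by (simp add: if_distrib cong: if_cong)
qed

lemma dot_cnj: "dot y x = cnj (dot x y)"
  by (simp add: dot_def mult.commute)

lemma dot_self: "dot x x = of_real (\<Sum>i<n. (cmod (x i))\<^sup>2)"
  by (simp add: dot_def mult_cnj_eq mult.commute[of "cnj _"])

lemma app_diff: "app (\<lambda>i. y i - z i) i = app y i - app z i"
  by (simp add: app_def algebra_simps sum_subtractf)

lemma app_scale: "app (\<lambda>i. c * y i) i = c * app y i"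
  by (simp add: app_def sum_distrib_left mult_ac)

lemma app_sum: "app (\<lambda>i. \<Sum>j\<in>J. c j * v j i) i = (\<Sum>j\<in>J. c j * app (v j) i)"
  by (simp add: app_def sum_distrib_left sum_distrib_right mult_ac) (rule sum.swap)

lemma hform_dot: "hform ent {..<n} x y = dot x (app y)"
  by (simp add: hform_eq dot_def app_def)

lemma dot_app: "dot x (app y) = cnj (dot y (app x))"
  unfolding hform_dot[symmetric] by (rule hform_cnj[OF herm_ent])

text \<open>Gram-Schmidt orthonormalisation of the flag of a triangularisation diagonalises a
  Hermitian matrix, because the orthogonal complement of an invariant subspace is invariant.\<close>

lemma spectral:
  obtains u :: "nat \<Rightarrow> nat \<Rightarrow> complex" and c :: "nat \<Rightarrow> real" where
    "\<And>a b. a < n \<Longrightarrow> b < n \<Longrightarrow> dot (u a) (u b) = (if a = b then 1 else 0)"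
    "\<And>a i. a < n \<Longrightarrow> i < n \<Longrightarrow> app (u a) i = of_real (c a) * u a i"
    "\<And>x i. i < n \<Longrightarrow> x i = (\<Sum>a<n. dot (u a) x * u a i)"
    "char_poly A = (\<Prod>a<n. [:- of_real (c a), 1:])"
proof -
  obtain es where es: "char_poly A = (\<Prod>a\<leftarrow>es. [:- a, 1:])" "length es = n"
    using char_poly_factorized[OF A] by blast
  obtain B P Q where BPQ: "schur_decomposition A es = (B, P, Q)"
    by (metis prod_cases3)
  from schur_decomposition[OF A es(1) this]
  have wit: "similar_mat_wit A B P Q" and ut: "upper_triangular B" and dg: "diag_mat B = es" by auto
  from similar_mat_witD2[OF A wit]
  have PQ: "P * Q = 1\<^sub>m n" and QP: "Q * P = 1\<^sub>m n" and AB: "A = P * B * Q"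
    and B: "B \<in> carrier_mat n n" and P: "P \<in> carrier_mat n n" and Q: "Q \<in> carrier_mat n n" by auto
  define p where "p k i = P $$ (i, k)" for k i
  define q where "q r x = (\<Sum>i<n. Q $$ (r, i) * x i)" for r and x :: "nat \<Rightarrow> complex"
  define l where "l k = B $$ (k, k)" for k
  have "A * P = P * B * (Q * P)" unfolding AB using P B Q by (simp add: assoc_mult_mat[of _ n n _ n _ n])
  hence AP: "A * P = P * B" using QP P B by simp
  have qp: "q r (p k) = (if r = k then 1 else 0)" if "r < n" "k < n" for r k
  proof -
    have "(Q * P) $$ (r, k) = q r (p k)"
      using that P Q by (auto simp: q_def p_def scalar_prod_def lessThan_atLeast0 intro!: sum.cong)
    thus ?thesis using QP that by simp
  qed
  have xp: "x i = (\<Sum>k<n. q k x * p k i)" if "i < n" for x i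
  proof -
    have "(\<Sum>k<n. q k x * p k i) = (\<Sum>k<n. \<Sum>j<n. P $$ (i, k) * Q $$ (k, j) * x j)"
      by (simp add: q_def p_def sum_distrib_left sum_distrib_right mult_ac)
    also have "\<dots> = (\<Sum>j<n. \<Sum>k<n. P $$ (i, k) * Q $$ (k, j) * x j)"
      by (rule sum.swap)
    also have "\<dots> = (\<Sum>j<n. (P * Q) $$ (i, j) * x j)"
      using that P Q by (auto simp: scalar_prod_def lessThan_atLeast0 sum_distrib_right intro!: sum.cong)
    also have "\<dots> = x i" using that by (simp add: PQ if_distrib[of "\<lambda>y. y * _"] cong: if_cong)
    finally show ?thesis by simp
  qed
  have Ap: "app (p k) i = l k * p k i + (\<Sum>j<k. B $$ (j, k) * p j i)" if "k < n" "i < n" for k i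
  proof -
    have "app (p k) i = (A * P) $$ (i, k)"
      using that P A by (auto simp: app_def ent_def p_def scalar_prod_def lessThan_atLeast0 intro!: sum.cong)
    also have "\<dots> = (\<Sum>j<n. p j i * B $$ (j, k))"
      unfolding AP using that P B by (auto simp: p_def scalar_prod_def lessThan_atLeast0 intro!: sum.cong)
    also have "\<dots> = (\<Sum>j<Suc k. p j i * B $$ (j, k))"
    proof (intro sum.mono_neutral_right ballI)
      fix j assume "j \<in> {..<n} - {..<Suc k}"
      hence "B $$ (j, k) = 0" using ut B by auto
      thus "p j i * B $$ (j, k) = 0" by simp
    qed (use that in auto)
    finally show ?thesis by (simp add: l_def mult.commute)
  qed
  \<comment> \<open>The columns \<open>p k\<close> of \<open>P\<close> span the invariant flag. The
    last two clauses say that \<open>u a\<close> lies in the span of the columns up to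
    \<open>a\<close>, and that the first \<open>m\<close> columns lie in the span of the
    \<open>u b\<close>.\<close>
  define good where "good m u \<longleftrightarrow>
      (\<forall>a<m. \<forall>b<m. dot (u a) (u b) = (if a = b then 1 else 0)) \<and>
      (\<forall>a<m. \<forall>i<n. app (u a) i = l a * u a i) \<and>
      (\<forall>a<m. \<forall>r<n. a < r \<longrightarrow> q r (u a) = 0) \<and>
      (\<forall>k<m. \<exists>s. \<forall>i<n. p k i = (\<Sum>b<m. s b * u b i))" for m and u :: "nat \<Rightarrow> nat \<Rightarrow> complex"
  have "\<exists>u. good m u" if "m \<le> n" for m
    using that
  proof (induction m)
    case 0
    show ?case by (simp add: good_def)
  next
    case (Suc m)
    then obtain u where u: "good m u" by auto
    have m: "m < n" using Suc.prems by simp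
    have on: "dot (u a) (u b) = (if a = b then 1 else 0)" if "a < m" "b < m" for a b
      using u that by (simp add: good_def)
    have ev: "app (u a) i = l a * u a i" if "a < m" "i < n" for a i
      using u that by (simp add: good_def)
    have q0: "q r (u a) = 0" if "a < m" "a < r" "r < n" for a r
      using u that by (simp add: good_def)
    have "\<forall>k\<in>{..<m}. \<exists>s. \<forall>i<n. p k i = (\<Sum>b<m. s b * u b i)"
      using u unfolding good_def by (elim conjE) simp
    from bchoice[OF this] obtain S where S: "p k i = (\<Sum>b<m. S k b * u b i)" if "k < m" "i < n" for k i
      by auto
    define w where "w i = p m i - (\<Sum>b<m. dot (u b) (p m) * u b i)" for i
    have orth: "dot (u a) w = 0" if "a < m" for a
      unfolding w_def dot_diff using that on by (subst dot_orthonormal_sum) auto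
    have qlin: "q r w = q r (p m) - (\<Sum>b<m. dot (u b) (p m) * q r (u b))" for r
    proof -
      have "q r w = q r (p m) - (\<Sum>i<n. \<Sum>b<m. Q $$ (r, i) * (dot (u b) (p m) * u b i))"
        unfolding w_def q_def by (simp add: right_diff_distrib sum_subtractf sum_distrib_left)
      also have "(\<Sum>i<n. \<Sum>b<m. Q $$ (r, i) * (dot (u b) (p m) * u b i)) =
          (\<Sum>b<m. \<Sum>i<n. Q $$ (r, i) * (dot (u b) (p m) * u b i))" by (rule sum.swap)
      also have "\<dots> = (\<Sum>b<m. dot (u b) (p m) * q r (u b))"
        by (simp add: q_def sum_distrib_left mult_ac)
      finally show ?thesis .
    qed
    have qw: "q r w = (if r = m then 1 else 0)" if "m \<le> r" "r < n" for r
      unfolding qlin using that m q0 qp by simp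
    \<comment> \<open>In the basis of the columns, the coordinate of \<open>w\<close> with index
      \<open>m\<close> is 1, because the earlier \<open>u b\<close> contribute nothing to
      it.\<close>
    have "dot w w \<noteq> 0"
    proof
      assume "dot w w = 0"
      hence "(\<Sum>i<n. (cmod (w i))\<^sup>2) = 0" unfolding dot_self by (simp only: of_real_eq_0_iff)
      hence "w i = 0" if "i < n" for i
        using that sum_nonneg_eq_0_iff[of "{..<n}" "\<lambda>i. (cmod (w i))\<^sup>2"] by auto
      hence "q m w = 0" by (simp add: q_def)
      with qw[of m] m show False by simp
    qed
    define N where "N = sqrt (\<Sum>i<n. (cmod (w i))\<^sup>2)"
    have ww: "dot w w = of_real (N\<^sup>2)"
      unfolding dot_self N_def by (simp add: sum_nonneg)
    have N0: "N \<noteq> 0" using ww \<open>dot w w \<noteq> 0\<close> by auto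
    define d where "d b = (\<Sum>j<m. B $$ (j, m) * S j b) + dot (u b) (p m) * (l m - l b)" for b
    have Aw: "app w i = l m * w i + (\<Sum>b<m. d b * u b i)" if i: "i < n" for i
    proof -
      have "app w i = app (p m) i - (\<Sum>b<m. dot (u b) (p m) * app (u b) i)"
        unfolding w_def app_diff app_sum ..
      also have "app (p m) i = l m * p m i + (\<Sum>b<m. (\<Sum>j<m. B $$ (j, m) * S j b) * u b i)"
      proof -
        have "(\<Sum>j<m. B $$ (j, m) * p j i) = (\<Sum>j<m. \<Sum>b<m. B $$ (j, m) * S j b * u b i)"
          using S i by (simp add: sum_distrib_left mult.assoc)
        also have "\<dots> = (\<Sum>b<m. \<Sum>j<m. B $$ (j, m) * S j b * u b i)" by (rule sum.swap)
        finally show ?thesis unfolding Ap[OF m i] by (simp add: sum_distrib_right)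
      qed
      also have "(\<Sum>b<m. dot (u b) (p m) * app (u b) i) = (\<Sum>b<m. dot (u b) (p m) * (l b * u b i))"
        using ev i by simp
      finally have "app w i = l m * p m i + (\<Sum>b<m. (\<Sum>j<m. B $$ (j, m) * S j b) * u b i)
          - (\<Sum>b<m. dot (u b) (p m) * (l b * u b i))" .
      thus ?thesis
        by (simp only: w_def d_def) (simp add: algebra_simps sum.distrib sum_subtractf sum_distrib_left)
    qed
    \<comment> \<open>\<open>d\<close> collects the components of \<open>app w\<close> along the
      earlier vectors. Symmetry moves \<open>app\<close> onto the eigenvector \<open>u a\<close>,
      which is orthogonal to \<open>w\<close>.\<close>
    have d0: "d a = 0" if a: "a < m" for a
    proof -
      have "dot (u a) (app w) = dot (u a) (\<lambda>i. l m * w i + (\<Sum>b<m. d b * u b i))"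
        by (rule dot_cong) (auto simp: Aw)
      also have "\<dots> = d a"
        unfolding dot_add dot_scale orth[OF a] using a on by (subst dot_orthonormal_sum) auto
      also have "dot (u a) (app w) = cnj (dot w (app (u a)))" by (rule dot_app)
      also have "dot w (app (u a)) = dot w (\<lambda>i. l a * u a i)"
        by (rule dot_cong) (auto simp: ev a)
      also have "\<dots> = 0" unfolding dot_scale using orth[OF a] dot_cnj[of w "u a"] by simp
      finally show ?thesis by simp
    qed
    define cN where "cN = complex_of_real (1 / N)"
    define u' where "u' = u(m := \<lambda>i. cN * w i)"
    have u'm: "u' m = (\<lambda>i. cN * w i)" and u'l: "\<And>a. a < m \<Longrightarrow> u' a = u a"
      by (auto simp: u'_def)
    have "good (Suc m) u'"
      unfolding good_def
    proof (intro conjI allI impI)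
      fix a b assume "a < Suc m" "b < Suc m"
      moreover have "dot w (u a) = 0" if "a < m" for a using orth[OF that] dot_cnj[of w "u a"] by simp
      moreover have "dot (u' m) (u' m) = 1"
        unfolding u'm dot_scale dot_scale_left ww using N0 by (simp add: cN_def power2_eq_square)
      ultimately show "dot (u' a) (u' b) = (if a = b then 1 else 0)"
        using on orth by (auto simp: less_Suc_eq u'l u'm dot_scale dot_scale_left)
    next
      fix a i assume "a < Suc m" "i < n"
      thus "app (u' a) i = l a * u' a i"
        using ev Aw d0 by (auto simp: less_Suc_eq u'l u'm app_scale)
    next
      fix a r assume *: "a < Suc m" "r < n" "a < r"
      show "q r (u' a) = 0"
      proof (cases "a = m")
        case True
        have "q r (u' m) = cN * q r w"
          unfolding u'm q_def sum_distrib_left by (simp add: mult_ac)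
        thus ?thesis using qw[of r] * True by simp
      next
        case False
        thus ?thesis using * q0 by (simp add: u'l)
      qed
    next
      fix k assume k: "k < Suc m"
      show "\<exists>s. \<forall>i<n. p k i = (\<Sum>b<Suc m. s b * u' b i)"
      proof (cases "k = m")
        case True
        show ?thesis
          by (rule exI[of _ "\<lambda>b. if b = m then of_real N else dot (u b) (p m)"])
             (use N0 in \<open>auto simp: True u'l u'm w_def cN_def\<close>)
      next
        case False
        show ?thesis
          by (rule exI[of _ "\<lambda>b. if b = m then 0 else S k b"])
             (use False k S in \<open>auto simp: u'l\<close>)
      qed
    qed
    thus ?case by blast
  qed
  then obtain u where u: "good n u" by blast
  have on: "dot (u a) (u b) = (if a = b then 1 else 0)" if "a < n" "b < n" for a b
    using u that by (simp add: good_def)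
  have ev: "app (u a) i = l a * u a i" if "a < n" "i < n" for a i
    using u that by (simp add: good_def)
  have "\<forall>k\<in>{..<n}. \<exists>s. \<forall>i<n. p k i = (\<Sum>b<n. s b * u b i)"
    using u unfolding good_def by (elim conjE) simp
  from bchoice[OF this] obtain S where S: "p k i = (\<Sum>b<n. S k b * u b i)" if "k < n" "i < n" for k i
    by auto
  have exp: "x i = (\<Sum>a<n. dot (u a) x * u a i)" if i: "i < n" for x i
  proof -
    define s where "s b = (\<Sum>k<n. q k x * S k b)" for b
    have xs: "x i = (\<Sum>b<n. s b * u b i)" if "i < n" for i
    proof -
      have "x i = (\<Sum>k<n. \<Sum>b<n. q k x * S k b * u b i)"
        using xp[OF that, of x] S that by (simp add: sum_distrib_left mult.assoc)
      also have "\<dots> = (\<Sum>b<n. \<Sum>k<n. q k x * S k b * u b i)" by (rule sum.swap)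
      finally show ?thesis by (simp add: s_def sum_distrib_right)
    qed
    have "dot (u a) x = s a" if "a < n" for a
    proof -
      have "dot (u a) x = dot (u a) (\<lambda>i. \<Sum>b<n. s b * u b i)" by (rule dot_cong) (auto simp: xs)
      also have "\<dots> = s a" using that on by (subst dot_orthonormal_sum) auto
      finally show ?thesis .
    qed
    thus ?thesis using xs[OF i] by simp
  qed
  have lreal: "l a = of_real (Re (l a))" if a: "a < n" for a
  proof -
    have "hform ent {..<n} (u a) (u a) = dot (u a) (\<lambda>i. l a * u a i)"
      unfolding hform_dot by (rule dot_cong) (auto simp: ev a)
    also have "\<dots> = l a" unfolding dot_scale using on a by simp
    finally show ?thesis using hform_real[OF herm_ent, of "{..<n}" "u a"] by simp
  qed
  have "char_poly A = (\<Prod>a<n. [:- l a, 1:])"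
  proof -
    have "map (\<lambda>k. l k) [0..<n] = es"
      using dg B by (simp add: diag_mat_def l_def)
    hence "char_poly A = (\<Prod>a\<leftarrow>[0..<n]. [:- l a, 1:])"
      unfolding es(1) by (metis (no_types, lifting) list.map_comp comp_def map_eq_conv)
    thus ?thesis by (simp add: prod.list_conv_set_nth lessThan_atLeast0)
  qed
  also have "\<dots> = (\<Prod>a<n. [:- of_real (Re (l a)), 1:])"
    using lreal by (intro prod.cong) auto
  finally show ?thesis using that[of u "\<lambda>a. Re (l a)"] on ev exp lreal by (metis (no_types, lifting))
qed

text \<open>In an orthonormal eigenbasis the form is diagonal with the real entries
  \<open>c a\<close>, and \<open>sq_neg\<close> counts the negative ones. The eigenvectors belonging
  to them serve twice: as functionals for the upper bound and, normalised, as the negative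
  system.\<close>

lemma sq_neg_form:
  shows "neg_le ent {..<n} (sq_neg A)" and "\<exists>v. neg_system ent {..<n} (sq_neg A) v"
proof -
  obtain u c where on: "\<And>a b. a < n \<Longrightarrow> b < n \<Longrightarrow> dot (u a) (u b) = (if a = b then 1 else 0)"
    and ev: "\<And>a i. a < n \<Longrightarrow> i < n \<Longrightarrow> app (u a) i = of_real (c a) * u a i"
    and exp: "\<And>x i. i < n \<Longrightarrow> x i = (\<Sum>a<n. dot (u a) x * u a i)"
    and cp: "char_poly A = (\<Prod>a<n. [:- of_real (c a), 1:])"
    by (rule spectral) blast
  have "sq_neg A = (\<Sum>t\<in>c ` {a. a < n \<and> c a < 0}. card {a\<in>{..<n}. c a = t})"
    unfolding sq_neg_def
  proof (rule sum.cong)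
    show "{t. t < 0 \<and> eigenvalue A (complex_of_real t)} = c ` {a. a < n \<and> c a < 0}"
      unfolding eigenvalue_root_char_poly[OF A] cp by (auto simp: poly_prod)
    show "Polynomial.order (complex_of_real t) (char_poly A) = card {a\<in>{..<n}. c a = t}" for t
      unfolding cp by (subst order_prod_linear) auto
  qed
  also have "\<dots> = card (\<Union>t\<in>c ` {a. a < n \<and> c a < 0}. {a\<in>{..<n}. c a = t})"
    by (rule card_UN_disjoint[symmetric]) auto
  also have "(\<Union>t\<in>c ` {a. a < n \<and> c a < 0}. {a\<in>{..<n}. c a = t}) = {a. a < n \<and> c a < 0}"
    by auto
  finally have sq: "sq_neg A = card {a. a < n \<and> c a < 0}" .
  have "finite {a. a < n \<and> c a < 0}" by simp
  from ex_bij_betw_nat_finite[OF this] obtain e where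
    e: "bij_betw e {0..<sq_neg A} {a. a < n \<and> c a < 0}" unfolding sq by blast
  have en: "e j < n" "c (e j) < 0" if "j < sq_neg A" for j
    using bij_betwE[OF e] that by auto
  have einj: "e j = e k \<longleftrightarrow> j = k" if "j < sq_neg A" "k < sq_neg A" for j k
    using bij_betw_imp_inj_on[OF e] that by (auto simp: inj_on_def)
  have hu: "hform ent {..<n} (u a) (u b) = (if a = b then of_real (c a) else 0)" if "a < n" "b < n" for a b
  proof -
    have "hform ent {..<n} (u a) (u b) = dot (u a) (\<lambda>i. of_real (c b) * u b i)"
      unfolding hform_dot by (rule dot_cong) (auto simp: ev that)
    thus ?thesis unfolding dot_scale using on that by auto
  qed
  show "neg_le ent {..<n} (sq_neg A)"
    unfolding neg_le_def
  proof (intro exI[of _ "\<lambda>r i. cnj (u (e r) i)"] allI impI)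
    fix x assume x: "\<forall>r<sq_neg A. (\<Sum>i<n. cnj (u (e r) i) * x i) = 0"
    have x0: "dot (u a) x = 0" if "a < n" "c a < 0" for a
    proof -
      from that have "a \<in> e ` {0..<sq_neg A}" using bij_betw_imp_surj_on[OF e] by auto
      thus ?thesis using x by (auto simp: dot_def)
    qed
    have "hform ent {..<n} x x
       = hform ent {..<n} (\<lambda>i. \<Sum>a<n. dot (u a) x * u a i) (\<lambda>i. \<Sum>a<n. dot (u a) x * u a i)"
      by (rule hform_cong) (use exp in auto)
    also have "\<dots> = (\<Sum>a<n. \<Sum>b<n. cnj (dot (u a) x) * dot (u b) x * (if a = b then of_real (c a) else 0))"
      unfolding hform_comb using hu by (intro sum.cong) auto
    also have "\<dots> = (\<Sum>a<n. dot (u a) x * cnj (dot (u a) x) * of_real (c a))"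
      by (intro sum.cong) (auto simp: if_distrib cong: if_cong)
    also have "\<dots> = of_real (\<Sum>a<n. (cmod (dot (u a) x))\<^sup>2 * c a)"
      by (simp add: mult_cnj_eq)
    also have "Re \<dots> \<ge> 0"
      unfolding Re_complex_of_real by (intro sum_nonneg) (use x0 in \<open>metis lessThan_iff mult_nonneg_nonneg mult_zero_left norm_zero not_le power_zero_numeral zero_le_power2 order_refl\<close>)
    finally show "0 \<le> Re (hform ent {..<n} x x)" .
  qed
  have "neg_system ent {..<n} (sq_neg A) (\<lambda>j i. of_real (1 / sqrt (- c (e j))) * u (e j) i)"
    unfolding neg_system_def
  proof (intro allI impI)
    fix j k assume jk: "j < sq_neg A" "k < sq_neg A"
    have "1 / sqrt (- c (e j)) * (1 / sqrt (- c (e j)) * c (e j)) = -1"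
      using en[OF jk(1)] by (simp add: field_simps)
    hence "complex_of_real (1 / sqrt (- c (e j))) * (of_real (1 / sqrt (- c (e j))) * of_real (c (e j))) = -1"
      by (metis of_real_mult of_real_minus of_real_1)
    thus "hform ent {..<n} (\<lambda>i. of_real (1 / sqrt (- c (e j))) * u (e j) i)
            (\<lambda>i. of_real (1 / sqrt (- c (e k))) * u (e k) i) = (if j = k then -1 else 0)"
      unfolding hform_scale_left hform_scale_right complex_cnj_complex_of_real
        hu[OF en(1)[OF jk(1)] en(1)[OF jk(2)]] einj[OF jk]
      by (cases "j = k") (simp_all only: mult_ac simp_thms if_True if_False mult_zero_right mult_zero_left)
  qed
  thus "\<exists>v. neg_system ent {..<n} (sq_neg A) v" by blast
qed

end

lemma sq_neg_le_iff:
  assumes "hermitian_matrix A n"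
  shows "sq_neg A \<le> k \<longleftrightarrow> neg_le (hermitian_matrix.ent A n) {..<n} k"
  using hermitian_matrix.sq_neg_form[OF assms] neg_le_mono neg_le_system_bound by blast

subsection \<open>Kernels with finitely many negative squares\<close>

definition neg_le_on :: "('a \<Rightarrow> 'a \<Rightarrow> complex) \<Rightarrow> 'a set \<Rightarrow> nat \<Rightarrow> bool" where
  "neg_le_on H S k \<longleftrightarrow> (\<forall>I. finite I \<and> I \<subseteq> S \<longrightarrow> neg_le H I k)"

lemma neg_le_onD: "neg_le_on H S k \<Longrightarrow> finite I \<Longrightarrow> I \<subseteq> S \<Longrightarrow> neg_le H I k"
  by (auto simp: neg_le_on_def)

lemma neg_le_0_iff: "neg_le H I 0 \<longleftrightarrow> (\<forall>x. 0 \<le> Re (hform H I x x))"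
  by (simp add: neg_le_def)

lemma neg_le_cong:
  assumes "\<And>i j. i \<in> I \<Longrightarrow> j \<in> I \<Longrightarrow> H i j = H' i j"
  shows "neg_le H I k \<longleftrightarrow> neg_le H' I k"
proof -
  have "hform H I x x = hform H' I x x" for x
    by (rule hform_cong) (auto simp: assms)
  thus ?thesis by (simp add: neg_le_def)
qed

lemma hform_restrict:
  assumes "finite I'" "I \<subseteq> I'"
  shows "hform H I' (\<lambda>i. if i \<in> I then u i else 0) (\<lambda>i. if i \<in> I then v i else 0) = hform H I u v"
proof -
  have "hform H I' (\<lambda>i. if i \<in> I then u i else 0) (\<lambda>i. if i \<in> I then v i else 0)
      = (\<Sum>i\<in>I'. if i \<in> I then cnj (u i) * (\<Sum>j\<in>I'. if j \<in> I then H i j * v j else 0) else 0)"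
    unfolding hform_eq by (intro sum.cong) (auto intro!: sum.cong)
  also have "\<dots> = hform H I u v"
    using assms by (simp add: hform_eq sum.If_cases Int_absorb1)
  finally show ?thesis .
qed

text \<open>A congruence by a relabelling and a diagonal matrix. The scaling \<open>s\<close> may
  have zeros, since a degenerate congruence can only lose negative squares.\<close>

lemma neg_le_transfer:
  assumes le: "neg_le G J k" and e: "bij_betw e J I"
    and H: "\<And>a b. a \<in> J \<Longrightarrow> b \<in> J \<Longrightarrow> H (e a) (e b) = cnj (s a) * G a b * s b"
  shows "neg_le H I k"
proof -
  obtain l where l: "\<And>x. (\<And>r. r < k \<Longrightarrow> (\<Sum>i\<in>J. l r i * x i) = 0) \<Longrightarrow> 0 \<le> Re (hform G J x x)"
    using le unfolding neg_le_def by auto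
  define d where "d = inv_into J e"
  have d: "d (e a) = a" if "a \<in> J" for a
    using e that by (simp add: d_def bij_betw_def)
  show ?thesis
    unfolding neg_le_def
  proof (intro exI[of _ "\<lambda>r i. l r (d i) * s (d i)"] allI impI)
    fix x assume x: "\<forall>r<k. (\<Sum>i\<in>I. l r (d i) * s (d i) * x i) = 0"
    have "hform H I x x = (\<Sum>a\<in>J. \<Sum>b\<in>J. cnj (x (e a)) * H (e a) (e b) * x (e b))"
      unfolding hform_def by (simp add: sum.reindex_bij_betw[OF e, symmetric])
    also have "\<dots> = hform G J (\<lambda>a. s a * x (e a)) (\<lambda>a. s a * x (e a))"
      unfolding hform_def by (intro sum.cong refl) (simp add: H)
    also have "0 \<le> Re \<dots>"
    proof (rule l)
      fix r assume "r < k"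
      have "(\<Sum>a\<in>J. l r a * (s a * x (e a))) = (\<Sum>a\<in>J. l r (d (e a)) * s (d (e a)) * x (e a))"
        by (intro sum.cong) (auto simp: d)
      also have "\<dots> = (\<Sum>i\<in>I. l r (d i) * s (d i) * x i)"
        by (rule sum.reindex_bij_betw[OF e])
      finally show "(\<Sum>a\<in>J. l r a * (s a * x (e a))) = 0" using x \<open>r < k\<close> by simp
    qed
    finally show "0 \<le> Re (hform H I x x)" .
  qed
qed

lemma neg_le_subset:
  assumes "neg_le H I' k" "finite I'" "I \<subseteq> I'"
  shows "neg_le H I k"
proof -
  obtain l where l: "\<And>x. (\<And>r. r < k \<Longrightarrow> (\<Sum>i\<in>I'. l r i * x i) = 0) \<Longrightarrow> 0 \<le> Re (hform H I' x x)"
    using assms(1) unfolding neg_le_def by auto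
  show ?thesis
    unfolding neg_le_def
  proof (intro exI[of _ l] allI impI)
    fix x assume x: "\<forall>r<k. (\<Sum>i\<in>I. l r i * x i) = 0"
    have "(\<Sum>i\<in>I'. l r i * (if i \<in> I then x i else 0)) = (\<Sum>i\<in>I. l r i * x i)" for r
      using assms by (intro sum.mono_neutral_cong_right) auto
    hence "0 \<le> Re (hform H I' (\<lambda>i. if i \<in> I then x i else 0) (\<lambda>i. if i \<in> I then x i else 0))"
      using x by (intro l) simp
    thus "0 \<le> Re (hform H I x x)" using hform_restrict[OF assms(2,3)] by simp
  qed
qed

lemma neg_le_Un:
  assumes "finite F" "finite I" "neg_le H I k"
  shows "neg_le H (I \<union> F) (k + card F)"
  using assms(1)
proof (induction F rule: finite_induct)
  case empty
  thus ?case using assms by simp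
next
  case (insert f F)
  let ?I = "I \<union> F"
  obtain l where l: "\<And>x. (\<And>r. r < k + card F \<Longrightarrow> (\<Sum>i\<in>?I. l r i * x i) = 0) \<Longrightarrow> 0 \<le> Re (hform H ?I x x)"
    using insert.IH unfolding neg_le_def by auto
  show ?case
    unfolding neg_le_def
  proof (intro exI[of _ "\<lambda>r i. if r < k + card F then l r i else if i = f then 1 else 0"] allI impI)
    fix x
    let ?l = "\<lambda>r i. if r < k + card F then l r i else if i = f then 1 else 0"
    assume x: "\<forall>r<k + card (insert f F). (\<Sum>i\<in>I \<union> insert f F. ?l r i * x i) = 0"
    have "(\<Sum>i\<in>I \<union> insert f F. ?l (k + card F) i * x i) = 0"
      using x[rule_format, of "k + card F"] insert.hyps by auto
    moreover have "(\<Sum>i\<in>I \<union> insert f F. ?l (k + card F) i * x i) = (\<Sum>i\<in>{f}. x i)"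
      using insert.hyps assms(2) by (intro sum.mono_neutral_cong_right) auto
    ultimately have xf: "x f = 0" by simp
    have fin: "finite (I \<union> insert f F)" "?I \<subseteq> I \<union> insert f F" using insert.hyps assms(2) by auto
    have "(\<Sum>i\<in>?I. l r i * x i) = 0" if "r < k + card F" for r
    proof -
      have "(\<Sum>i\<in>?I. l r i * x i) = (\<Sum>i\<in>I \<union> insert f F. l r i * x i)"
        using xf fin by (intro sum.mono_neutral_left) auto
      thus ?thesis using x[rule_format, of r] that insert.hyps by simp
    qed
    hence "0 \<le> Re (hform H ?I x x)" by (rule l)
    also have "hform H ?I x x = hform H (I \<union> insert f F) (\<lambda>i. if i \<in> ?I then x i else 0) (\<lambda>i. if i \<in> ?I then x i else 0)"
      by (rule hform_restrict[OF fin, symmetric])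
    also have "\<dots> = hform H (I \<union> insert f F) x x"
      using xf by (intro hform_cong) auto
    finally show "0 \<le> Re (hform H (I \<union> insert f F) x x)" .
  qed
qed

text \<open>Raising diagonal entries adds a nonnegative form. This is how the inequalities in the
  interpolation conditions enter; for infinite \<open>I\<close> all sums are 0.\<close>

lemma neg_le_add_diagonal:
  assumes "neg_le G I k"
    and "\<And>i j. i \<in> I \<Longrightarrow> j \<in> I \<Longrightarrow> i \<noteq> j \<Longrightarrow> H i j = G i j"
    and "\<And>i. i \<in> I \<Longrightarrow> Re (G i i) \<le> Re (H i i)"
  shows "neg_le H I k"
proof (cases "finite I")
  case True
  have "Re (hform G I x x) \<le> Re (hform H I x x)" for x
  proof -
    have "hform H I x x - hform G I x x
       = (\<Sum>i\<in>I. \<Sum>j\<in>I. if i = j then cnj (x i) * (H i i - G i i) * x i else 0)"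
      unfolding hform_def sum_subtractf[symmetric]
      by (intro sum.cong) (auto simp: assms(2) algebra_simps)
    also have "\<dots> = (\<Sum>i\<in>I. x i * cnj (x i) * (H i i - G i i))"
      using True by (intro sum.cong) (auto simp: mult_ac)
    also have "Re \<dots> = (\<Sum>i\<in>I. (cmod (x i))\<^sup>2 * Re (H i i - G i i))"
      unfolding mult_cnj_eq Re_sum by (intro sum.cong) (auto simp flip: of_real_power)
    also have "\<dots> \<ge> 0" using assms(3) by (intro sum_nonneg) auto
    finally show ?thesis by simp
  qed
  thus ?thesis using assms(1) unfolding neg_le_def by (meson order_trans)
qed (simp add: neg_le_def hform_def)

section \<open>Positive kernels and Schur complements\<close>

definition psd_on :: "('a \<Rightarrow> 'a \<Rightarrow> complex) \<Rightarrow> 'a set \<Rightarrow> bool" where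
  "psd_on K S \<longleftrightarrow> (\<forall>I u. finite I \<longrightarrow> I \<subseteq> S \<longrightarrow> 0 \<le> Re (hform K I u u))"

lemma psd_on_iff: "psd_on K S \<longleftrightarrow> neg_le_on K S 0"
  by (auto simp: psd_on_def neg_le_on_def neg_le_0_iff)

lemma psd_Cauchy_Schwarz:
  assumes "herm K" and psd: "\<And>u. 0 \<le> Re (hform K I u u)"
  shows "(cmod (hform K I u v))\<^sup>2 \<le> Re (hform K I u u) * Re (hform K I v v)"
proof -
  define A B b where "A = Re (hform K I u u)" and "B = Re (hform K I v v)" and "b = hform K I v u"
  have uv: "hform K I u v = cnj b" using hform_cnj[OF assms(1)] b_def by blast
  have ineq: "0 \<le> A - 2 * s * (cmod b)\<^sup>2 + s\<^sup>2 * (cmod b)\<^sup>2 * B" for s :: real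
  proof -
    let ?c = "- of_real s * b"
    have "hform K I (\<lambda>i. u i + ?c * v i) (\<lambda>i. u i + ?c * v i)
        = hform K I u u - of_real s * (b * cnj b) - of_real s * (b * cnj b)
          + of_real (s\<^sup>2) * (b * cnj b) * hform K I v v"
      by (simp only: hform_add_right hform_add_left hform_scale_left hform_scale_right uv b_def[symmetric])
         (simp add: algebra_simps power2_eq_square)
    hence "Re (hform K I (\<lambda>i. u i + ?c * v i) (\<lambda>i. u i + ?c * v i))
        = A - 2 * s * (cmod b)\<^sup>2 + s\<^sup>2 * (cmod b)\<^sup>2 * B"
      unfolding mult_cnj_eq A_def B_def by (simp flip: of_real_power of_real_mult)
    thus ?thesis using psd[of "\<lambda>i. u i + ?c * v i"] by simp
  qed
  have "B \<ge> 0" unfolding B_def by (rule psd)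
  have "(cmod b)\<^sup>2 \<le> A * B"
  proof (cases "B = 0")
    case True
    have "(cmod b)\<^sup>2 = 0"
    proof (rule ccontr)
      assume "(cmod b)\<^sup>2 \<noteq> 0"
      \<comment> \<open>For \<open>B = 0\<close> the inequality is linear in \<open>s\<close>, and
        this choice of \<open>s\<close> makes its right-hand side -1.\<close>
      moreover have "0 \<le> A - 2 * ((A + 1) / (2 * (cmod b)\<^sup>2)) * (cmod b)\<^sup>2"
        using ineq[of "(A + 1) / (2 * (cmod b)\<^sup>2)"] True by simp
      ultimately show False by (simp add: field_simps)
    qed
    thus ?thesis using True by simp
  next
    case False
    hence "B > 0" using \<open>B \<ge> 0\<close> by simp
    have "0 \<le> A - (cmod b)\<^sup>2 / B"
      using ineq[of "1 / B"] \<open>B > 0\<close> by (simp add: field_simps power2_eq_square)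
    thus ?thesis using \<open>B > 0\<close> by (simp add: field_simps)
  qed
  thus ?thesis using uv by (simp add: A_def B_def)
qed

text \<open>The Schur complement of \<open>H\<close> with respect to the span of the system
  \<open>v\<close>. The Gram matrix of \<open>v\<close> is minus the identity, so that subtracting
  its inverse between the two factors becomes adding a sum of rank-one kernels.\<close>

definition schur_kernel ::
  "('a \<Rightarrow> 'a \<Rightarrow> complex) \<Rightarrow> 'a set \<Rightarrow> nat \<Rightarrow> (nat \<Rightarrow> 'a \<Rightarrow> complex) \<Rightarrow> 'a \<Rightarrow> 'a \<Rightarrow> complex" where
  "schur_kernel H I m v a b = H a b +
     (\<Sum>j<m. cnj (\<Sum>i\<in>I. cnj (v j i) * H i a) * (\<Sum>i\<in>I. cnj (v j i) * H i b))"

lemma herm_schur: "herm H \<Longrightarrow> herm (schur_kernel H I m v)"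
proof -
  assume H: "herm H"
  have "schur_kernel H I m v b a = cnj (schur_kernel H I m v a b)" for a b
  proof -
    define f where "f j b = (\<Sum>i\<in>I. cnj (v j i) * H i b)" for j b
    have "H b a = cnj (H a b)" using H unfolding herm_def by blast
    thus ?thesis unfolding schur_kernel_def f_def[symmetric] by (simp add: mult.commute)
  qed
  thus ?thesis unfolding herm_def by blast
qed

text \<open>The value of the new form at \<open>u\<close> is the expression bounded in
  \<open>neg_system_projection\<close>, once \<open>u\<close> and the system are extended by 0 to
  the common index set \<open>I0 \<union> I\<close>.\<close>

lemma psd_schur_kernel:
  assumes "herm H" "finite I0" "I0 \<subseteq> S" "neg_system H I0 m v" "neg_le_on H S m"
  shows "psd_on (schur_kernel H I0 m v) S"
  unfolding psd_on_def
proof (intro allI impI)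
  fix I and u :: "'a \<Rightarrow> complex" assume I: "finite I" "I \<subseteq> S"
  define I' where "I' = I0 \<union> I"
  have I': "finite I'" "I \<subseteq> I'" "I0 \<subseteq> I'" "I' \<subseteq> S" using I assms by (auto simp: I'_def)
  define v' where "v' j i = (if i \<in> I0 then v j i else 0)" for j i
  define u' where "u' i = (if i \<in> I then u i else 0)" for i
  have sys: "neg_system H I' m v'"
    using assms(4) unfolding neg_system_def v'_def hform_restrict[OF I'(1,3)] .
  have "neg_le H I' m" using assms(5) I' by (auto simp: neg_le_on_def)
  from neg_system_projection[OF assms(1) sys this, of u']
  have *: "0 \<le> Re (hform H I' u' u') + (\<Sum>j<m. (cmod (hform H I' (v' j) u'))\<^sup>2)" .
  have 1: "hform H I' u' u' = hform H I u u"
    unfolding u'_def by (rule hform_restrict[OF I'(1,2)])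
  define f where "f j b = (\<Sum>i\<in>I0. cnj (v j i) * H i b)" for j b
  have 2: "hform H I' (v' j) u' = (\<Sum>b\<in>I. f j b * u b)" for j
  proof -
    have "hform H I' (v' j) u' = (\<Sum>i\<in>I0. cnj (v j i) * (\<Sum>b\<in>I. H i b * u b))"
      unfolding hform_eq v'_def u'_def using I'
      by (intro sum.mono_neutral_cong_right)
         (auto intro!: arg_cong2[of _ _ _ _ "(*)"] sum.mono_neutral_cong_right)
    also have "\<dots> = (\<Sum>i\<in>I0. \<Sum>b\<in>I. cnj (v j i) * H i b * u b)"
      by (simp add: sum_distrib_left mult.assoc)
    also have "\<dots> = (\<Sum>b\<in>I. \<Sum>i\<in>I0. cnj (v j i) * H i b * u b)" by (rule sum.swap)
    also have "\<dots> = (\<Sum>b\<in>I. f j b * u b)" by (simp add: f_def sum_distrib_right)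
    finally show ?thesis .
  qed
  have "hform (schur_kernel H I0 m v) I u u
     = hform H I u u + (\<Sum>a\<in>I. \<Sum>b\<in>I. \<Sum>j<m. cnj (f j a * u a) * (f j b * u b))"
    unfolding hform_def schur_kernel_def f_def[symmetric]
    by (simp add: algebra_simps sum.distrib sum_distrib_left sum_distrib_right)
  also have "(\<Sum>a\<in>I. \<Sum>b\<in>I. \<Sum>j<m. cnj (f j a * u a) * (f j b * u b))
      = (\<Sum>j<m. \<Sum>a\<in>I. \<Sum>b\<in>I. cnj (f j a * u a) * (f j b * u b))"
    by (subst sum.swap[of _ "{..<m}"], subst sum.swap[of _ "{..<m}"]) (rule refl)
  also have "\<dots> = (\<Sum>j<m. (\<Sum>b\<in>I. f j b * u b) * cnj (\<Sum>b\<in>I. f j b * u b))"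
    by (subst mult.commute, unfold cnj_sum sum_product) (rule refl)
  also have "\<dots> = of_real (\<Sum>j<m. (cmod (\<Sum>b\<in>I. f j b * u b))\<^sup>2)"
    unfolding mult_cnj_eq by simp
  finally show "0 \<le> Re (hform (schur_kernel H I0 m v) I u u)"
    using * unfolding 1 2 by simp
qed

section \<open>Kernel matrices and the index of a generalized Nevanlinna function\<close>

lemma hermitian_kernel_matrix: "hermitian_matrix (kernel_matrix w m z) m"
  by standard (auto simp: kernel_matrix_def nevanlinna_kernel_def minus_divide_left
     simp flip: minus_divide_right, metis minus_diff_eq minus_divide_divide)

lemma ent_kernel_matrix:
  "i < m \<Longrightarrow> j < m \<Longrightarrow> hermitian_matrix.ent (kernel_matrix w m z) m i j = nevanlinna_kernel w (z j) (z i)"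
  using hermitian_matrix.ent_def[OF hermitian_kernel_matrix]
  by (simp add: kernel_matrix_def)

text \<open>The conjugated variable comes first, as in \<open>hform\<close>; thus
  \<open>nk w (z i) (z j)\<close> is the entry \<open>(i, j)\<close> of
  \<open>kernel_matrix\<close>.\<close>

definition nk :: "(complex \<Rightarrow> complex) \<Rightarrow> complex \<Rightarrow> complex \<Rightarrow> complex" where
  "nk w a b = nevanlinna_kernel w b a"

lemma sq_neg_kernel_matrix:
  "sq_neg (kernel_matrix w m z) \<le> k \<longleftrightarrow> neg_le (\<lambda>i j. nk w (z i) (z j)) {..<m} k"
  unfolding sq_neg_le_iff[OF hermitian_kernel_matrix]
  by (rule neg_le_cong) (simp add: ent_kernel_matrix nk_def)

text \<open>The family \<open>e\<close> may repeat points, as kernel matrices and moving points do.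
  Coefficients on the same fibre of \<open>e\<close> are added up, which leaves the value of the
  form unchanged.\<close>

lemma neg_le_family:
  assumes "neg_le_on H S k" "finite J" "e ` J \<subseteq> S"
  shows "neg_le (\<lambda>i j. H (e i) (e j)) J k"
proof -
  obtain l where l: "\<And>x. (\<And>r. r < k \<Longrightarrow> (\<Sum>i\<in>e ` J. l r i * x i) = 0) \<Longrightarrow> 0 \<le> Re (hform H (e ` J) x x)"
    using neg_le_onD[OF assms(1) finite_imageI[OF assms(2)] assms(3)] unfolding neg_le_def by auto
  show ?thesis
    unfolding neg_le_def
  proof (intro exI[of _ "\<lambda>r i. l r (e i)"] allI impI)
    fix x assume x: "\<forall>r<k. (\<Sum>i\<in>J. l r (e i) * x i) = 0"
    define y where "y a = (\<Sum>i\<in>{i\<in>J. e i = a}. x i)" for a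
    have push: "(\<Sum>a\<in>e ` J. g a * y a) = (\<Sum>i\<in>J. g (e i) * x i)" for g
    proof -
      have "(\<Sum>a\<in>e ` J. g a * y a) = (\<Sum>a\<in>e ` J. \<Sum>i\<in>{i\<in>J. e i = a}. g (e i) * x i)"
        unfolding y_def sum_distrib_left by (intro sum.cong) auto
      thus ?thesis using assms(2) by (simp add: sum.image_gen[of J _ e])
    qed
    have push': "(\<Sum>a\<in>e ` J. cnj (y a) * g a) = (\<Sum>i\<in>J. cnj (x i) * g (e i))" for g
      using arg_cong[OF push[of "\<lambda>a. cnj (g a)"], of cnj] by (simp add: mult.commute)
    have "hform H (e ` J) y y = hform (\<lambda>i j. H (e i) (e j)) J x x"
      unfolding hform_eq push push' ..
    moreover have "0 \<le> Re (hform H (e ` J) y y)"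
      by (rule l) (use x push in auto)
    ultimately show "0 \<le> Re (hform (\<lambda>i j. H (e i) (e j)) J x x)" by simp
  qed
qed

lemma sq_neg_all_iff:
  "(\<forall>m\<ge>1. \<forall>z. (\<forall>i<m. z i \<in> S) \<longrightarrow> sq_neg (kernel_matrix w m z) \<le> k) \<longleftrightarrow> neg_le_on (nk w) S k"
proof
  assume L: "\<forall>m\<ge>1. \<forall>z. (\<forall>i<m. z i \<in> S) \<longrightarrow> sq_neg (kernel_matrix w m z) \<le> k"
  show "neg_le_on (nk w) S k"
    unfolding neg_le_on_def
  proof (intro allI impI)
    fix I assume I: "finite I \<and> I \<subseteq> S"
    show "neg_le (nk w) I k"
    proof (cases "I = {}")
      case True
      thus ?thesis by (simp add: neg_le_def hform_def)
    next
      case False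
      obtain e where e: "bij_betw e {..<card I} I"
        using ex_bij_betw_nat_finite[of I] I by (auto simp: lessThan_atLeast0)
      have "card I \<ge> 1" using False I by (simp add: Suc_le_eq card_gt_0_iff)
      moreover have "\<forall>i<card I. e i \<in> S" using e I by (auto simp: bij_betw_def)
      ultimately have "neg_le (\<lambda>i j. nk w (e i) (e j)) {..<card I} k"
        using L unfolding sq_neg_kernel_matrix by blast
      thus ?thesis by (rule neg_le_transfer[OF _ e, where s = "\<lambda>_. 1"]) auto
    qed
  qed
next
  assume "neg_le_on (nk w) S k"
  thus "\<forall>m\<ge>1. \<forall>z. (\<forall>i<m. z i \<in> S) \<longrightarrow> sq_neg (kernel_matrix w m z) \<le> k"
    unfolding sq_neg_kernel_matrix by (intro allI impI neg_le_family) auto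
qed

lemma gen_nevanlinna_neg_le: "w \<in> gen_nevanlinna k \<Longrightarrow> neg_le_on (nk w) (analyticity_domain w) k"
  unfolding gen_nevanlinna_def sq_neg_all_iff[symmetric] by blast

lemma analyticity_domain_nonempty:
  assumes "w nicely_meromorphic_on upper_half_plane"
  shows "\<exists>z. z \<in> analyticity_domain w"
proof -
  have o: "open upper_half_plane" by (auto simp: upper_half_plane_def open_halfspace_Im_gt)
  have i: "\<i> \<in> upper_half_plane" by (simp add: upper_half_plane_def)
  have "eventually (\<lambda>z. w analytic_on {z}) (cosparse upper_half_plane)"
    using assms by (intro meromorphic_on_imp_analytic_cosparse) (auto simp: nicely_meromorphic_on_def)
  hence "eventually (\<lambda>z. w analytic_on {z}) (at \<i>)"
    using i eventually_cosparse_imp_eventually_at by blast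
  moreover have "eventually (\<lambda>z. z \<in> upper_half_plane) (at \<i>)"
    using o i by (rule eventually_at_in_open')
  ultimately have "eventually (\<lambda>z. z \<in> analyticity_domain w) (at \<i>)"
    by eventually_elim (auto simp: analyticity_domain_def)
  thus ?thesis using eventually_happens' trivial_limit_at by (metis at_neq_bot)
qed

text \<open>The index is the least admissible bound. A positive one is attained by minimality; for 0
  the required matrix with \<open>m \<ge> 1\<close> comes from a single point of
  analyticity.\<close>

lemma gen_nevanlinna_exists:
  assumes "w nicely_meromorphic_on upper_half_plane" "neg_le_on (nk w) (analyticity_domain w) k"
  obtains k' where "k' \<le> k" "w \<in> gen_nevanlinna k'"
proof -
  let ?P = "\<lambda>k. neg_le_on (nk w) (analyticity_domain w) k"
  define k' where "k' = (LEAST k. ?P k)"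
  have k': "?P k'" "k' \<le> k" unfolding k'_def using assms(2) by (auto intro: LeastI Least_le)
  have "w \<in> gen_nevanlinna k'"
  proof (cases "k' = 0")
    case True
    obtain z where "z \<in> analyticity_domain w" using analyticity_domain_nonempty[OF assms(1)] by blast
    hence "\<exists>m\<ge>1. \<exists>z. (\<forall>i<m. z i \<in> analyticity_domain w) \<and> sq_neg (kernel_matrix w m z) \<le> 0"
      using k'(1) unfolding True sq_neg_all_iff[symmetric]
      by (intro exI[of _ 1] exI[of _ "\<lambda>_. z"]) auto
    thus ?thesis using assms(1) k'(1) unfolding gen_nevanlinna_def sq_neg_all_iff True by auto
  next
    case False
    then obtain k0 where k0: "k' = Suc k0" using not0_implies_Suc by blast
    have "\<not> ?P k0" using not_less_Least[of k0 ?P] k0 k'_def by auto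
    hence "\<exists>m\<ge>1. \<exists>z. (\<forall>i<m. z i \<in> analyticity_domain w) \<and> sq_neg (kernel_matrix w m z) = k'"
      using k'(1) unfolding sq_neg_all_iff[symmetric] k0 by (metis Suc_leI le_antisym not_le)
    thus ?thesis using assms(1) k'(1) unfolding gen_nevanlinna_def sq_neg_all_iff by auto
  qed
  thus ?thesis using that k' by blast
qed

subsection \<open>Poles of generalized Nevanlinna functions\<close>

text \<open>With the Blaschke factor \<open>b(z) = (z - a m) / (z + cnj (a m))\<close>, the kernel
  is a positive rank-one kernel plus the same kernel multiplied by \<open>b\<close> and its
  conjugate. As \<open>b\<close> vanishes at \<open>a m\<close>, the second summand involves one
  point less, and the rank-one term is positive when all its coefficients vanish.\<close>

lemma Szego_kernel_pos:
  fixes a :: "nat \<Rightarrow> complex"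
  assumes "inj_on a {..<m}" "\<And>i. i < m \<Longrightarrow> Re (a i) > 0" "\<exists>j<m. x j \<noteq> 0"
  shows "0 < Re (hform (\<lambda>i j. 1 / (a j + cnj (a i))) {..<m} x x)"
  using assms
proof (induction m arbitrary: x)
  case 0
  thus ?case by simp
next
  case (Suc m)
  let ?K = "\<lambda>i j. 1 / (a j + cnj (a i))"
  define y where "y j = x j * (a j - a m) / (a j + cnj (a m))" for j
  define s where "s = (\<Sum>j<Suc m. x j / (a j + cnj (a m)))"
  have pos: "Re (a i) > 0" if "i \<le> m" for i using Suc.prems(2)[of i] that by simp
  have nz: "a j + cnj (a i) \<noteq> 0" if "i \<le> m" "j \<le> m" for i j
    using pos[OF that(1)] pos[OF that(2)] by (auto simp: complex_eq_iff)
  have split: "cnj (x i) * ?K i j * x j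
      = of_real (2 * Re (a m)) * (cnj (x i / (a i + cnj (a m))) * (x j / (a j + cnj (a m))))
        + cnj (y i) * ?K i j * y j" if "i \<le> m" "j \<le> m" for i j
  proof -
    have "a j + cnj (a i) \<noteq> 0" "a j + cnj (a m) \<noteq> 0" "cnj (a i) + a m \<noteq> 0"
      using nz[OF that] nz[OF _ that(2), of m] nz[OF that(1), of m] by (auto simp: add.commute)
    moreover have "of_real (2 * Re (a m)) = a m + cnj (a m)" by (simp add: complex_add_cnj)
    ultimately show ?thesis
      unfolding y_def by (simp add: divide_simps) (simp add: algebra_simps)
  qed
  have ym: "y m = 0" by (simp add: y_def)
  have "hform ?K {..<Suc m} x x = (\<Sum>i<Suc m. \<Sum>j<Suc m.
      of_real (2 * Re (a m)) * (cnj (x i / (a i + cnj (a m))) * (x j / (a j + cnj (a m))))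
        + cnj (y i) * ?K i j * y j)"
    unfolding hform_def by (intro sum.cong refl split) auto
  also have "\<dots> = of_real (2 * Re (a m)) * (cnj s * s) + hform ?K {..<Suc m} y y"
  proof -
    have "cnj s * s = (\<Sum>i<Suc m. \<Sum>j<Suc m. cnj (x i / (a i + cnj (a m))) * (x j / (a j + cnj (a m))))"
      by (simp only: s_def cnj_sum sum_product)
    thus ?thesis by (simp only: sum.distrib hform_def sum_distrib_left)
  qed
  also have "hform ?K {..<Suc m} y y = hform ?K {..<m} y y"
    unfolding hform_def by (simp add: ym)
  also have "cnj s * s = of_real ((cmod s)\<^sup>2)" by (simp add: mult_cnj_eq mult.commute[of "cnj _"])
  finally have eq: "Re (hform ?K {..<Suc m} x x) = 2 * Re (a m) * (cmod s)\<^sup>2 + Re (hform ?K {..<m} y y)"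
    by (simp flip: of_real_mult)
  show ?case
  proof (cases "\<exists>j<m. y j \<noteq> 0")
    case True
    have "0 < Re (hform ?K {..<m} y y)"
      using Suc.prems True by (intro Suc.IH) (auto simp: inj_on_def)
    moreover have "0 \<le> 2 * Re (a m) * (cmod s)\<^sup>2" using pos[of m] by simp
    ultimately show ?thesis unfolding eq by linarith
  next
    case False
    have x0: "x j = 0" if "j < m" for j
    proof -
      have "a j \<noteq> a m" using Suc.prems(1) that by (auto simp: inj_on_def)
      thus ?thesis using False that nz[of m j] by (auto simp: y_def)
    qed
    hence "x m \<noteq> 0" using Suc.prems(3) by (auto simp: less_Suc_eq)
    hence "s \<noteq> 0" using x0 nz[of m m] by (simp add: s_def)
    hence "0 < 2 * Re (a m) * (cmod s)\<^sup>2" using pos[of m] by simp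
    moreover have "hform ?K {..<m} y y = 0" using False by (simp add: hform_def)
    ultimately show ?thesis unfolding eq by simp
  qed
qed

text \<open>The open mapping theorem for \<open>1/w\<close>, which has a zero at the pole and
  therefore attains every small value, in particular \<open>\<i>/R\<close>.\<close>

lemma pole_takes_large_values:
  assumes "is_pole w p" "isolated_singularity_at w p" "e > 0"
  shows "\<forall>\<^sub>F R in at_top. \<exists>z\<in>ball p e. w analytic_on {z} \<and> w z = - \<i> * of_real R"
proof -
  obtain r where r: "r > 0" "w analytic_on ball p r - {p}"
    using assms(2) by (auto simp: isolated_singularity_at_def)
  have "\<forall>\<^sub>F z in at p. w z \<noteq> 0" using assms(1) by (rule non_zero_neighbour_pole)
  then obtain d where d: "d > 0" "\<And>z. z \<in> ball p d - {p} \<Longrightarrow> w z \<noteq> 0"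
    unfolding eventually_at by (auto simp: dist_commute)
  define c where "c = min e (min r d)"
  have c: "c > 0" "c \<le> e" "c \<le> r" "c \<le> d" using assms(3) r d by (auto simp: c_def)
  have an: "w analytic_on ball p c - {p}" by (rule analytic_on_subset[OF r(2)]) (use c in auto)
  define g where "g z = (if z = p then 0 else inverse (w z))" for z
  have g: "g holomorphic_on ball p c"
    unfolding g_def
    by (rule is_pole_inverse_holomorphic) (use assms(1) an d c in \<open>auto simp: analytic_imp_holomorphic\<close>)
  have nc: "\<not> g constant_on ball p c"
  proof
    assume "g constant_on ball p c"
    then obtain k where k: "\<And>z. z \<in> ball p c \<Longrightarrow> g z = k" by (auto simp: constant_on_def)
    have "p + of_real (c / 2) \<in> ball p c" "p \<in> ball p c" using c by (auto simp: dist_norm)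
    with k have "g (p + of_real (c / 2)) = g p" by simp
    moreover have "p + of_real (c / 2) \<in> ball p d - {p}" using c by (auto simp: dist_norm)
    ultimately show False using d(2) c by (auto simp: g_def split: if_splits)
  qed
  have "open (g ` ball p c)"
    by (rule open_mapping_thm[OF g _ _ _ _ nc]) (use c in auto)
  moreover have "0 \<in> g ` ball p c" using c by (auto simp: g_def intro!: image_eqI[of _ _ p])
  ultimately obtain h where h: "h > 0" "ball 0 h \<subseteq> g ` ball p c"
    by (meson open_contains_ball)
  have "\<forall>\<^sub>F R::real in at_top. R > 1 / h" by (rule eventually_gt_at_top)
  thus ?thesis
  proof eventually_elim
    case (elim R)
    have R: "R > 0" using elim h(1) by (meson less_trans zero_less_divide_1_iff)
    have "\<i> / of_real R \<in> ball 0 h" using elim R h by (simp add: norm_divide field_simps)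
    then obtain z where z: "z \<in> ball p c" "g z = \<i> / of_real R" using h(2) by auto
    have "z \<noteq> p" using z(2) R by (auto simp: g_def)
    hence "inverse (w z) = \<i> / of_real R" using z(2) by (simp add: g_def)
    hence "w z = inverse (\<i> / of_real R)" by (metis inverse_inverse_eq)
    also have "\<dots> = - \<i> * of_real R" using R by (simp add: field_simps)
    finally have "w z = - \<i> * of_real R" .
    moreover have "w analytic_on {z}" using an z(1) \<open>z \<noteq> p\<close> by (meson DiffI analytic_on_analytic_at empty_iff insert_iff)
    ultimately show ?case using z(1) c by (intro bexI[of _ z]) auto
  qed
qed

lemma nicely_meromorphic_pole:
  assumes "w nicely_meromorphic_on upper_half_plane" "p \<in> upper_half_plane" "p \<notin> analyticity_domain w"
  shows "is_pole w p" "isolated_singularity_at w p"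
  using assms nicely_meromorphic_on_imp_analytic_at[OF assms(1,2)]
  by (auto simp: analyticity_domain_def nicely_meromorphic_on_def
      intro: meromorphic_on_isolated_singularity meromorphic_on_subset)

lemma open_upper_half_plane: "open upper_half_plane"
  by (auto simp: upper_half_plane_def open_halfspace_Im_gt)

lemma herm_nk: "herm (nk w)"
  unfolding herm_def nk_def nevanlinna_kernel_def
  by (intro allI) (simp, metis minus_diff_eq minus_divide_divide)

text \<open>Near a pole, \<open>w\<close> attains the values \<open>-\<i>R\<close> for all large \<open>R\<close>; on points with this common
  value the kernel is \<open>-2R\<close> times a Szego kernel.\<close>

lemma few_poles:
  assumes w: "w nicely_meromorphic_on upper_half_plane"
    and le: "neg_le_on (nk w) (analyticity_domain w) k"
    and p: "inj_on p {..<m}" "\<And>i. i < m \<Longrightarrow> p i \<in> upper_half_plane - analyticity_domain w"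
  shows "m \<le> k"
proof -
  have "\<exists>R>0. \<forall>i<m. \<exists>z\<in>ball (p i) (1 / real (Suc n)). z \<in> analyticity_domain w \<and> w z = - \<i> * of_real R" for n
  proof -
    have "\<forall>\<^sub>F R in at_top. \<forall>i\<in>{..<m}. \<exists>z\<in>ball (p i) (1 / real (Suc n)). z \<in> analyticity_domain w \<and> w z = - \<i> * of_real R"
    proof (intro eventually_ball_finite ballI)
      fix i assume i: "i \<in> {..<m}"
      have pi: "p i \<in> upper_half_plane" "p i \<notin> analyticity_domain w" using p(2)[of i] i by auto
      obtain e where e: "e > 0" "ball (p i) e \<subseteq> upper_half_plane"
        using open_upper_half_plane pi(1) open_contains_ball by meson
      have "min e (1 / real (Suc n)) > 0" using e by simp
      from pole_takes_large_values[OF nicely_meromorphic_pole[OF w pi] this]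
      show "\<forall>\<^sub>F R in at_top. \<exists>z\<in>ball (p i) (1 / real (Suc n)). z \<in> analyticity_domain w \<and> w z = - \<i> * of_real R"
      proof eventually_elim
        case (elim R)
        then obtain z where z: "z \<in> ball (p i) (min e (1 / real (Suc n)))"
          "w analytic_on {z}" "w z = - \<i> * of_real R" by blast
        moreover have "z \<in> upper_half_plane" using z(1) e(2) by auto
        ultimately show ?case by (auto simp: analyticity_domain_def)
      qed
    qed simp
    with eventually_gt_at_top[of "0::real"]
    have "\<forall>\<^sub>F R in at_top. R > 0 \<and> (\<forall>i\<in>{..<m}. \<exists>z\<in>ball (p i) (1 / real (Suc n)). z \<in> analyticity_domain w \<and> w z = - \<i> * of_real R)"
      by eventually_elim blast
    from eventually_happens'[OF trivial_limit_at_top_linorder this] show ?thesis by auto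
  qed
  then obtain R where R: "\<And>n. R n > 0"
    "\<And>n i. i < m \<Longrightarrow> \<exists>z\<in>ball (p i) (1 / real (Suc n)). z \<in> analyticity_domain w \<and> w z = - \<i> * of_real (R n)"
    by metis
  define z where "z n i = (SOME z. z \<in> ball (p i) (1 / real (Suc n)) \<and> z \<in> analyticity_domain w \<and>
      w z = - \<i> * of_real (R n))" for n i
  have z: "z n i \<in> ball (p i) (1 / real (Suc n))" "z n i \<in> analyticity_domain w"
      "w (z n i) = - \<i> * of_real (R n)" if "i < m" for n i
    using someI_ex[OF R(2)[OF that, unfolded Bex_def], of n] unfolding z_def by blast+
  have zlim: "(\<lambda>n. z n i) \<longlonglongrightarrow> p i" if "i < m" for i
  proof (rule tendsto_dist_iff[THEN iffD2], rule tendsto_sandwich)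
    show "\<forall>\<^sub>F n in sequentially. 0 \<le> dist (z n i) (p i)" by simp
    show "\<forall>\<^sub>F n in sequentially. dist (z n i) (p i) \<le> 1 / real (Suc n)"
      using z(1)[OF that] by (intro always_eventually allI) (auto simp: dist_commute less_imp_le)
    show "(\<lambda>n. 1 / real (Suc n)) \<longlonglongrightarrow> 0" using LIMSEQ_inverse_real_of_nat by (simp add: inverse_eq_divide)
  qed simp
  \<comment> \<open>The value \<open>- \<i> * R\<close> minus its conjugate is
    \<open>- 2 * \<i> * R\<close>; \<open>H\<close> is the limit of the kernels divided by
    \<open>R\<close> as the points tend to the poles.\<close>
  define H where "H i j = (if i < m \<and> j < m then - 2 * \<i> / (p j - cnj (p i)) else 0)" for i j
  have nz: "p j - cnj (p i) \<noteq> 0" if "i < m" "j < m" for i j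
    using p(2)[of i] p(2)[of j] that by (auto simp: upper_half_plane_def complex_eq_iff)
  have "herm H"
  proof -
    have "H j i = cnj (H i j)" for i j
    proof (cases "i < m \<and> j < m")
      case True
      define d where "d = cnj (p j) - p i"
      have "p i - cnj (p j) = - d" by (simp add: d_def)
      moreover have "cnj (H i j) = 2 * \<i> / d" using True by (simp add: H_def d_def)
      moreover have "H j i = - 2 * \<i> / (p i - cnj (p j))" using True by (simp add: H_def)
      ultimately show ?thesis by simp
    qed (auto simp: H_def)
    thus ?thesis unfolding herm_def by blast
  qed
  have "neg_le H {..<m} k"
  proof (rule neg_le_limit[OF _ \<open>herm H\<close>])
    show "\<forall>\<^sub>F n in sequentially. neg_le (\<lambda>i j. - 2 * \<i> / (z n j - cnj (z n i))) {..<m} k"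
    proof (intro always_eventually allI)
      fix n
      have "neg_le (\<lambda>i j. nk w (z n i) (z n j)) {..<m} k"
        by (rule neg_le_family[OF le]) (use z in auto)
      thus "neg_le (\<lambda>i j. - 2 * \<i> / (z n j - cnj (z n i))) {..<m} k"
      proof (rule neg_le_transfer[where e = id and s = "\<lambda>_. of_real (1 / sqrt (R n))"])
        fix i j assume "i \<in> {..<m}" "j \<in> {..<m}"
        hence "nk w (z n i) (z n j) = of_real (R n) * (- 2 * \<i> / (z n j - cnj (z n i)))"
          by (simp add: nk_def nevanlinna_kernel_def z)
        moreover have "complex_of_real (1 / sqrt (R n)) * of_real (R n) * of_real (1 / sqrt (R n)) = 1"
          using R(1)[of n] by (simp flip: of_real_mult)
        ultimately show "- 2 * \<i> / (z n (id j) - cnj (z n (id i))) =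
            cnj (of_real (1 / sqrt (R n))) * nk w (z n i) (z n j) * of_real (1 / sqrt (R n))"
          unfolding complex_cnj_complex_of_real by (simp only: mult_ac id_apply) simp
      qed auto
    qed
    fix i j assume "i \<in> {..<m}" "j \<in> {..<m}"
    thus "(\<lambda>n. - 2 * \<i> / (z n j - cnj (z n i))) \<longlonglongrightarrow> H i j"
      unfolding H_def using zlim nz by (auto intro!: tendsto_intros)
  qed auto
  thus "m \<le> k"
  proof (rule neg_le_strict_bound[where v = "\<lambda>j i. if i = j then 1 else 0"])
    fix y :: "nat \<Rightarrow> complex" assume y: "\<exists>j<m. y j \<noteq> 0"
    \<comment> \<open>Multiplication by \<open>- \<i>\<close> rotates the upper half plane onto the
      right half plane, where the Szego kernel is stated.\<close>
    let ?K = "\<lambda>i j. 1 / (- \<i> * p j + cnj (- \<i> * p i))"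
    have "hform H {..<m} (\<lambda>i. \<Sum>j<m. y j * (if i = j then 1 else 0)) (\<lambda>i. \<Sum>j<m. y j * (if i = j then 1 else 0))
       = hform (\<lambda>i j. of_real (-2) * ?K i j) {..<m} y y"
    proof (rule hform_cong)
      fix i j assume ij: "i \<in> {..<m}" "j \<in> {..<m}"
      define d where "d = p j - cnj (p i)"
      have "d \<noteq> 0" using ij nz[of i j] by (simp add: d_def)
      hence "- 2 * \<i> / d = of_real (-2) * (1 / (- \<i> * d))" by (simp add: field_simps)
      moreover have "- \<i> * p j + cnj (- \<i> * p i) = - \<i> * d" by (simp add: algebra_simps d_def)
      moreover have "H i j = - 2 * \<i> / d" using ij by (simp add: H_def d_def)
      ultimately show "H i j = of_real (-2) * ?K i j" by (simp only:)
    qed (simp_all add: if_distrib cong: if_cong)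
    also have "\<dots> = of_real (-2) * hform ?K {..<m} y y"
      by (simp add: hform_def sum_distrib_left mult_ac)
    finally have "Re (hform H {..<m} (\<lambda>i. \<Sum>j<m. y j * (if i = j then 1 else 0)) (\<lambda>i. \<Sum>j<m. y j * (if i = j then 1 else 0)))
       = -2 * Re (hform ?K {..<m} y y)" by simp
    moreover have "0 < Re (hform ?K {..<m} y y)"
      by (rule Szego_kernel_pos[OF _ _ y]) (use p in \<open>auto simp: inj_on_def upper_half_plane_def\<close>)
    ultimately show "Re (hform H {..<m} (\<lambda>i. \<Sum>j<m. y j * (if i = j then 1 else 0)) (\<lambda>i. \<Sum>j<m. y j * (if i = j then 1 else 0))) < 0"
      by linarith
  qed
qed

lemma finite_poles:
  assumes "w nicely_meromorphic_on upper_half_plane" "neg_le_on (nk w) (analyticity_domain w) k"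
  shows "finite (upper_half_plane - analyticity_domain w)"
proof (rule ccontr)
  assume "infinite (upper_half_plane - analyticity_domain w)"
  then obtain A where A: "A \<subseteq> upper_half_plane - analyticity_domain w" "card A = Suc k" "finite A"
    using infinite_arbitrarily_large by metis
  from ex_bij_betw_nat_finite[OF A(3)] obtain p where p: "bij_betw p {..<Suc k} A"
    unfolding A(2) lessThan_atLeast0 by blast
  have "Suc k \<le> k"
    by (rule few_poles[OF assms, of p]) (use p A(1) in \<open>auto simp: bij_betw_def\<close>)
  thus False by simp
qed

lemma eventually_analyticity_domain:
  assumes "finite (upper_half_plane - analyticity_domain w)"
  shows "\<forall>\<^sub>F z in at (complex_of_real x) within upper_half_plane. z \<in> analyticity_domain w"
proof -
  have "open (- (upper_half_plane - analyticity_domain w))"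
    using assms by (intro open_Compl finite_imp_closed)
  moreover have "complex_of_real x \<in> - (upper_half_plane - analyticity_domain w)"
    by (auto simp: upper_half_plane_def)
  ultimately have "\<forall>\<^sub>F z in nhds (complex_of_real x). z \<in> - (upper_half_plane - analyticity_domain w)"
    by (rule eventually_nhds_in_open)
  thus ?thesis unfolding eventually_at_filter by eventually_elim auto
qed

lemma at_within_stolz_le: "at x within stolz_angle y a \<le> at x within upper_half_plane"
  by (rule at_le) (auto simp: stolz_angle_def upper_half_plane_def)

subsection \<open>The bordered kernel and the resolvent matrix\<close>

definition data_fst :: "interp_data \<Rightarrow> nat \<Rightarrow> complex" where
  "data_fst \<Omega> i = of_real (if i < n_reg \<Omega> then val \<Omega> i else resid \<Omega> i)"

definition data_snd :: "interp_data \<Rightarrow> nat \<Rightarrow> complex" where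
  "data_snd \<Omega> i = (if i < n_reg \<Omega> then 1 else 0)"

definition pt_fst :: "interp_data \<Rightarrow> (complex \<Rightarrow> complex) \<Rightarrow> nat + complex \<Rightarrow> complex" where
  "pt_fst \<Omega> w a = (case a of Inl i \<Rightarrow> data_fst \<Omega> i | Inr z \<Rightarrow> w z)"

definition pt_snd :: "interp_data \<Rightarrow> nat + complex \<Rightarrow> complex" where
  "pt_snd \<Omega> a = (case a of Inl i \<Rightarrow> data_snd \<Omega> i | Inr z \<Rightarrow> 1)"

definition pt_pos :: "interp_data \<Rightarrow> nat + complex \<Rightarrow> complex" where
  "pt_pos \<Omega> a = (case a of Inl i \<Rightarrow> of_real (node \<Omega> i) | Inr z \<Rightarrow> z)"

definition fmi_diag :: "interp_data \<Rightarrow> nat \<Rightarrow> complex" where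
  "fmi_diag \<Omega> i = of_real (if i < n_reg \<Omega> then slope \<Omega> i else - resid \<Omega> i)"

text \<open>The Pick matrix bordered by the Nevanlinna kernel: the interpolation nodes \<open>Inl i\<close> are treated
  as boundary points of the kernel with the projective value \<open>(C\<^sub>i, E\<^sub>i)\<close>.\<close>

definition fmi :: "interp_data \<Rightarrow> (complex \<Rightarrow> complex) \<Rightarrow> nat + complex \<Rightarrow> nat + complex \<Rightarrow> complex" where
  "fmi \<Omega> w a b = (if a = b \<and> isl a then fmi_diag \<Omega> (projl a)
     else (pt_fst \<Omega> w b * cnj (pt_snd \<Omega> a) - pt_snd \<Omega> b * cnj (pt_fst \<Omega> w a)) / (pt_pos \<Omega> b - cnj (pt_pos \<Omega> a)))"

lemma cnj_data_fst [simp]: "cnj (data_fst \<Omega> i) = data_fst \<Omega> i"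
  by (simp add: data_fst_def)

lemma cnj_data_snd [simp]: "cnj (data_snd \<Omega> i) = data_snd \<Omega> i"
  by (simp add: data_snd_def)

lemma herm_fmi: "herm (fmi \<Omega> w)"
proof -
  have "fmi \<Omega> w b a = cnj (fmi \<Omega> w a b)" for a b
  proof (cases "a = b \<and> isl a")
    case True
    then obtain i where "a = Inl i" "b = Inl i" by (cases a) auto
    thus ?thesis by (simp add: fmi_def fmi_diag_def)
  next
    case False
    hence *: "\<not> (b = a \<and> isl b)" by auto
    define X where "X = pt_fst \<Omega> w b * cnj (pt_snd \<Omega> a) - pt_snd \<Omega> b * cnj (pt_fst \<Omega> w a)"
    define Y where "Y = pt_pos \<Omega> b - cnj (pt_pos \<Omega> a)"
    have "fmi \<Omega> w b a = - cnj X / - cnj Y"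
      unfolding fmi_def if_not_P[OF *] by (simp add: X_def Y_def mult.commute)
    also have "\<dots> = cnj (X / Y)" by simp
    also have "X / Y = fmi \<Omega> w a b"
      unfolding fmi_def if_not_P[OF False] X_def Y_def ..
    finally show ?thesis .
  qed
  thus ?thesis unfolding herm_def by blast
qed

lemma fmi_Inr_Inr: "fmi \<Omega> w (Inr s) (Inr t) = nk w s t"
  by (simp add: fmi_def nk_def nevanlinna_kernel_def pt_fst_def pt_snd_def pt_pos_def)

lemma fmi_Inl_Inr:
  "fmi \<Omega> w (Inl i) (Inr t) = (data_snd \<Omega> i * w t - data_fst \<Omega> i) / (t - of_real (node \<Omega> i))"
  by (simp add: fmi_def pt_fst_def pt_snd_def pt_pos_def mult.commute)

lemma fmi_Inl_Inl: "i < n_pts \<Omega> \<Longrightarrow> j < n_pts \<Omega> \<Longrightarrow> fmi \<Omega> w (Inl i) (Inl j) = of_real (pick_entry \<Omega> i j)"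
proof -
  assume ij: "i < n_pts \<Omega>" "j < n_pts \<Omega>"
  have "- resid \<Omega> i / (node \<Omega> j - node \<Omega> i) = resid \<Omega> i / (node \<Omega> i - node \<Omega> j)"
    by (metis minus_diff_eq minus_divide_divide minus_minus)
  hence "- complex_of_real (resid \<Omega> i) / (of_real (node \<Omega> j) - of_real (node \<Omega> i))
      = of_real (resid \<Omega> i) / (of_real (node \<Omega> i) - of_real (node \<Omega> j))"
    by (metis of_real_diff of_real_divide of_real_minus)
  thus ?thesis
    by (auto simp: fmi_def pt_fst_def pt_snd_def pt_pos_def fmi_diag_def pick_entry_def data_fst_def data_snd_def)
qed

section \<open>The Pick matrix and its inverse in coordinates\<close>

lemma matinv_eqI:
  assumes "A \<in> carrier_mat n n" "B \<in> carrier_mat n n" "A * B = 1\<^sub>m n" "B * A = 1\<^sub>m n"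
  shows "matinv A = B"
proof -
  have "A \<in> Units (ring_mat TYPE(complex) n ())"
    using assms by (auto simp: Units_def ring_mat_def)
  then obtain C where C: "mat_inverse A = Some C"
    using mat_inverse(1)[OF assms(1), where b = "()"] by (cases "mat_inverse A") auto
  from mat_inverse(2)[OF assms(1) C] have "A * C = 1\<^sub>m n" "C \<in> carrier_mat n n" by auto
  hence "B * (A * C) = B" using assms(2) by simp
  moreover have "B * (A * C) = C"
    using assms \<open>C \<in> carrier_mat n n\<close> by (simp flip: assoc_mult_mat[of B n n A n C n])
  ultimately show ?thesis by (simp add: matinv_def C)
qed

locale interpolation_data =
  fixes \<Omega> :: interp_data
  assumes valid: "valid_data \<Omega>"
    and inv: "invertible_mat (pick_matrix \<Omega>)"
begin

abbreviation "n \<equiv> n_pts \<Omega>"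
abbreviation "c \<equiv> data_fst \<Omega>"
abbreviation "e \<equiv> data_snd \<Omega>"
definition x :: "nat \<Rightarrow> complex" where "x i = of_real (node \<Omega> i)"
definition p :: "nat \<Rightarrow> nat \<Rightarrow> complex" where "p i j = of_real (pick_entry \<Omega> i j)"
definition q :: "nat \<Rightarrow> nat \<Rightarrow> complex" where "q i j = matinv (pick_matrix \<Omega>) $$ (i, j)"

lemma pick_carrier: "pick_matrix \<Omega> \<in> carrier_mat n n"
  by (simp add: pick_matrix_def)

lemma matinv_pick:
  shows "matinv (pick_matrix \<Omega>) \<in> carrier_mat n n"
    and "pick_matrix \<Omega> * matinv (pick_matrix \<Omega>) = 1\<^sub>m n"
    and "matinv (pick_matrix \<Omega>) * pick_matrix \<Omega> = 1\<^sub>m n"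
proof -
  from inv obtain B where B: "inverts_mat (pick_matrix \<Omega>) B" "inverts_mat B (pick_matrix \<Omega>)"
    by (auto simp: invertible_mat_def)
  have 1: "pick_matrix \<Omega> * B = 1\<^sub>m n" using B(1) pick_carrier by (auto simp: inverts_mat_def)
  have 2: "B * pick_matrix \<Omega> = 1\<^sub>m (dim_row B)" using B(2) by (auto simp: inverts_mat_def)
  have "dim_col B = n" using arg_cong[OF 1, of dim_col] by simp
  moreover have "dim_row B = n" using arg_cong[OF 2, of dim_col] pick_carrier by simp
  ultimately have Bc: "B \<in> carrier_mat n n" by auto
  have "matinv (pick_matrix \<Omega>) = B"
    using 1 2 Bc pick_carrier by (intro matinv_eqI) auto
  thus "matinv (pick_matrix \<Omega>) \<in> carrier_mat n n"
    "pick_matrix \<Omega> * matinv (pick_matrix \<Omega>) = 1\<^sub>m n"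
    "matinv (pick_matrix \<Omega>) * pick_matrix \<Omega> = 1\<^sub>m n"
    using 1 2 Bc by auto
qed

lemma pq: "i < n \<Longrightarrow> k < n \<Longrightarrow> (\<Sum>j<n. p i j * q j k) = (if i = k then 1 else 0)"
proof -
  assume ik: "i < n" "k < n"
  have "(pick_matrix \<Omega> * matinv (pick_matrix \<Omega>)) $$ (i, k) = (\<Sum>j<n. p i j * q j k)"
    using ik matinv_pick(1) pick_carrier
    by (auto simp: p_def q_def scalar_prod_def lessThan_atLeast0 pick_matrix_def intro!: sum.cong)
  thus ?thesis using matinv_pick(2) ik by simp
qed

lemma qp: "i < n \<Longrightarrow> k < n \<Longrightarrow> (\<Sum>j<n. q i j * p j k) = (if i = k then 1 else 0)"
proof -
  assume ik: "i < n" "k < n"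
  have "(matinv (pick_matrix \<Omega>) * pick_matrix \<Omega>) $$ (i, k) = (\<Sum>j<n. q i j * p j k)"
    using ik matinv_pick(1) pick_carrier
    by (auto simp: p_def q_def scalar_prod_def lessThan_atLeast0 pick_matrix_def intro!: sum.cong)
  thus ?thesis using matinv_pick(3) ik by simp
qed

lemma node_neq: "i < n \<Longrightarrow> j < n \<Longrightarrow> i \<noteq> j \<Longrightarrow> node \<Omega> i \<noteq> node \<Omega> j"
  using valid by (auto simp: valid_data_def inj_on_def)

lemma x_neq: "i < n \<Longrightarrow> j < n \<Longrightarrow> i \<noteq> j \<Longrightarrow> x i \<noteq> x j"
  using node_neq by (simp add: x_def)

lemma fmi_pp: "i < n \<Longrightarrow> j < n \<Longrightarrow> fmi \<Omega> w (Inl i) (Inl j) = p i j"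
  by (simp add: fmi_Inl_Inl p_def)

text \<open>Off the diagonal this is the formula for the Pick entries with the denominator cleared;
  on the diagonal both sides vanish, so the identity puts no condition on the entries
  \<open>p i i\<close>.\<close>

lemma Lyapunov: "i < n \<Longrightarrow> j < n \<Longrightarrow> p i j * (x j - x i) = e i * c j - c i * e j"
proof (cases "i = j")
  case False
  assume ij: "i < n" "j < n"
  have "p i j = (c j * e i - e j * c i) / (x j - x i)"
    unfolding fmi_pp[OF ij, of undefined, symmetric] using False
    by (simp add: fmi_def pt_fst_def pt_snd_def pt_pos_def x_def)
  thus ?thesis using x_neq[OF ij False] by (simp add: field_simps)
qed simp

lemma cnj_p: "cnj (p i j) = p i j" by (simp add: p_def)

lemma p_sym: "p i j = p j i"
proof -
  have "(val \<Omega> j - val \<Omega> i) / (node \<Omega> j - node \<Omega> i) = (val \<Omega> i - val \<Omega> j) / (node \<Omega> i - node \<Omega> j)"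
    by (metis minus_diff_eq minus_divide_divide)
  thus ?thesis by (auto simp: p_def pick_entry_def)
qed

text \<open>For a projective value \<open>(U, V)\<close> at \<open>t\<close>, \<open>border\<close> is the vector \<open>g\<close>, \<open>coef\<close> is \<open>P\<^sup>-\<^sup>1g\<close>, and
  \<open>(numer, denom)\<close> is \<open>\<Theta>(t)\<^sup>-\<^sup>1(U, V)\<close>; \<open>(theta_fst, theta_snd)\<close> is \<open>\<Theta>(t)(a, b)\<close>.\<close>

definition border :: "complex \<Rightarrow> complex \<Rightarrow> complex \<Rightarrow> nat \<Rightarrow> complex" where
  "border U V t i = (e i * U - c i * V) / (t - x i)"

definition coef :: "complex \<Rightarrow> complex \<Rightarrow> complex \<Rightarrow> nat \<Rightarrow> complex" where
  "coef U V t i = (\<Sum>j<n. q i j * border U V t j)"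

definition numer :: "complex \<Rightarrow> complex \<Rightarrow> complex \<Rightarrow> complex" where
  "numer U V t = U - (\<Sum>i<n. c i * coef U V t i)"

definition denom :: "complex \<Rightarrow> complex \<Rightarrow> complex \<Rightarrow> complex" where
  "denom U V t = V - (\<Sum>i<n. e i * coef U V t i)"

definition lin :: "complex \<Rightarrow> complex \<Rightarrow> complex \<Rightarrow> nat \<Rightarrow> complex" where
  "lin a b t i = (\<Sum>j<n. q i j * (e j * a - c j * b)) / (t - x i)"

definition theta_fst :: "complex \<Rightarrow> complex \<Rightarrow> complex \<Rightarrow> complex" where
  "theta_fst a b t = a + (\<Sum>i<n. c i * lin a b t i)"

definition theta_snd :: "complex \<Rightarrow> complex \<Rightarrow> complex \<Rightarrow> complex" where
  "theta_snd a b t = b + (\<Sum>i<n. e i * lin a b t i)"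

section \<open>Inversion of the resolvent matrix and its indefinite metric\<close>

lemma p_mult_q: "i < n \<Longrightarrow> (\<Sum>j<n. p i j * (\<Sum>k<n. q j k * f k)) = f i"
proof -
  assume i: "i < n"
  have "(\<Sum>j<n. p i j * (\<Sum>k<n. q j k * f k)) = (\<Sum>j<n. \<Sum>k<n. p i j * q j k * f k)"
    by (simp add: sum_distrib_left mult.assoc)
  also have "\<dots> = (\<Sum>k<n. (\<Sum>j<n. p i j * q j k) * f k)"
    by (subst sum.swap) (simp add: sum_distrib_right)
  also have "\<dots> = (\<Sum>k<n. if i = k then f k else 0)"
    using i by (intro sum.cong) (auto simp: pq)
  finally show ?thesis using i by simp
qed

lemma q_mult_p: "i < n \<Longrightarrow> (\<Sum>j<n. q i j * (\<Sum>k<n. p j k * f k)) = f i"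
proof -
  assume i: "i < n"
  have "(\<Sum>j<n. q i j * (\<Sum>k<n. p j k * f k)) = (\<Sum>j<n. \<Sum>k<n. q i j * p j k * f k)"
    by (simp add: sum_distrib_left mult.assoc)
  also have "\<dots> = (\<Sum>k<n. (\<Sum>j<n. q i j * p j k) * f k)"
    by (subst sum.swap) (simp add: sum_distrib_right)
  also have "\<dots> = (\<Sum>k<n. if i = k then f k else 0)"
    using i by (intro sum.cong) (auto simp: qp)
  finally show ?thesis using i by simp
qed

lemma p_coef: "i < n \<Longrightarrow> (\<Sum>j<n. p i j * coef U V t j) = border U V t i"
  unfolding coef_def by (rule p_mult_q)

text \<open>The Lyapunov identity applied to a vector \<open>h\<close>: it trades the two numbers
  that \<open>C\<close> and \<open>E\<close> assign to \<open>h\<close> for the action of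
  \<open>X\<close> and \<open>P\<close>.\<close>

lemma Lyapunov_sum:
  assumes "j < n"
  shows "e j * (\<Sum>i<n. c i * h i) - c j * (\<Sum>i<n. e i * h i)
           = (\<Sum>i<n. p j i * (x i * h i)) - x j * (\<Sum>i<n. p j i * h i)"
proof -
  have "e j * (\<Sum>i<n. c i * h i) - c j * (\<Sum>i<n. e i * h i) = (\<Sum>i<n. (e j * c i - c j * e i) * h i)"
    by (simp add: sum_distrib_left sum_subtractf algebra_simps)
  also have "\<dots> = (\<Sum>i<n. p j i * (x i - x j) * h i)"
    using assms by (intro sum.cong) (auto simp: Lyapunov)
  also have "\<dots> = (\<Sum>i<n. p j i * (x i * h i)) - x j * (\<Sum>i<n. p j i * h i)"
    by (simp add: sum_distrib_left sum_subtractf algebra_simps)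
  finally show ?thesis .
qed

text \<open>The point is that \<open>lin\<close> of \<open>(numer, denom)\<close> is again
  \<open>coef U V t\<close>, by the Lyapunov identity; \<open>theta_fst\<close> and
  \<open>theta_snd\<close> then add back the sums which \<open>numer\<close> and
  \<open>denom\<close> subtract.\<close>

lemma theta_inverse:
  assumes t: "\<And>i. i < n \<Longrightarrow> t \<noteq> x i"
  shows "theta_fst (numer U V t) (denom U V t) t = U"
    and "theta_snd (numer U V t) (denom U V t) t = V"
proof -
  let ?h = "coef U V t"
  have "lin (numer U V t) (denom U V t) t i = ?h i" if i: "i < n" for i
  proof -
    have "e j * numer U V t - c j * denom U V t = t * border U V t j - (\<Sum>i<n. p j i * (x i * ?h i))"
      if j: "j < n" for j
    proof -
      have "e j * numer U V t - c j * denom U V t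
          = e j * U - c j * V - (e j * (\<Sum>i<n. c i * ?h i) - c j * (\<Sum>i<n. e i * ?h i))"
        by (simp add: numer_def denom_def algebra_simps)
      also have "e j * U - c j * V = (t - x j) * border U V t j"
        using t[OF j] by (simp add: border_def)
      finally show ?thesis unfolding Lyapunov_sum[OF j] p_coef[OF j] by (simp add: algebra_simps)
    qed
    hence "(\<Sum>j<n. q i j * (e j * numer U V t - c j * denom U V t))
       = (\<Sum>j<n. q i j * (t * border U V t j - (\<Sum>i<n. p j i * (x i * ?h i))))"
      by (intro sum.cong) auto
    also have "\<dots> = t * ?h i - (\<Sum>j<n. q i j * (\<Sum>i<n. p j i * (x i * ?h i)))"
      by (simp add: coef_def sum_distrib_left sum_subtractf algebra_simps)
    also have "\<dots> = (t - x i) * ?h i"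
      unfolding q_mult_p[OF i] by (simp add: algebra_simps)
    finally show ?thesis using t[OF i] by (simp add: lin_def)
  qed
  thus "theta_fst (numer U V t) (denom U V t) t = U" "theta_snd (numer U V t) (denom U V t) t = V"
    by (simp_all add: theta_fst_def theta_snd_def numer_def denom_def)
qed

text \<open>Here the \<open>border\<close> of the image vector is \<open>P\<close> applied to
  \<open>lin a b t\<close>, so that \<open>coef\<close> returns \<open>lin a b t\<close> and the
  sums cancel.\<close>

lemma inverse_theta:
  assumes t: "\<And>i. i < n \<Longrightarrow> t \<noteq> x i"
  shows "numer (theta_fst a b t) (theta_snd a b t) t = a"
    and "denom (theta_fst a b t) (theta_snd a b t) t = b"
proof -
  let ?U = "theta_fst a b t" and ?V = "theta_snd a b t" and ?k = "lin a b t"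
  have bd: "border ?U ?V t j = (\<Sum>i<n. p j i * ?k i)" if j: "j < n" for j
  proof -
    have "e j * ?U - c j * ?V = (e j * a - c j * b) + (e j * (\<Sum>i<n. c i * ?k i) - c j * (\<Sum>i<n. e i * ?k i))"
      by (simp add: theta_fst_def theta_snd_def algebra_simps)
    also have "e j * a - c j * b = (\<Sum>i<n. p j i * ((t - x i) * ?k i))"
    proof -
      have "(\<Sum>i<n. p j i * ((t - x i) * ?k i)) = (\<Sum>i<n. p j i * (\<Sum>k<n. q i k * (e k * a - c k * b)))"
        using t by (intro sum.cong) (auto simp: lin_def)
      thus ?thesis unfolding p_mult_q[OF j] by simp
    qed
    also have "\<dots> = t * (\<Sum>i<n. p j i * ?k i) - (\<Sum>i<n. p j i * (x i * ?k i))"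
      by (simp add: sum_distrib_left sum_subtractf algebra_simps)
    finally have "e j * ?U - c j * ?V = (t - x j) * (\<Sum>i<n. p j i * ?k i)"
      unfolding Lyapunov_sum[OF j] by (simp add: algebra_simps)
    thus ?thesis using t[OF j] by (simp add: border_def)
  qed
  have "coef ?U ?V t i = ?k i" if i: "i < n" for i
    unfolding coef_def using bd q_mult_p[OF i, of ?k] by simp
  thus "numer ?U ?V t = a" "denom ?U ?V t = b"
    by (simp_all add: numer_def denom_def theta_fst_def theta_snd_def)
qed

text \<open>This says how far the inverse of \<open>Theta\<close> is from preserving the form of
  \<open>J\<close>. After expansion, the double sum is reduced by the Lyapunov identity; all terms
  containing the nodes \<open>x i\<close> cancel, and the symmetry of \<open>p\<close> combines the
  rest into the factor \<open>t - cnj s\<close>.\<close>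

lemma schur_identity:
  assumes t: "\<And>i. i < n \<Longrightarrow> t \<noteq> x i" and s: "\<And>i. i < n \<Longrightarrow> s \<noteq> x i"
  shows "numer U V t * cnj (denom U' V' s) - denom U V t * cnj (numer U' V' s)
     = (U * cnj V' - V * cnj U') - (t - cnj s) * (\<Sum>i<n. cnj (border U' V' s i) * coef U V t i)"
proof -
  let ?g = "border U V t" and ?h = "coef U V t"
  let ?g' = "\<lambda>i. cnj (border U' V' s i)" and ?h' = "\<lambda>i. cnj (coef U' V' s i)"
  have g: "e i * U - c i * V = (t - x i) * ?g i" if "i < n" for i
    using t[OF that] by (simp add: border_def)
  have cx: "cnj (x i) = x i" for i by (simp add: x_def)
  have g': "e i * cnj U' - c i * cnj V' = (cnj s - x i) * ?g' i" if "i < n" for i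
  proof -
    have "e i * U' - c i * V' = (s - x i) * border U' V' s i"
      using s[OF that] by (simp add: border_def)
    from arg_cong[OF this, of cnj] show ?thesis by (simp add: cx)
  qed
  have ph': "(\<Sum>j<n. p i j * ?h' j) = ?g' i" if "i < n" for i
    using arg_cong[OF p_coef[OF that, of U' V' s], of cnj] by (simp add: cnj_p)
  have "numer U V t * cnj (denom U' V' s) - denom U V t * cnj (numer U' V' s)
     = (U * cnj V' - V * cnj U') + (\<Sum>i<n. ?h i * (e i * cnj U' - c i * cnj V'))
       - (\<Sum>j<n. ?h' j * (e j * U - c j * V))
       + (\<Sum>j<n. ?h' j * (e j * (\<Sum>i<n. c i * ?h i) - c j * (\<Sum>i<n. e i * ?h i)))"
    by (simp add: numer_def denom_def algebra_simps sum_subtractf sum.distrib sum_distrib_left)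
  also have "(\<Sum>j<n. ?h' j * (e j * (\<Sum>i<n. c i * ?h i) - c j * (\<Sum>i<n. e i * ?h i)))
      = (\<Sum>j<n. \<Sum>i<n. ?h' j * (p j i * (x i * ?h i))) - (\<Sum>j<n. ?h' j * (x j * ?g j))"
    using Lyapunov_sum[of _ ?h] p_coef[of _ U V t]
    by (simp add: right_diff_distrib sum_subtractf sum_distrib_left)
  also have "(\<Sum>j<n. \<Sum>i<n. ?h' j * (p j i * (x i * ?h i))) = (\<Sum>i<n. (x i * ?h i) * ?g' i)"
  proof -
    have "(\<Sum>j<n. \<Sum>i<n. ?h' j * (p j i * (x i * ?h i))) = (\<Sum>i<n. \<Sum>j<n. (x i * ?h i) * (p i j * ?h' j))"
      by (subst sum.swap) (simp add: mult_ac p_sym[of _ _])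
    also have "\<dots> = (\<Sum>i<n. (x i * ?h i) * ?g' i)"
      unfolding sum_distrib_left[symmetric] by (intro sum.cong) (auto simp: ph')
    finally show ?thesis .
  qed
  also have "(\<Sum>i<n. ?h i * (e i * cnj U' - c i * cnj V')) = (\<Sum>i<n. ?h i * ((cnj s - x i) * ?g' i))"
    by (intro sum.cong) (auto simp: g')
  also have "(\<Sum>j<n. ?h' j * (e j * U - c j * V)) = (\<Sum>j<n. ?h' j * ((t - x j) * ?g j))"
    by (intro sum.cong) (auto simp: g)
  also have "(U * cnj V' - V * cnj U') + (\<Sum>i<n. ?h i * ((cnj s - x i) * ?g' i))
       - (\<Sum>j<n. ?h' j * ((t - x j) * ?g j))
       + ((\<Sum>i<n. (x i * ?h i) * ?g' i) - (\<Sum>j<n. ?h' j * (x j * ?g j)))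
     = (U * cnj V' - V * cnj U') + cnj s * (\<Sum>i<n. ?h i * ?g' i) - t * (\<Sum>j<n. ?h' j * ?g j)"
    by (simp add: algebra_simps sum_subtractf sum.distrib sum_distrib_left)
  also have "(\<Sum>j<n. ?h' j * ?g j) = (\<Sum>i<n. ?h i * ?g' i)"
  proof -
    have "(\<Sum>j<n. ?h' j * ?g j) = (\<Sum>j<n. \<Sum>i<n. ?h' j * (p j i * ?h i))"
      unfolding sum_distrib_left[symmetric] by (intro sum.cong) (auto simp: p_coef)
    also have "\<dots> = (\<Sum>i<n. \<Sum>j<n. ?h i * (p i j * ?h' j))"
      by (subst sum.swap) (simp add: mult_ac p_sym[of _ _])
    also have "\<dots> = (\<Sum>i<n. ?h i * ?g' i)"
      unfolding sum_distrib_left[symmetric] by (intro sum.cong) (auto simp: ph')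
    finally show ?thesis .
  qed
  finally show ?thesis by (simp add: algebra_simps)
qed

lemma Theta_entry:
  assumes t: "\<And>i. i < n \<Longrightarrow> t \<noteq> x i" and "r < 2" "k < 2"
  shows "Theta \<Omega> t $$ (r, k) = (if r = k then 1 else 0) +
     (\<Sum>i<n. (if r = 0 then c i else e i) * ((\<Sum>j<n. q i j * (if k = 0 then e j else - c j)) / (t - x i)))"
proof -
  define M where "M r i = (if r = 0 then c i else e i)" for r :: nat and i
  define CE where "CE = append_rows (C_matrix \<Omega>) (E_matrix \<Omega>)"
  have CEc: "CE \<in> carrier_mat 2 n"
    unfolding CE_def by (metis C_matrix_def E_matrix_def carrier_append_rows mat_carrier one_add_one)
  have CEi: "CE $$ (r, i) = M r i" if "r < 2" "i < n" for r i
    using that unfolding CE_def append_rows_def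
    by (auto simp: C_matrix_def E_matrix_def M_def data_fst_def data_snd_def four_block_mat_def Let_def)
  define D where "D = Matrix.mat n n (\<lambda>(i, j). if i = j then 1 / (t - x i) else 0)"
  have X: "t \<cdot>\<^sub>m 1\<^sub>m n - X_matrix \<Omega> = Matrix.mat n n (\<lambda>(i, j). if i = j then t - x i else 0)"
    by (intro eq_matI) (auto simp: X_matrix_def x_def)
  have D: "matinv (t \<cdot>\<^sub>m 1\<^sub>m n - X_matrix \<Omega>) = D"
    unfolding X D_def using t
    by (intro matinv_eqI eq_matI) (auto simp: scalar_prod_def if_distrib[of "\<lambda>y. y * _"] if_distrib[of "\<lambda>y. _ * y"] cong: if_cong)
  define Q where "Q = matinv (pick_matrix \<Omega>)"
  have Qc: "Q \<in> carrier_mat n n" unfolding Q_def by (rule matinv_pick)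
  have Dc: "D \<in> carrier_mat n n" by (simp add: D_def)
  have CED: "CE * D = Matrix.mat 2 n (\<lambda>(r, i). M r i / (t - x i))"
    using CEc by (intro eq_matI)
      (auto simp: D_def scalar_prod_def CEi if_distrib[of "\<lambda>y. _ * y"] cong: if_cong)
  have CEDQ: "CE * D * Q = Matrix.mat 2 n (\<lambda>(r, j). \<Sum>i<n. M r i / (t - x i) * q i j)"
    unfolding CED using Qc by (intro eq_matI)
      (auto simp: scalar_prod_def q_def Q_def lessThan_atLeast0 intro!: sum.cong)
  have Mc: "cnj (M r i) = M r i" for r i by (simp add: M_def)
  have adjc: "mat_adjoint CE \<in> carrier_mat n 2" using CEc by (auto simp: mat_adjoint_def)
  have adj: "mat_adjoint CE $$ (i, r) = M r i" if "i < n" "r < 2" for i r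
    using that CEc by (simp add: mat_adjoint_def mat_of_rows_def CEi Mc)
  have Jc: "J_matrix \<in> carrier_mat 2 2" by (auto simp: J_matrix_def mat_of_rows_list_def)
  \<comment> \<open>Right multiplication by \<open>J\<close> turns the row of adjoints into
    \<open>\<i>\<close> times \<open>E\<close> and minus \<open>C\<close>; together with the factor
    \<open>- \<i>\<close> in front the imaginary units disappear.\<close>
  have Jadj: "mat_adjoint CE * J_matrix = Matrix.mat n 2 (\<lambda>(j, k). \<i> * (if k = 0 then e j else - c j))"
    using adjc Jc by (intro eq_matI)
      (auto simp: scalar_prod_def adj M_def J_matrix_def mat_of_rows_list_def numeral_2_eq_2 less_Suc_eq)
  have "CE * D * Q * mat_adjoint CE * J_matrix = (CE * D * Q) * (mat_adjoint CE * J_matrix)"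
    by (rule assoc_mult_mat) (use CEc Dc Qc adjc Jc in auto)
  hence T: "Theta \<Omega> t = 1\<^sub>m 2 - \<i> \<cdot>\<^sub>m ((CE * D * Q) * (mat_adjoint CE * J_matrix))"
    unfolding Theta_def Let_def CE_def[symmetric] D Q_def[symmetric] by simp
  have "((CE * D * Q) * (mat_adjoint CE * J_matrix)) $$ (r, k)
     = (\<Sum>j<n. (\<Sum>i<n. M r i / (t - x i) * q i j) * (\<i> * (if k = 0 then e j else - c j)))"
    unfolding CEDQ Jadj using assms(2,3) by (simp add: scalar_prod_def lessThan_atLeast0)
  hence "Theta \<Omega> t $$ (r, k) = (if r = k then 1 else 0)
     - \<i> * (\<Sum>j<n. (\<Sum>i<n. M r i / (t - x i) * q i j) * (\<i> * (if k = 0 then e j else - c j)))"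
    unfolding T CEDQ Jadj using assms(2,3) by simp
  also have "(\<Sum>j<n. (\<Sum>i<n. M r i / (t - x i) * q i j) * (\<i> * (if k = 0 then e j else - c j)))
     = (\<Sum>j<n. \<Sum>i<n. M r i / (t - x i) * q i j * (\<i> * (if k = 0 then e j else - c j)))"
    by (simp add: sum_distrib_right)
  also have "\<dots> = (\<Sum>i<n. \<Sum>j<n. M r i / (t - x i) * q i j * (\<i> * (if k = 0 then e j else - c j)))"
    by (rule sum.swap)
  also have "\<dots> = \<i> * (\<Sum>i<n. M r i * ((\<Sum>j<n. q i j * (if k = 0 then e j else - c j)) / (t - x i)))"
    by (simp add: sum_distrib_left sum_divide_distrib mult_ac)
  finally show ?thesis by (simp add: M_def mult.assoc[symmetric])
qed

lemma Theta_apply: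
  assumes t: "\<And>i. i < n \<Longrightarrow> t \<noteq> x i"
  shows "Theta \<Omega> t $$ (0, 0) * a + Theta \<Omega> t $$ (0, 1) * b = theta_fst a b t"
    and "Theta \<Omega> t $$ (1, 0) * a + Theta \<Omega> t $$ (1, 1) * b = theta_snd a b t"
proof -
  have *: "((\<Sum>j<n. q i j * e j) / (t - x i)) * a + ((\<Sum>j<n. q i j * (- c j)) / (t - x i)) * b = lin a b t i" for i
    by (simp add: lin_def add_divide_distrib[symmetric] sum_distrib_right sum.distrib[symmetric] algebra_simps sum_subtractf sum_negf)
      (simp add: sum_distrib_left mult_ac)
  have **: "(\<Sum>i<n. f i * A i) * a + (\<Sum>i<n. f i * B i) * b = (\<Sum>i<n. f i * (A i * a + B i * b))" for f A B :: "nat \<Rightarrow> complex"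
    by (simp add: sum_distrib_right sum.distrib algebra_simps) (simp add: sum_distrib_left mult_ac)
  show "Theta \<Omega> t $$ (0, 0) * a + Theta \<Omega> t $$ (0, 1) * b = theta_fst a b t"
    using **[of c "\<lambda>i. (\<Sum>j<n. q i j * e j) / (t - x i)" "\<lambda>i. (\<Sum>j<n. q i j * (- c j)) / (t - x i)"]
    unfolding * by (simp add: Theta_entry[OF t] theta_fst_def algebra_simps)
  show "Theta \<Omega> t $$ (1, 0) * a + Theta \<Omega> t $$ (1, 1) * b = theta_snd a b t"
    using **[of e "\<lambda>i. (\<Sum>j<n. q i j * e j) / (t - x i)" "\<lambda>i. (\<Sum>j<n. q i j * (- c j)) / (t - x i)"]
    unfolding * by (simp add: Theta_entry[OF t] theta_snd_def algebra_simps)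
qed

end

subsection \<open>Linear fractional transforms and the bordered kernel\<close>

lemma hform_Plus:
  assumes "finite A" "finite Z"
  shows "hform H (Inl ` A \<union> Inr ` Z) u v =
     hform (\<lambda>i j. H (Inl i) (Inl j)) A (u \<circ> Inl) (v \<circ> Inl)
   + (\<Sum>i\<in>A. cnj (u (Inl i)) * (\<Sum>z\<in>Z. H (Inl i) (Inr z) * v (Inr z)))
   + (\<Sum>z\<in>Z. cnj (u (Inr z)) * (\<Sum>i\<in>A. H (Inr z) (Inl i) * v (Inl i)))
   + hform (\<lambda>s t. H (Inr s) (Inr t)) Z (u \<circ> Inr) (v \<circ> Inr)"
proof -
  have *: "(\<Sum>a\<in>Inl ` A \<union> Inr ` Z. f a) = (\<Sum>i\<in>A. f (Inl i)) + (\<Sum>z\<in>Z. f (Inr z))" for f :: "'a + 'b \<Rightarrow> complex"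
    using assms by (subst sum.union_disjoint) (auto simp: sum.reindex inj_on_def)
  show ?thesis
    unfolding hform_eq * by (simp add: distrib_left sum.distrib)
qed

text \<open>A finite set is moved off the exceptional set by one common small translation
  \<open>h\<close>; continuity is therefore asked only along simultaneous shifts of both
  arguments.\<close>

lemma neg_le_on_cosparse:
  fixes K :: "complex \<Rightarrow> complex \<Rightarrow> complex"
  assumes "herm K" "S \<subseteq> upper_half_plane"
    and cont: "\<And>s t. s \<in> S \<Longrightarrow> t \<in> S \<Longrightarrow> ((\<lambda>h. K (s + h) (t + h)) \<longlongrightarrow> K s t) (at 0)"
    and G: "\<forall>\<^sub>\<approx>z\<in>upper_half_plane. z \<in> G"
    and le: "neg_le_on K G k"
  shows "neg_le_on K S k"
  unfolding neg_le_on_def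
proof (intro allI impI, elim conjE)
  fix Z assume Z: "finite Z" "Z \<subseteq> S"
  show "neg_le K Z k"
  proof (rule neg_le_limit[OF Z(1) assms(1), of "at 0"])
    show "((\<lambda>h. K (s + h) (t + h)) \<longlongrightarrow> K s t) (at 0)" if "s \<in> Z" "t \<in> Z" for s t
      using cont that Z by auto
    have "\<forall>\<^sub>F h in at 0. \<forall>z\<in>Z. z + h \<in> G"
    proof (intro eventually_ball_finite Z(1) ballI)
      fix z assume "z \<in> Z"
      hence "\<forall>\<^sub>F z in at z. z \<in> G"
        using Z(2) assms(2) eventually_cosparse_imp_eventually_at[OF G] by blast
      thus "\<forall>\<^sub>F h in at 0. z + h \<in> G"
        by (subst (asm) at_to_0) (simp add: eventually_filtermap add.commute)
    qed
    thus "\<forall>\<^sub>F h in at 0. neg_le (\<lambda>i j. K (i + h) (j + h)) Z k"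
      by eventually_elim (rule neg_le_family[OF le Z(1)], auto)
  qed auto
qed

lemma analyticity_domain_cosparse:
  assumes "w nicely_meromorphic_on upper_half_plane"
  shows "\<forall>\<^sub>\<approx>z\<in>upper_half_plane. z \<in> analyticity_domain w"
proof -
  have "\<forall>\<^sub>\<approx>z\<in>upper_half_plane. w analytic_on {z}"
    using assms by (intro meromorphic_on_imp_analytic_cosparse) (auto simp: nicely_meromorphic_on_def)
  moreover have "\<forall>\<^sub>\<approx>z\<in>upper_half_plane. z \<in> upper_half_plane"
    by (rule eventually_in_cosparse) (auto simp: open_upper_half_plane)
  ultimately show ?thesis by eventually_elim (auto simp: analyticity_domain_def)
qed

lemma analyticity_domain_subset: "analyticity_domain w \<subseteq> upper_half_plane"
  by (auto simp: analyticity_domain_def)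

lemma uhp_diff_cnj: "s \<in> upper_half_plane \<Longrightarrow> t \<in> upper_half_plane \<Longrightarrow> t - cnj s \<noteq> 0"
  by (auto simp: upper_half_plane_def complex_eq_iff)

lemma analyticity_domain_shift:
  assumes "s \<in> analyticity_domain w"
  shows "((\<lambda>h. w (s + h)) \<longlongrightarrow> w s) (at 0)"
  using analytic_at_imp_isCont[of w s] assms by (auto simp: analyticity_domain_def isCont_iff)

lemma nk_cont:
  assumes "s \<in> analyticity_domain w" "t \<in> analyticity_domain w"
  shows "((\<lambda>h. nk w (s + h) (t + h)) \<longlongrightarrow> nk w s t) (at 0)"
proof -
  have "t - cnj s \<noteq> 0" using assms by (intro uhp_diff_cnj) (auto simp: analyticity_domain_def)
  moreover have "((\<lambda>h. t + h - cnj (s + h)) \<longlongrightarrow> t + 0 - cnj (s + 0)) (at 0)"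
    by (intro tendsto_intros)
  moreover have "((\<lambda>h. w (t + h) - cnj (w (s + h))) \<longlongrightarrow> w t - cnj (w s)) (at 0)"
    by (intro tendsto_diff tendsto_cnj analyticity_domain_shift assms)
  ultimately show ?thesis
    unfolding nk_def nevanlinna_kernel_def by (intro tendsto_divide) simp_all
qed

section \<open>Negative squares of the bordered kernel and of its Schur complement\<close>

context interpolation_data
begin

definition neg where "neg = sq_neg (pick_matrix \<Omega>)"

lemma hermitian_pick: "hermitian_matrix (pick_matrix \<Omega>) n"
proof
  fix i j assume "i < n" "j < n"
  moreover have "p j i = cnj (p i j)" by (simp add: cnj_p p_sym[of j i])
  ultimately show "pick_matrix \<Omega> $$ (j, i) = cnj (pick_matrix \<Omega> $$ (i, j))"
    by (simp add: pick_matrix_def p_def)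
qed (rule pick_carrier)

lemma ent_pick: "i < n \<Longrightarrow> j < n \<Longrightarrow> hermitian_matrix.ent (pick_matrix \<Omega>) n i j = p i j"
  unfolding hermitian_matrix.ent_def[OF hermitian_pick] by (simp add: pick_matrix_def p_def)

lemma herm_p: "herm p"
  unfolding herm_def by (metis cnj_p p_sym)

lemma pick_neg_le: "neg_le p {..<n} neg"
  using hermitian_matrix.sq_neg_form(1)[OF hermitian_pick]
  unfolding neg_def by (subst (asm) neg_le_cong[OF ent_pick]) auto

lemma pick_neg_system: "\<exists>v. neg_system p {..<n} neg v"
proof -
  obtain v where "neg_system (hermitian_matrix.ent (pick_matrix \<Omega>) n) {..<n} neg v"
    using hermitian_matrix.sq_neg_form(2)[OF hermitian_pick] unfolding neg_def by blast
  moreover have "hform (hermitian_matrix.ent (pick_matrix \<Omega>) n) {..<n} a b = hform p {..<n} a b" for a b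
    by (rule hform_cong) (auto simp: ent_pick)
  ultimately have "neg_system p {..<n} neg v" by (simp add: neg_system_def)
  thus ?thesis by blast
qed

abbreviation bdr where "bdr w t i \<equiv> border (w t) 1 t i"
abbreviation cf where "cf w t i \<equiv> coef (w t) 1 t i"

lemma fmi_bdr: "fmi \<Omega> w (Inl i) (Inr t) = bdr w t i"
  by (simp add: fmi_Inl_Inr border_def x_def)

lemma fmi_bdr': "fmi \<Omega> w (Inr t) (Inl i) = cnj (bdr w t i)"
  using herm_fmi[of \<Omega> w] fmi_bdr[of w i t] unfolding herm_def by metis

text \<open>The Schur complement of the block \<open>P\<close> in the bordered kernel.\<close>

definition compl :: "(complex \<Rightarrow> complex) \<Rightarrow> complex \<Rightarrow> complex \<Rightarrow> complex" where
  "compl w s t = nk w s t - (\<Sum>i<n. cnj (bdr w s i) * cf w t i)"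

lemma hform_fmi_nodes:
  "hform (\<lambda>i j. fmi \<Omega> w (Inl i) (Inl j)) {..<n} u v = hform p {..<n} u v"
  by (rule hform_cong) (auto simp: fmi_pp)

lemma hform_p_coef:
  "hform p {..<n} y (\<lambda>i. \<Sum>z\<in>Z. cf w z i * u z) = (\<Sum>i<n. cnj (y i) * (\<Sum>z\<in>Z. bdr w z i * u z))"
proof -
  have "(\<Sum>j<n. p i j * (\<Sum>z\<in>Z. cf w z j * u z)) = (\<Sum>z\<in>Z. bdr w z i * u z)" if "i < n" for i
  proof -
    have "(\<Sum>j<n. p i j * (\<Sum>z\<in>Z. cf w z j * u z)) = (\<Sum>z\<in>Z. \<Sum>j<n. p i j * cf w z j * u z)"
      unfolding sum_distrib_left by (subst sum.swap) (simp add: mult.assoc)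
    also have "\<dots> = (\<Sum>z\<in>Z. bdr w z i * u z)"
      unfolding sum_distrib_right[symmetric] by (simp add: p_coef[OF that])
    finally show ?thesis .
  qed
  thus ?thesis unfolding hform_eq by (intro sum.cong) auto
qed

text \<open>Completing the square in the node coordinates: \<open>h u\<close> is the inverse of
  \<open>P\<close> applied to the border terms of \<open>u\<close>.\<close>

lemma hform_fmi:
  fixes w :: "complex \<Rightarrow> complex"
  assumes Z: "finite Z"
  defines "h \<equiv> \<lambda>u i. \<Sum>z\<in>Z. cf w z i * u (Inr z)"
  shows "hform (fmi \<Omega> w) (Inl ` {..<n} \<union> Inr ` Z) u u =
     hform p {..<n} (\<lambda>i. u (Inl i) + h u i) (\<lambda>i. u (Inl i) + h u i) + hform (compl w) Z (u \<circ> Inr) (u \<circ> Inr)"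
proof -
  define y where "y = u \<circ> Inl"
  define f where "f i = (\<Sum>z\<in>Z. bdr w z i * u (Inr z))" for i
  have yh: "hform p {..<n} v (h u) = (\<Sum>i<n. cnj (v i) * f i)" for v
    unfolding h_def f_def by (rule hform_p_coef)
  have hy: "hform p {..<n} (h u) y = (\<Sum>i<n. cnj (f i) * y i)"
    by (subst hform_cnj[OF herm_p]) (simp add: yh mult.commute)
  have 1: "(\<Sum>z\<in>Z. cnj (u (Inr z)) * (\<Sum>i<n. fmi \<Omega> w (Inr z) (Inl i) * u (Inl i))) = (\<Sum>i<n. cnj (f i) * y i)"
  proof -
    have "(\<Sum>z\<in>Z. cnj (u (Inr z)) * (\<Sum>i<n. fmi \<Omega> w (Inr z) (Inl i) * u (Inl i)))
       = (\<Sum>z\<in>Z. \<Sum>i<n. cnj (bdr w z i * u (Inr z)) * y i)"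
      unfolding fmi_bdr' sum_distrib_left by (simp add: y_def mult_ac)
    also have "\<dots> = (\<Sum>i<n. cnj (f i) * y i)"
      by (subst sum.swap) (simp add: f_def sum_distrib_right)
    finally show ?thesis .
  qed
  have "hform (compl w) Z (u \<circ> Inr) (u \<circ> Inr) = hform (nk w) Z (u \<circ> Inr) (u \<circ> Inr)
      - (\<Sum>s\<in>Z. \<Sum>t\<in>Z. \<Sum>i<n. cnj (bdr w s i * u (Inr s)) * (cf w t i * u (Inr t)))"
    unfolding hform_def compl_def
    by (simp add: algebra_simps sum_subtractf sum_distrib_left sum_distrib_right)
  also have "(\<Sum>s\<in>Z. \<Sum>t\<in>Z. \<Sum>i<n. cnj (bdr w s i * u (Inr s)) * (cf w t i * u (Inr t)))
      = (\<Sum>i<n. \<Sum>s\<in>Z. \<Sum>t\<in>Z. cnj (bdr w s i * u (Inr s)) * (cf w t i * u (Inr t)))"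
    by (subst sum.swap[of _ "{..<n}"], subst sum.swap[of _ "{..<n}"]) (rule refl)
  also have "\<dots> = (\<Sum>i<n. cnj (f i) * h u i)"
    unfolding f_def h_def by (simp only: cnj_sum sum_product)
  also have "(\<Sum>i<n. cnj (f i) * h u i) = hform p {..<n} (h u) (h u)"
  proof -
    have "hform p {..<n} (h u) (h u) = cnj (hform p {..<n} (h u) (h u))" by (rule hform_cnj[OF herm_p])
    thus ?thesis by (simp add: yh mult.commute)
  qed
  finally have 2: "hform (compl w) Z (u \<circ> Inr) (u \<circ> Inr) = hform (nk w) Z (u \<circ> Inr) (u \<circ> Inr)
      - hform p {..<n} (h u) (h u)" .
  have "hform (fmi \<Omega> w) (Inl ` {..<n} \<union> Inr ` Z) u u =
      hform p {..<n} y y + (\<Sum>i<n. cnj (y i) * f i) + (\<Sum>i<n. cnj (f i) * y i) + hform (nk w) Z (u \<circ> Inr) (u \<circ> Inr)"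
    using Z by (subst hform_Plus) (simp_all add: 1 hform_fmi_nodes fmi_Inr_Inr y_def fmi_bdr f_def cong: hform_cong)
  moreover have "hform p {..<n} (\<lambda>i. y i + h u i) (\<lambda>i. y i + h u i) =
      hform p {..<n} y y + (\<Sum>i<n. cnj (y i) * f i) + (\<Sum>i<n. cnj (f i) * y i) + hform p {..<n} (h u) (h u)"
    by (simp add: hform_add_left hform_add_right yh hy)
  ultimately show ?thesis unfolding 2 by (simp add: y_def)
qed

definition nodes_and :: "nat set \<Rightarrow> (complex \<Rightarrow> complex) \<Rightarrow> (nat + complex) set" where
  "nodes_and T w = Inl ` T \<union> Inr ` analyticity_domain w"

lemma finite_nodes_and:
  assumes "finite I" "I \<subseteq> nodes_and T w"
  shows "finite {z. Inr z \<in> I}" "{z. Inr z \<in> I} \<subseteq> analyticity_domain w" "I \<subseteq> Inl ` T \<union> Inr ` {z. Inr z \<in> I}"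
proof -
  have "{z. Inr z \<in> I} = Inr -` I" by auto
  thus "finite {z. Inr z \<in> I}" using assms(1) by (simp add: finite_vimageI)
  show "{z. Inr z \<in> I} \<subseteq> analyticity_domain w" "I \<subseteq> Inl ` T \<union> Inr ` {z. Inr z \<in> I}"
    using assms(2) by (auto simp: nodes_and_def)
qed

text \<open>Additivity of inertia under the block diagonalisation \<open>hform_fmi\<close>: the
  \<open>P\<close>-part accounts for exactly \<open>neg\<close> negative squares, which leaves none
  for the complement.\<close>

lemma fmi_iff_compl:
  "neg_le_on (fmi \<Omega> w) (nodes_and {..<n} w) neg \<longleftrightarrow> psd_on (compl w) (analyticity_domain w)"
proof
  assume psd: "psd_on (compl w) (analyticity_domain w)"
  show "neg_le_on (fmi \<Omega> w) (nodes_and {..<n} w) neg"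
    unfolding neg_le_on_def
  proof (intro allI impI, elim conjE)
    fix I assume I: "finite I" "I \<subseteq> nodes_and {..<n} w"
    define Z where "Z = {z. Inr z \<in> I}"
    have Z: "finite Z" "Z \<subseteq> analyticity_domain w" "I \<subseteq> Inl ` {..<n} \<union> Inr ` Z"
      using finite_nodes_and[OF I] by (auto simp: Z_def)
    obtain l where l: "\<And>y. (\<And>r. r < neg \<Longrightarrow> (\<Sum>i<n. l r i * y i) = 0) \<Longrightarrow> 0 \<le> Re (hform p {..<n} y y)"
      using pick_neg_le unfolding neg_le_def by auto
    \<comment> \<open>The functionals for \<open>P\<close>, composed with the change of variable
      that completes the square.\<close>
    define L where "L r a = (case a of Inl i \<Rightarrow> l r i | Inr z \<Rightarrow> \<Sum>i<n. l r i * cf w z i)" for r a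
    have "neg_le (fmi \<Omega> w) (Inl ` {..<n} \<union> Inr ` Z) neg"
      unfolding neg_le_def
    proof (intro exI[of _ L] allI impI)
      fix u assume u: "\<forall>r<neg. (\<Sum>a\<in>Inl ` {..<n} \<union> Inr ` Z. L r a * u a) = 0"
      have "(\<Sum>a\<in>Inl ` {..<n} \<union> Inr ` Z. L r a * u a)
          = (\<Sum>i<n. l r i * (u (Inl i) + (\<Sum>z\<in>Z. cf w z i * u (Inr z))))" for r
      proof -
        have "(\<Sum>a\<in>Inl ` {..<n} \<union> Inr ` Z. L r a * u a)
            = (\<Sum>i<n. l r i * u (Inl i)) + (\<Sum>z\<in>Z. \<Sum>i<n. l r i * cf w z i * u (Inr z))"
          using Z by (subst sum.union_disjoint) (auto simp: sum.reindex inj_on_def L_def sum_distrib_right)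
        also have "(\<Sum>z\<in>Z. \<Sum>i<n. l r i * cf w z i * u (Inr z)) = (\<Sum>i<n. \<Sum>z\<in>Z. l r i * cf w z i * u (Inr z))"
          by (rule sum.swap)
        finally show ?thesis by (simp add: distrib_left sum.distrib sum_distrib_left mult.assoc)
      qed
      hence "0 \<le> Re (hform p {..<n} (\<lambda>i. u (Inl i) + (\<Sum>z\<in>Z. cf w z i * u (Inr z))) (\<lambda>i. u (Inl i) + (\<Sum>z\<in>Z. cf w z i * u (Inr z))))"
        using u by (intro l) simp
      moreover have "0 \<le> Re (hform (compl w) Z (u \<circ> Inr) (u \<circ> Inr))"
        using psd Z by (auto simp: psd_on_def)
      ultimately show "0 \<le> Re (hform (fmi \<Omega> w) (Inl ` {..<n} \<union> Inr ` Z) u u)"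
        unfolding hform_fmi[OF Z(1)] by simp
    qed
    thus "neg_le (fmi \<Omega> w) I neg" by (rule neg_le_subset) (use Z in auto)
  qed
next
  assume le: "neg_le_on (fmi \<Omega> w) (nodes_and {..<n} w) neg"
  show "psd_on (compl w) (analyticity_domain w)"
    unfolding psd_on_def
  proof (intro allI impI, rule ccontr)
    fix Z and u :: "complex \<Rightarrow> complex"
    assume Z: "finite Z" "Z \<subseteq> analyticity_domain w" and neg0: "\<not> 0 \<le> Re (hform (compl w) Z u u)"
    let ?I = "Inl ` {..<n} \<union> Inr ` Z"
    have leI: "neg_le (fmi \<Omega> w) ?I neg"
      by (rule neg_le_onD[OF le]) (use Z in \<open>auto simp: nodes_and_def\<close>)
    obtain v where v: "neg_system p {..<n} neg v" using pick_neg_system by blast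
    define v' where "v' j a = (case a of Inl i \<Rightarrow> v j i | Inr z \<Rightarrow> 0)" for j and a :: "nat + complex"
    \<comment> \<open>The node coordinates are chosen so that the completed square vanishes; the
      form at \<open>u'\<close> is then the complement at \<open>u\<close>, and \<open>u'\<close> is
      orthogonal to the node part.\<close>
    define u' where "u' a = (case a of Inl i \<Rightarrow> - (\<Sum>z\<in>Z. cf w z i * u z) | Inr z \<Rightarrow> u z)" for a
    have v'l: "v' j \<circ> Inl = v j" and v'r: "v' j \<circ> Inr = (\<lambda>z. 0)" for j
      by (auto simp: v'_def)
    have "neg_system (fmi \<Omega> w) ?I neg v'"
      using v Z unfolding neg_system_def
      by (auto simp: hform_Plus v'l v'r hform_fmi_nodes) (auto simp: v'_def)
    moreover have "hform (fmi \<Omega> w) ?I (v' j) u' = 0" for j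
    proof -
      have "hform (fmi \<Omega> w) ?I (v' j) u' = hform p {..<n} (v j) (\<lambda>i. - (\<Sum>z\<in>Z. cf w z i * u z))
           + (\<Sum>i<n. cnj (v j i) * (\<Sum>z\<in>Z. bdr w z i * u z))"
        using Z by (simp add: hform_Plus v'l v'r hform_fmi_nodes fmi_bdr) (simp add: v'_def u'_def comp_def)
      also have "hform p {..<n} (v j) (\<lambda>i. - (\<Sum>z\<in>Z. cf w z i * u z)) = - hform p {..<n} (v j) (\<lambda>i. \<Sum>z\<in>Z. cf w z i * u z)"
        using hform_scale_right[of p "{..<n}" "v j" "-1" "\<lambda>i. \<Sum>z\<in>Z. cf w z i * u z"] by simp
      also have "hform p {..<n} (v j) (\<lambda>i. \<Sum>z\<in>Z. cf w z i * u z) = (\<Sum>i<n. cnj (v j i) * (\<Sum>z\<in>Z. bdr w z i * u z))"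
        by (rule hform_p_coef)
      finally show ?thesis by simp
    qed
    moreover have "hform (fmi \<Omega> w) ?I u' u' = hform (compl w) Z u u"
      unfolding hform_fmi[OF Z(1)] by (simp add: u'_def comp_def)
    ultimately have "Suc neg \<le> neg"
      using neg0 by (intro neg_le_system_bound[OF leI neg_system_extend[OF herm_fmi]]) auto
    thus False by simp
  qed
qed

section \<open>From the linear fractional transform to the Schur complement and back\<close>

lemma t_neq_x: "t \<in> upper_half_plane \<Longrightarrow> t \<noteq> x i"
  by (auto simp: upper_half_plane_def x_def)

lemma compl_eq:
  assumes "s \<in> upper_half_plane" "t \<in> upper_half_plane"
  shows "compl w s t = (numer (w t) 1 t * cnj (denom (w s) 1 s) - denom (w t) 1 t * cnj (numer (w s) 1 s)) / (t - cnj s)"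
  using uhp_diff_cnj[OF assms] t_neq_x assms
  by (subst schur_identity) (auto simp: compl_def nk_def nevanlinna_kernel_def field_simps)

lemma herm_compl: "herm (compl w)"
proof -
  have "compl w t s = cnj (compl w s t)" for s t
  proof -
    have "(\<Sum>i<n. cnj (bdr w s i) * cf w t i) = hform p {..<n} (cf w s) (cf w t)" for s t
    proof -
      have "hform p {..<n} (cf w s) (cf w t) = cnj (hform p {..<n} (cf w t) (cf w s))"
        by (rule hform_cnj[OF herm_p])
      thus ?thesis by (simp add: hform_eq p_coef mult.commute)
    qed
    moreover have "hform p {..<n} (cf w t) (cf w s) = cnj (hform p {..<n} (cf w s) (cf w t))"
      by (rule hform_cnj[OF herm_p])
    ultimately have S: "(\<Sum>i<n. cnj (bdr w t i) * cf w s i) = cnj (\<Sum>i<n. cnj (bdr w s i) * cf w t i)"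
      by (simp only:)
    have N: "nk w t s = cnj (nk w s t)" using herm_nk[of w] unfolding herm_def by blast
    show ?thesis unfolding compl_def complex_cnj_diff using arg_cong2[of _ _ _ _ "(-)", OF N S] .
  qed
  thus ?thesis unfolding herm_def by blast
qed

lemma border_cont:
  assumes "s \<in> analyticity_domain w"
  shows "((\<lambda>h. bdr w (s + h) i) \<longlongrightarrow> bdr w s i) (at 0)"
proof -
  have "s \<noteq> x i" using assms by (intro t_neq_x) (auto simp: analyticity_domain_def)
  moreover have "((\<lambda>h. s + h - x i) \<longlongrightarrow> s + 0 - x i) (at 0)" by (intro tendsto_intros)
  moreover have "((\<lambda>h. e i * w (s + h) - c i * 1) \<longlongrightarrow> e i * w s - c i * 1) (at 0)"
    by (intro tendsto_diff tendsto_mult tendsto_const analyticity_domain_shift assms)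
  ultimately show ?thesis unfolding border_def by (intro tendsto_divide) simp_all
qed

lemma compl_cont:
  assumes "s \<in> analyticity_domain w" "t \<in> analyticity_domain w"
  shows "((\<lambda>h. compl w (s + h) (t + h)) \<longlongrightarrow> compl w s t) (at 0)"
  unfolding compl_def coef_def
  by (intro tendsto_intros nk_cont border_cont assms)

lemma numer_scale: "numer (k * U) (k * V) t = k * numer U V t"
  and denom_scale: "denom (k * U) (k * V) t = k * denom U V t"
proof -
  have "border (k * U) (k * V) t i = k * border U V t i" for i
    by (simp add: border_def algebra_simps diff_divide_distrib)
  hence "coef (k * U) (k * V) t i = k * coef U V t i" for i
    by (simp add: coef_def sum_distrib_left mult_ac)
  thus "numer (k * U) (k * V) t = k * numer U V t" "denom (k * U) (k * V) t = k * denom U V t"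
    by (simp_all add: numer_def denom_def algebra_simps sum_distrib_left)
qed

text \<open>The denominator of the transform is the projective factor between \<open>(w, 1)\<close>
  and the image under \<open>Theta\<close> of \<open>(\<phi>, 1)\<close>, or of
  \<open>(1, 0)\<close> for \<open>None\<close>; applying the inverse of \<open>Theta\<close> and
  homogeneity gives both equations.\<close>

lemma lft_num_den:
  assumes "t \<in> upper_half_plane" "lft_den (Theta \<Omega>) \<phi> t \<noteq> 0"
    "w t = lft_num (Theta \<Omega>) \<phi> t / lft_den (Theta \<Omega>) \<phi> t"
  shows "lft_den (Theta \<Omega>) \<phi> t * numer (w t) 1 t = (case \<phi> of Some f \<Rightarrow> f t | None \<Rightarrow> 1)"
    and "lft_den (Theta \<Omega>) \<phi> t * denom (w t) 1 t = (case \<phi> of Some f \<Rightarrow> 1 | None \<Rightarrow> 0)"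
proof -
  define a b where "a = (case \<phi> of Some f \<Rightarrow> f t | None \<Rightarrow> 1)" and "b = (case \<phi> of Some f \<Rightarrow> (1::complex) | None \<Rightarrow> 0)"
  have ne: "\<And>i. i < n \<Longrightarrow> t \<noteq> x i" using assms(1) t_neq_x by blast
  have "lft_num (Theta \<Omega>) \<phi> t = theta_fst a b t"
    using Theta_apply(1)[OF ne, of a b] by (cases \<phi>) (simp_all add: a_def b_def)
  moreover have "lft_den (Theta \<Omega>) \<phi> t = theta_snd a b t"
    using Theta_apply(2)[OF ne, of a b] by (cases \<phi>) (simp_all add: a_def b_def)
  moreover from calculation have "theta_fst a b t = theta_snd a b t * w t"
    using assms(2,3) by auto
  moreover have "theta_snd a b t * numer (w t) 1 t = numer (theta_snd a b t * w t) (theta_snd a b t * 1) t"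
    "theta_snd a b t * denom (w t) 1 t = denom (theta_snd a b t * w t) (theta_snd a b t * 1) t"
    by (simp_all only: numer_scale denom_scale)
  ultimately show "lft_den (Theta \<Omega>) \<phi> t * numer (w t) 1 t = a" "lft_den (Theta \<Omega>) \<phi> t * denom (w t) 1 t = b"
    using inverse_theta[OF ne, of a b] by simp_all
qed

text \<open>Off a sparse set the complement is the kernel of \<phi> rescaled by the reciprocal
  denominator. For \<open>None\<close> the function \<open>denom\<close> vanishes, and with it the
  complement. Continuity extends positivity to all points of analyticity.\<close>

lemma lft_imp_compl:
  assumes w: "w nicely_meromorphic_on upper_half_plane"
    and phi: "\<phi> \<in> ext_gen_nevanlinna 0" and lft: "is_lft w (Theta \<Omega>) \<phi>"
  shows "psd_on (compl w) (analyticity_domain w)"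
proof -
  define G where "G = {t \<in> upper_half_plane. lft_den (Theta \<Omega>) \<phi> t \<noteq> 0 \<and>
    w t = lft_num (Theta \<Omega>) \<phi> t / lft_den (Theta \<Omega>) \<phi> t \<and> (\<forall>f. \<phi> = Some f \<longrightarrow> t \<in> analyticity_domain f)}"
  have phi': "f nicely_meromorphic_on upper_half_plane" "neg_le_on (nk f) (analyticity_domain f) 0" if "\<phi> = Some f" for f
    using phi that gen_nevanlinna_neg_le[of f 0] by (auto simp: ext_gen_nevanlinna_def gen_nevanlinna_def)
  have "\<forall>\<^sub>\<approx>t\<in>upper_half_plane. \<forall>f. \<phi> = Some f \<longrightarrow> t \<in> analyticity_domain f"
    using analyticity_domain_cosparse[OF phi'(1)] by (cases \<phi>) auto
  moreover have "\<forall>\<^sub>\<approx>z\<in>upper_half_plane. z \<in> upper_half_plane"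
    by (rule eventually_in_cosparse) (auto simp: open_upper_half_plane)
  ultimately have G: "\<forall>\<^sub>\<approx>t\<in>upper_half_plane. t \<in> G"
    using lft unfolding is_lft_def by eventually_elim (auto simp: G_def)
  have nd: "lft_den (Theta \<Omega>) \<phi> t * numer (w t) 1 t = (case \<phi> of Some f \<Rightarrow> f t | None \<Rightarrow> 1)"
    "lft_den (Theta \<Omega>) \<phi> t * denom (w t) 1 t = (case \<phi> of Some f \<Rightarrow> 1 | None \<Rightarrow> 0)" if "t \<in> G" for t
    using lft_num_den[of t \<phi> w] that by (auto simp: G_def)
  have "neg_le_on (compl w) G 0"
    unfolding neg_le_on_def
  proof (intro allI impI, elim conjE)
    fix Z assume Z: "finite Z" "Z \<subseteq> G"
    show "neg_le (compl w) Z 0"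
    proof (cases \<phi>)
      case None
      have "denom (w t) 1 t = 0" if "t \<in> Z" for t
        using nd(2)[of t] that Z None by (auto simp: G_def)
      hence "compl w s t = 0" if "s \<in> Z" "t \<in> Z" for s t
        using that Z by (subst compl_eq) (auto simp: G_def)
      hence "hform (compl w) Z u u = 0" for u by (simp add: hform_def)
      thus ?thesis by (simp add: neg_le_0_iff)
    next
      case (Some f)
      have "neg_le (nk f) Z 0"
        by (rule neg_le_onD[OF phi'(2)[OF Some] Z(1)]) (use Z Some in \<open>auto simp: G_def\<close>)
      thus ?thesis
      proof (rule neg_le_transfer[where e = id and s = "\<lambda>t. 1 / lft_den (Theta \<Omega>) \<phi> t"])
        fix s t assume st: "s \<in> Z" "t \<in> Z"
        let ?d = "lft_den (Theta \<Omega>) \<phi>"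
        have d: "?d s \<noteq> 0" "?d t \<noteq> 0" and uhp: "s \<in> upper_half_plane" "t \<in> upper_half_plane"
          using st Z by (auto simp: G_def)
        have "numer (w t) 1 t = f t / ?d t" "denom (w t) 1 t = 1 / ?d t"
          "numer (w s) 1 s = f s / ?d s" "denom (w s) 1 s = 1 / ?d s"
          using nd[of t] nd[of s] st Z Some d by (auto simp: field_simps)
        thus "compl w (id s) (id t) = cnj (1 / ?d s) * nk f s t * (1 / ?d t)"
          unfolding id_apply compl_eq[OF uhp] nk_def nevanlinna_kernel_def
          by (simp only:) (use d in \<open>simp add: divide_simps\<close>)
      qed auto
    qed
  qed
  from neg_le_on_cosparse[OF herm_compl analyticity_domain_subset compl_cont G this]
  show ?thesis unfolding psd_on_iff .
qed

text \<open>The parameter is the quotient of \<open>numer\<close> and \<open>denom\<close>. As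
  \<open>denom\<close> is meromorphic on a connected set, it vanishes either identically, which
  gives the parameter \<infinity>, or only on a sparse set.\<close>

lemma compl_imp_lft:
  assumes w: "w nicely_meromorphic_on upper_half_plane"
    and psd: "psd_on (compl w) (analyticity_domain w)"
  shows "\<exists>\<phi>\<in>ext_gen_nevanlinna 0. is_lft w (Theta \<Omega>) \<phi>"
proof -
  define N D where "N t = numer (w t) 1 t" and "D t = denom (w t) 1 t" for t
  have mw: "w meromorphic_on upper_half_plane" using w by (simp add: nicely_meromorphic_on_def)
  have mN: "N meromorphic_on upper_half_plane" and mD: "D meromorphic_on upper_half_plane"
    unfolding N_def D_def numer_def denom_def coef_def border_def
    by (intro meromorphic_intros mw)+
  have conn: "connected upper_half_plane"
    unfolding upper_half_plane_def by (intro convex_connected convex_halfspace_Im_gt)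
  have uhp: "\<forall>\<^sub>\<approx>z\<in>upper_half_plane. z \<in> upper_half_plane"
    by (rule eventually_in_cosparse) (auto simp: open_upper_half_plane)
  have ti: "theta_fst (N t) (D t) t = w t" "theta_snd (N t) (D t) t = 1" if "t \<in> upper_half_plane" for t
    unfolding N_def D_def using theta_inverse[of t "w t" 1] t_neq_x[OF that] by auto
  have TA: "Theta \<Omega> t $$ (0, 0) * N t + Theta \<Omega> t $$ (0, 1) * D t = w t"
       "Theta \<Omega> t $$ (1, 0) * N t + Theta \<Omega> t $$ (1, 1) * D t = 1" if "t \<in> upper_half_plane" for t
    using Theta_apply[of t "N t" "D t"] t_neq_x[OF that] ti[OF that] by auto
  consider "\<forall>\<^sub>\<approx>t\<in>upper_half_plane. D t = 0" | "\<forall>\<^sub>\<approx>t\<in>upper_half_plane. D t \<noteq> 0"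
    using meromorphic_imp_constant_or_avoid[OF mD open_upper_half_plane conn] by blast
  thus ?thesis
  proof cases
    case 1
    have "is_lft w (Theta \<Omega>) None"
      unfolding is_lft_def using 1 uhp
    proof eventually_elim
      case (elim t)
      have *: "Theta \<Omega> t $$ (0, 0) * N t = w t" "Theta \<Omega> t $$ (1, 0) * N t = 1"
        using TA[OF elim(2)] elim(1) by auto
      hence "Theta \<Omega> t $$ (1, 0) \<noteq> 0" by auto
      moreover from this * have "N t = 1 / Theta \<Omega> t $$ (1, 0)" by (simp add: eq_divide_eq mult.commute)
      ultimately show ?case using *(1) by simp
    qed
    thus ?thesis by (auto simp: ext_gen_nevanlinna_def)
  next
    case 2
    \<comment> \<open>The plain quotient takes dummy values at zeros of \<open>D\<close>;
      \<open>remove_sings\<close> yields the normalised representative, equal to it off a sparse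
      set.\<close>
    define f where "f = remove_sings (\<lambda>t. N t / D t)"
    have mf: "(\<lambda>t. N t / D t) meromorphic_on upper_half_plane" by (intro meromorphic_intros mN mD)
    have f: "f nicely_meromorphic_on upper_half_plane"
      unfolding f_def by (rule remove_sings_nicely_meromorphic[OF mf])
    have feq: "\<forall>\<^sub>\<approx>t\<in>upper_half_plane. f t = N t / D t"
      unfolding f_def by (rule eventually_remove_sings_eq[OF mf])
    define G where "G = {t \<in> analyticity_domain w. D t \<noteq> 0 \<and> f t = N t / D t}"
    have G: "\<forall>\<^sub>\<approx>t\<in>upper_half_plane. t \<in> G"
      using 2 feq analyticity_domain_cosparse[OF w] by eventually_elim (auto simp: G_def)
    have "neg_le_on (nk f) G 0"
      unfolding neg_le_on_def
    proof (intro allI impI, elim conjE)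
      fix Z assume Z: "finite Z" "Z \<subseteq> G"
      have "neg_le (compl w) Z 0"
        using psd Z unfolding psd_on_iff neg_le_on_def by (auto simp: G_def)
      thus "neg_le (nk f) Z 0"
      proof (rule neg_le_transfer[where e = id and s = "\<lambda>t. 1 / D t"])
        fix s t assume st: "s \<in> Z" "t \<in> Z"
        have uhp: "s \<in> upper_half_plane" "t \<in> upper_half_plane" and d: "D s \<noteq> 0" "D t \<noteq> 0"
          and ff: "f s = N s / D s" "f t = N t / D t"
          using st Z by (auto simp: G_def analyticity_domain_def)
        show "nk f (id s) (id t) = cnj (1 / D s) * compl w s t * (1 / D t)"
          using d unfolding id_apply compl_eq[OF uhp] N_def[symmetric] D_def[symmetric] nk_def nevanlinna_kernel_def ff
          by (simp add: divide_simps)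
      qed auto
    qed
    from neg_le_on_cosparse[OF herm_nk analyticity_domain_subset nk_cont G this]
    obtain k where "k \<le> 0" "f \<in> gen_nevanlinna k" using gen_nevanlinna_exists[OF f] by blast
    hence "f \<in> gen_nevanlinna 0" by simp
    moreover have "is_lft w (Theta \<Omega>) (Some f)"
      unfolding is_lft_def using 2 uhp feq
    proof eventually_elim
      case (elim t)
      have "lft_den (Theta \<Omega>) (Some f) t * D t = 1" "lft_num (Theta \<Omega>) (Some f) t * D t = w t"
        using TA[OF elim(2)] elim(1,3) by (simp_all add: distrib_right)
      moreover from this have "lft_den (Theta \<Omega>) (Some f) t \<noteq> 0" by auto
      moreover from calculation have "D t = 1 / lft_den (Theta \<Omega>) (Some f) t"
        by (simp only: eq_divide_eq mult.commute) simp
      ultimately show ?case by (simp del: lft_num.simps lft_den.simps)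
    qed
    ultimately show ?thesis by (auto simp: ext_gen_nevanlinna_def)
  qed
qed

theorem lft_iff_fmi:
  assumes "w nicely_meromorphic_on upper_half_plane"
  shows "(\<exists>\<phi>\<in>ext_gen_nevanlinna 0. is_lft w (Theta \<Omega>) \<phi>) \<longleftrightarrow> neg_le_on (fmi \<Omega> w) (nodes_and {..<n} w) neg"
  unfolding fmi_iff_compl using lft_imp_compl[OF assms] compl_imp_lft[OF assms] by blast

end

subsection \<open>Interpolation conditions bound the negative squares\<close>

lemma vertical_approach:
  "filterlim (\<lambda>y. of_real x0 + \<i> * of_real y) (at (complex_of_real x0) within stolz_angle x0 1) (at_right 0)"
proof -
  have "((\<lambda>y. of_real x0 + \<i> * of_real y) \<longlongrightarrow> of_real x0 + \<i> * of_real 0) (at_right (0::real))"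
    by (intro tendsto_intros)
  moreover have "\<forall>\<^sub>F y in at_right (0::real). y > 0"
    by (simp add: eventually_at_right_less)
  hence "\<forall>\<^sub>F y in at_right (0::real). of_real x0 + \<i> * of_real y \<in> stolz_angle x0 1 \<and>
      of_real x0 + \<i> * of_real y \<noteq> complex_of_real x0"
    by eventually_elim (auto simp: stolz_angle_def)
  ultimately show ?thesis by (intro filterlim_at[THEN iffD2]) simp
qed

lemma nontangential_vertical:
  "nontangential_limit f x0 F \<Longrightarrow> filterlim (\<lambda>y. f (of_real x0 + \<i> * of_real y)) F (at_right 0)"
  unfolding nontangential_limit_def
  by (rule filterlim_compose[OF _ vertical_approach]) auto

lemma eventually_vertical_analytic:
  assumes "finite (upper_half_plane - analyticity_domain w)"
  shows "\<forall>\<^sub>F y in at_right 0. of_real x0 + \<i> * of_real y \<in> analyticity_domain w"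
proof -
  have "\<forall>\<^sub>F z in at (complex_of_real x0) within stolz_angle x0 1. z \<in> analyticity_domain w"
    using eventually_analyticity_domain[OF assms, of x0] at_within_stolz_le[of "complex_of_real x0" x0 1]
    by (simp add: le_filter_def)
  thus ?thesis using vertical_approach unfolding filterlim_iff by blast
qed

text \<open>The rule of l'Hopital on the vertical line: the derivative of \<open>Im w\<close> in
  \<open>y\<close> is \<open>Re w'\<close>, and \<open>Im w\<close> tends to 0 because the boundary
  value is real.\<close>

lemma boundary_derivative_quotient:
  assumes fin: "finite (upper_half_plane - analyticity_domain w)"
    and lim: "nontangential_limit w x0 (nhds (of_real v))"
    and der: "nontangential_limit (deriv w) x0 (nhds (of_real d))"
  shows "((\<lambda>y. Im (w (of_real x0 + \<i> * of_real y)) / y) \<longlongrightarrow> d) (at_right 0)"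
proof (rule lhopital_right_0)
  let ?z = "\<lambda>y. complex_of_real x0 + \<i> * of_real y"
  show "((\<lambda>y. Im (w (?z y))) \<longlongrightarrow> 0) (at_right 0)"
    using tendsto_Im[OF nontangential_vertical[OF lim]] by simp
  show "\<forall>\<^sub>F y in at_right 0. y \<noteq> (0::real)" by (simp add: eventually_at_filter)
  show "\<forall>\<^sub>F y in at_right 0. ((\<lambda>y. Im (w (?z y))) has_real_derivative Re (deriv w (?z y))) (at y)"
    using eventually_vertical_analytic[OF fin, of x0]
  proof eventually_elim
    case (elim y)
    hence "w field_differentiable at (?z y)"
      by (auto simp: analyticity_domain_def intro: analytic_on_imp_differentiable_at)
    hence "(w has_field_derivative deriv w (?z y)) (at (?z y))"
      by (simp add: field_differentiable_derivI)
    moreover have "(?z has_vector_derivative \<i>) (at y)"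
      by (auto intro!: derivative_eq_intros)
    ultimately have "((w \<circ> ?z) has_vector_derivative (\<i> * deriv w (?z y))) (at y)"
      by (rule field_vector_diff_chain_at[rotated])
    from bounded_linear.has_vector_derivative[OF bounded_linear_Im this]
    show ?case by (simp add: has_real_derivative_iff_has_vector_derivative comp_def)
  qed
  show "\<forall>\<^sub>F y in at_right 0. ((\<lambda>y. y) has_real_derivative 1) (at y)" by simp
  show "((\<lambda>y. Re (deriv w (?z y)) / 1) \<longlongrightarrow> d) (at_right 0)"
    using tendsto_Re[OF nontangential_vertical[OF der]] by simp
qed (simp_all add: tendsto_ident_at)

section \<open>Boundary limits at nodes satisfying their condition\<close>

context interpolation_data
begin

text \<open>The factor by which \<open>(w z, 1)\<close> is multiplied so that it converges to the
  projective value \<open>(c i, e i)\<close> of the node, including the value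
  \<open>(\<xi>, 0)\<close> of a singular one.\<close>

definition scale :: "(complex \<Rightarrow> complex) \<Rightarrow> nat \<Rightarrow> complex \<Rightarrow> complex" where
  "scale w i z = (if i < n_reg \<Omega> then 1 else of_real (resid \<Omega> i) / w z)"

definition above :: "nat \<Rightarrow> real \<Rightarrow> complex" where
  "above i y = of_real (node \<Omega> i) + \<i> * of_real y"

text \<open>The common form of both kinds of condition: the rescaled projective values converge, and
  so does the diagonal of the kernel, to a number \<open>d\<close> not above the prescribed diagonal
  entry.\<close>

definition boundary_value :: "(complex \<Rightarrow> complex) \<Rightarrow> nat \<Rightarrow> real \<Rightarrow> bool" where
  "boundary_value w i d \<longleftrightarrow> d \<le> Re (fmi_diag \<Omega> i) \<and>
    ((\<lambda>y. scale w i (above i y) * w (above i y)) \<longlongrightarrow> c i) (at_right 0) \<and>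
    ((\<lambda>y. scale w i (above i y)) \<longlongrightarrow> e i) (at_right 0) \<and>
    ((\<lambda>y. cnj (scale w i (above i y)) * nk w (above i y) (above i y) * scale w i (above i y)) \<longlongrightarrow> of_real d) (at_right 0)"

text \<open>At a regular node the diagonal of the kernel is \<open>Im w / y\<close>, with limit the
  boundary derivative. At a singular node, with \<open>W = \<i> * y * w\<close>, the rescaled
  diagonal is minus the square of \<xi> times the real part of \<open>1/W\<close>.\<close>

lemma boundary_value_exists:
  assumes fin: "finite (upper_half_plane - analyticity_domain w)"
    and i: "i < n" "interp_cond \<Omega> w i"
  shows "\<exists>d. boundary_value w i d"
proof (cases "i < n_reg \<Omega>")
  case True
  let ?x = "node \<Omega> i"
  obtain d where lim: "nontangential_limit w ?x (nhds (of_real (val \<Omega> i)))"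
    and der: "nontangential_limit (deriv w) ?x (nhds (of_real d))" and d: "d \<le> slope \<Omega> i"
    using i(2) True by (auto simp: interp_cond_def Let_def)
  have "nk w (above i y) (above i y) = of_real (Im (w (above i y)) / y)" if "y > 0" for y
  proof -
    have "above i y - cnj (above i y) = 2 * \<i> * of_real y" by (simp add: above_def)
    moreover have "w (above i y) - cnj (w (above i y)) = 2 * \<i> * of_real (Im (w (above i y)))"
      by (simp add: complex_eq_iff)
    ultimately show ?thesis using that by (simp add: nk_def nevanlinna_kernel_def)
  qed
  hence "\<forall>\<^sub>F y in at_right 0. of_real (Im (w (above i y)) / y) = nk w (above i y) (above i y)"
    by (simp add: eventually_at_filter)
  moreover have "((\<lambda>y. complex_of_real (Im (w (above i y)) / y)) \<longlongrightarrow> of_real d) (at_right 0)"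
    unfolding above_def by (intro tendsto_of_real boundary_derivative_quotient[OF fin lim der])
  ultimately have "((\<lambda>y. nk w (above i y) (above i y)) \<longlongrightarrow> of_real d) (at_right 0)"
    using tendsto_cong by fast
  moreover have "((\<lambda>y. w (above i y)) \<longlongrightarrow> of_real (val \<Omega> i)) (at_right 0)"
    using nontangential_vertical[OF lim] by (simp add: above_def)
  ultimately show ?thesis
    using d True unfolding boundary_value_def
    by (intro exI[of _ d]) (simp add: scale_def data_fst_def data_snd_def fmi_diag_def)
next
  case False
  let ?x = "node \<Omega> i" and ?\<xi> = "resid \<Omega> i"
  have xi: "?\<xi> \<noteq> 0" using valid i(1) False by (auto simp: valid_data_def)
  define W where "W y = \<i> * of_real y * w (above i y)" for y
  have W: "filterlim W F (at_right 0)" if "nontangential_limit (\<lambda>z. (z - of_real ?x) * w z) ?x F" for F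
    using nontangential_vertical[OF that] by (simp add: W_def[abs_def] above_def)
  \<comment> \<open>\<rho> is the reciprocal of the limit of \<open>(z - x) * w z\<close>, with 0
    for an infinite limit; both alternatives of \<open>interp_cond\<close> then become one
    inequality.\<close>
  obtain \<rho> :: real where \<rho>: "((\<lambda>y. inverse (W y)) \<longlongrightarrow> of_real \<rho>) (at_right 0)"
      "\<forall>\<^sub>F y in at_right 0. W y \<noteq> 0" "- \<rho> \<le> - 1 / ?\<xi>"
  proof -
    consider r where "r \<noteq> 0" "(W \<longlongrightarrow> of_real r) (at_right 0)" "- 1 / r \<le> - 1 / ?\<xi>"
      | "filterlim W at_infinity (at_right 0)" "0 \<le> - 1 / ?\<xi>"
      using i(2) False W by (auto simp: interp_cond_def Let_def)
    thus ?thesis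
    proof cases
      case 1
      have "((\<lambda>y. inverse (W y)) \<longlongrightarrow> inverse (of_real r)) (at_right 0)"
        using 1 by (intro tendsto_inverse) auto
      moreover have "\<forall>\<^sub>F y in at_right 0. W y \<noteq> 0"
        using 1 by (intro tendsto_imp_eventually_ne[of W "of_real r"]) auto
      ultimately show ?thesis using that[of "inverse r"] 1 by (simp add: inverse_eq_divide)
    next
      case 2
      have "((\<lambda>y. inverse (W y)) \<longlongrightarrow> 0) (at_right 0)"
        using 2(1) by (rule filterlim_compose[OF tendsto_inverse_0])
      moreover have "\<forall>\<^sub>F y in at_right 0. W y \<noteq> 0"
        using 2(1) eventually_not_equal_at_infinity unfolding filterlim_iff by blast
      ultimately show ?thesis using that[of 0] 2 by simp
    qed
  qed
  have pos: "\<forall>\<^sub>F y in at_right (0::real). y > 0" by (simp add: eventually_at_right_less)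
  have "\<forall>\<^sub>F y in at_right 0. c i = scale w i (above i y) * w (above i y)"
    using \<rho>(2) by eventually_elim (use False in \<open>auto simp: W_def scale_def data_fst_def\<close>)
  hence 1: "((\<lambda>y. scale w i (above i y) * w (above i y)) \<longlongrightarrow> c i) (at_right 0)"
    by (rule Lim_transform_eventually[OF tendsto_const])
  have sc: "\<forall>\<^sub>F y in at_right 0. of_real ?\<xi> * (\<i> * of_real y) * inverse (W y) = scale w i (above i y)"
    using pos by eventually_elim (use False in \<open>auto simp: W_def scale_def field_simps\<close>)
  have "((\<lambda>y. of_real ?\<xi> * (\<i> * of_real y) * inverse (W y)) \<longlongrightarrow> of_real ?\<xi> * (\<i> * of_real 0) * of_real \<rho>) (at_right 0)"
    by (intro tendsto_intros \<rho>(1))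
  hence 2: "((\<lambda>y. scale w i (above i y)) \<longlongrightarrow> e i) (at_right 0)"
    using Lim_transform_eventually[OF _ sc] False by (simp add: data_snd_def)
  have ev: "\<forall>\<^sub>F y in at_right 0. - of_real (?\<xi>\<^sup>2) * (cnj (inverse (W y)) + inverse (W y)) / 2
      = cnj (scale w i (above i y)) * nk w (above i y) (above i y) * scale w i (above i y)"
    using pos \<rho>(2)
  proof eventually_elim
    case (elim y)
    let ?w = "w (above i y)"
    have w0: "?w \<noteq> 0" "y \<noteq> 0" using elim by (auto simp: W_def)
    have s: "scale w i (above i y) = of_real ?\<xi> / ?w" using False by (simp add: scale_def)
    have k: "nk w (above i y) (above i y) = (?w - cnj ?w) / (2 * \<i> * of_real y)"
      by (simp add: nk_def nevanlinna_kernel_def above_def)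
    show ?case unfolding s k W_def using w0
      by (simp add: field_simps power2_eq_square)
  qed
  have lim: "((\<lambda>y. - of_real (?\<xi>\<^sup>2) * (cnj (inverse (W y)) + inverse (W y)) / 2)
      \<longlongrightarrow> - of_real (?\<xi>\<^sup>2) * (cnj (of_real \<rho>) + of_real \<rho>) / 2) (at_right 0)"
    by (intro tendsto_intros \<rho>(1)) auto
  have "- of_real (?\<xi>\<^sup>2) * (cnj (of_real \<rho>) + of_real \<rho>) / 2 = complex_of_real (- ?\<xi>\<^sup>2 * \<rho>)" by simp
  hence 3: "((\<lambda>y. cnj (scale w i (above i y)) * nk w (above i y) (above i y) * scale w i (above i y))
      \<longlongrightarrow> of_real (- ?\<xi>\<^sup>2 * \<rho>)) (at_right 0)"
    using Lim_transform_eventually[OF lim ev] by (simp only:)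
  have "?\<xi>\<^sup>2 * (- \<rho>) \<le> ?\<xi>\<^sup>2 * (- 1 / ?\<xi>)" using \<rho>(3) by (intro mult_left_mono) auto
  also have "\<dots> = - ?\<xi>" using xi by (simp add: power2_eq_square)
  finally have "- ?\<xi>\<^sup>2 * \<rho> \<le> Re (fmi_diag \<Omega> i)" using False by (simp add: fmi_diag_def)
  with 1 2 3 show ?thesis unfolding boundary_value_def by blast
qed

lemma solution_neg_le:
  assumes w: "w \<in> gen_nevanlinna k" and S: "S \<subseteq> {..<n}" "\<And>i. i \<in> S \<Longrightarrow> interp_cond \<Omega> w i"
  shows "neg_le_on (fmi \<Omega> w) (nodes_and S w) k"
proof -
  have le: "neg_le_on (nk w) (analyticity_domain w) k" by (rule gen_nevanlinna_neg_le[OF w])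
  have fin: "finite (upper_half_plane - analyticity_domain w)"
    using w le by (intro finite_poles) (auto simp: gen_nevanlinna_def)
  have "\<forall>i\<in>S. \<exists>d. boundary_value w i d"
    using S by (intro ballI boundary_value_exists[OF fin]) auto
  from bchoice[OF this] obtain d where dl: "\<forall>i\<in>S. boundary_value w i (d i)" ..
  have d: "d i \<le> Re (fmi_diag \<Omega> i)"
    and lim: "((\<lambda>y. scale w i (above i y) * w (above i y)) \<longlongrightarrow> c i) (at_right 0)"
      "((\<lambda>y. scale w i (above i y)) \<longlongrightarrow> e i) (at_right 0)"
      "((\<lambda>y. cnj (scale w i (above i y)) * nk w (above i y) (above i y) * scale w i (above i y)) \<longlongrightarrow> of_real (d i)) (at_right 0)"
    if "i \<in> S" for i
    using dl that unfolding boundary_value_def by blast+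
  define pos where "pos y a = (case a of Inl i \<Rightarrow> above i y | Inr z \<Rightarrow> z)" for y :: real and a :: "nat + complex"
  define sc where "sc y a = (case a of Inl i \<Rightarrow> scale w i (above i y) | Inr z \<Rightarrow> 1)" for y :: real and a :: "nat + complex"
  \<comment> \<open>Moving the points into the nodes yields the entries of \<open>fmi\<close> except
    on the diagonal, where only the actual limits \<open>d i\<close> are reached; \<open>fmi\<close>
    arises from \<open>H\<close> by raising these entries.\<close>
  define H where "H a b = (if a = b \<and> isl a then of_real (d (projl a)) else fmi \<Omega> w a b)" for a b
  have "herm H"
  proof -
    have "H b a = cnj (H a b)" for a b
    proof (cases "a = b \<and> isl a")
      case True
      hence "isl b" "a = b" by auto
      thus ?thesis by (simp add: H_def)
    next
      case False
      hence "H b a = fmi \<Omega> w b a" "H a b = fmi \<Omega> w a b" by (auto simp: H_def)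
      thus ?thesis using herm_fmi[of \<Omega> w] unfolding herm_def by metis
    qed
    thus ?thesis unfolding herm_def by blast
  qed
  show ?thesis
    unfolding neg_le_on_def
  proof (intro allI impI, elim conjE)
    fix I assume I: "finite I" "I \<subseteq> nodes_and S w"
    have "neg_le H I k"
    proof (rule neg_le_limit[OF I(1) \<open>herm H\<close>])
      show "at_right (0::real) \<noteq> bot" by simp
      have "\<forall>\<^sub>F y in at_right 0. \<forall>a\<in>I. pos y a \<in> analyticity_domain w"
      proof (intro eventually_ball_finite I(1) ballI)
        fix a assume "a \<in> I"
        thus "\<forall>\<^sub>F y in at_right 0. pos y a \<in> analyticity_domain w"
          using I(2) eventually_vertical_analytic[OF fin]
          by (cases a) (auto simp: pos_def above_def nodes_and_def)
      qed
      thus "\<forall>\<^sub>F y in at_right 0. neg_le (\<lambda>a b. cnj (sc y a) * nk w (pos y a) (pos y b) * sc y b) I k"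
      proof eventually_elim
        case (elim y)
        have "neg_le (\<lambda>a b. nk w (pos y a) (pos y b)) I k"
          by (rule neg_le_family[OF le I(1)]) (use elim in auto)
        thus ?case by (rule neg_le_transfer[where e = id and s = "sc y"]) auto
      qed
      fix a b assume ab: "a \<in> I" "b \<in> I"
      show "((\<lambda>y. cnj (sc y a) * nk w (pos y a) (pos y b) * sc y b) \<longlongrightarrow> H a b) (at_right 0)"
      proof (cases "a = b \<and> isl a")
        case True
        then obtain i where "a = Inl i" "b = Inl i" "i \<in> S" using ab I(2) by (cases a) (auto simp: nodes_and_def)
        thus ?thesis using lim(3) by (simp add: H_def sc_def pos_def)
      next
        case False
        have fst: "((\<lambda>y. sc y a * w (pos y a)) \<longlongrightarrow> pt_fst \<Omega> w a) (at_right 0)"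
          and snd: "((\<lambda>y. sc y a) \<longlongrightarrow> pt_snd \<Omega> a) (at_right 0)"
          and ps: "((\<lambda>y. pos y a) \<longlongrightarrow> pt_pos \<Omega> a) (at_right 0)" if "a \<in> I" for a
        proof -
          have "((\<lambda>y. above i y) \<longlongrightarrow> of_real (node \<Omega> i) + \<i> * of_real 0) (at_right 0)" for i
            unfolding above_def by (intro tendsto_intros)
          thus "((\<lambda>y. sc y a * w (pos y a)) \<longlongrightarrow> pt_fst \<Omega> w a) (at_right 0)"
            "((\<lambda>y. sc y a) \<longlongrightarrow> pt_snd \<Omega> a) (at_right 0)"
            "((\<lambda>y. pos y a) \<longlongrightarrow> pt_pos \<Omega> a) (at_right 0)"
            using that I(2) lim by (cases a; auto simp: sc_def pos_def pt_fst_def pt_snd_def pt_pos_def nodes_and_def)+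
        qed
        have im: "Im z > 0" if "Inr z \<in> I" for z
          using that I(2) by (auto simp: nodes_and_def analyticity_domain_def upper_half_plane_def)
        have nz: "pt_pos \<Omega> b - cnj (pt_pos \<Omega> a) \<noteq> 0"
        proof (cases a; cases b)
          fix i j assume "a = Inl i" "b = Inl j"
          moreover from this have "i < n" "j < n" "i \<noteq> j" using ab I(2) S(1) False by (auto simp: nodes_and_def)
          ultimately show ?thesis using node_neq by (auto simp: pt_pos_def)
        next
          fix z t assume "a = Inr z" "b = Inr t"
          moreover from this have "Im t + Im z > 0" using im ab by (simp add: add_pos_pos)
          ultimately show ?thesis by (auto simp: pt_pos_def complex_eq_iff)
        qed (use ab im in \<open>fastforce simp: pt_pos_def complex_eq_iff\<close>)+
        have "((\<lambda>y. (sc y b * w (pos y b) * cnj (sc y a) - sc y b * cnj (sc y a * w (pos y a))) / (pos y b - cnj (pos y a)))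
           \<longlongrightarrow> (pt_fst \<Omega> w b * cnj (pt_snd \<Omega> a) - pt_snd \<Omega> b * cnj (pt_fst \<Omega> w a)) / (pt_pos \<Omega> b - cnj (pt_pos \<Omega> a))) (at_right 0)"
          by (intro tendsto_divide tendsto_diff tendsto_mult tendsto_cnj fst snd ps ab nz)
        also have "(\<lambda>y. (sc y b * w (pos y b) * cnj (sc y a) - sc y b * cnj (sc y a * w (pos y a))) / (pos y b - cnj (pos y a)))
            = (\<lambda>y. cnj (sc y a) * nk w (pos y a) (pos y b) * sc y b)"
          by (rule ext) (simp add: nk_def nevanlinna_kernel_def diff_divide_distrib algebra_simps)
        finally show ?thesis using False by (auto simp: H_def fmi_def)
      qed
    qed
    thus "neg_le (fmi \<Omega> w) I k"
    proof (rule neg_le_add_diagonal)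
      fix a assume "a \<in> I"
      thus "Re (H a a) \<le> Re (fmi \<Omega> w a a)"
        using d I(2) by (cases a) (auto simp: H_def fmi_def nodes_and_def)
    qed (auto simp: H_def)
  qed
qed

lemma nodes_split_neg_le:
  assumes "neg_le_on (fmi \<Omega> w) (nodes_and ({..<n} - F) w) k" "F \<subseteq> {..<n}"
  shows "neg_le_on (fmi \<Omega> w) (nodes_and {..<n} w) (k + card F)"
  unfolding neg_le_on_def
proof (intro allI impI, elim conjE)
  fix I assume I: "finite I" "I \<subseteq> nodes_and {..<n} w"
  have finF: "finite F" using assms(2) finite_subset by blast
  let ?I = "I - Inl ` F"
  have "neg_le (fmi \<Omega> w) ?I k"
    by (rule neg_le_onD[OF assms(1)]) (use I in \<open>unfold nodes_and_def, blast+\<close>)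
  hence "neg_le (fmi \<Omega> w) (?I \<union> Inl ` F) (k + card (Inl ` F :: (nat + complex) set))"
    using I finF by (intro neg_le_Un) auto
  hence "neg_le (fmi \<Omega> w) (?I \<union> Inl ` F) (k + card F)"
    by (simp add: card_image inj_on_def)
  thus "neg_le (fmi \<Omega> w) I (k + card F)"
    by (rule neg_le_subset) (use I finF in auto)
qed

lemma neg_bound:
  assumes "neg_le_on (fmi \<Omega> w) (nodes_and {..<n} w) k"
  shows "neg \<le> k"
proof -
  have "neg_le (\<lambda>i j. fmi \<Omega> w (Inl i) (Inl j)) {..<n} k"
    by (rule neg_le_family[OF assms]) (auto simp: nodes_and_def)
  hence "neg_le p {..<n} k" by (subst (asm) neg_le_cong[OF fmi_pp]) auto
  thus ?thesis using pick_neg_system neg_le_system_bound by blast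
qed

end

subsection \<open>A Caratheodory-Julia theorem\<close>

lemma hform_insert:
  assumes "finite Z" "f \<notin> Z"
  shows "hform H (insert f Z) u v = cnj (u f) * H f f * v f + cnj (u f) * (\<Sum>a\<in>Z. H f a * v a)
     + (\<Sum>a\<in>Z. cnj (u a) * H a f) * v f + hform H Z u v"
  using assms by (simp add: hform_eq algebra_simps sum.distrib sum_distrib_left sum_distrib_right)

lemma hform_delta_right:
  assumes "finite I" "b \<in> I"
  shows "hform H I u (\<lambda>i. if i = b then 1 else 0) = (\<Sum>a\<in>I. cnj (u a) * H a b)"
  using assms by (simp add: hform_eq if_distrib cong: if_cong)

lemma hform_delta:
  assumes "finite I" "a \<in> I" "b \<in> I"
  shows "hform H I (\<lambda>i. if i = a then 1 else 0) (\<lambda>i. if i = b then 1 else 0) = H a b"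
  unfolding hform_delta_right[OF assms(1,3)] using assms
  by (simp add: if_distrib[of cnj] if_distrib[of "\<lambda>y. y * _"] cong: if_cong)

lemma psd_entries:
  assumes "herm K" "psd_on K S" "a \<in> S" "b \<in> S"
  shows "0 \<le> Re (K a a)" and "(cmod (K a b))\<^sup>2 \<le> Re (K a a) * Re (K b b)"
proof -
  have psd: "0 \<le> Re (hform K {a, b} u u)" for u using assms by (auto simp: psd_on_def)
  from psd[of "\<lambda>i. if i = a then 1 else 0"] show "0 \<le> Re (K a a)" by (simp add: hform_delta)
  from psd_Cauchy_Schwarz[OF assms(1) psd, of "\<lambda>i. if i = a then 1 else 0" "\<lambda>i. if i = b then 1 else 0"]
  show "(cmod (K a b))\<^sup>2 \<le> Re (K a a) * Re (K b b)" by (simp add: hform_delta)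
qed

text \<open>Lowering the diagonal entry at \<open>f\<close> as far as positivity permits places the kernel vector of
  \<open>f\<close> in the closed span of the others, so that it can be approximated by them.\<close>

lemma extremal_kernel:
  fixes K :: "'a \<Rightarrow> 'a \<Rightarrow> complex"
  assumes "herm K" and psd: "psd_on K (insert f S)" and f: "f \<notin> S"
  obtains A :: real where "0 \<le> A" "A \<le> Re (K f f)"
    "\<And>\<epsilon>. \<epsilon> > 0 \<Longrightarrow> \<exists>Z u. finite Z \<and> Z \<subseteq> S \<and>
       (\<forall>z\<in>S. (cmod (K f z + (\<Sum>a\<in>Z. cnj (u a) * K a z)))\<^sup>2 \<le> \<epsilon> * Re (K z z)) \<and>
       (cmod (of_real A + (\<Sum>a\<in>Z. cnj (u a) * K a f)))\<^sup>2 \<le> \<epsilon> * A"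
proof -
  \<comment> \<open>With coefficient 1 at \<open>f\<close>, coefficients \<open>u\<close> on
    \<open>Z\<close> and diagonal entry \<open>A\<close> at \<open>f\<close>, the form equals
    \<open>A - g Z u\<close>.\<close>
  define g where "g Z u = - (Re (hform K Z u u) + 2 * Re (\<Sum>a\<in>Z. K f a * u a))" for Z and u :: "'a \<Rightarrow> complex"
  define V where "V = {g Z u | Z u. finite Z \<and> Z \<subseteq> S}"
  have Kh: "K b a = cnj (K a b)" for a b using assms(1) unfolding herm_def by blast
  have sum_cnj: "(\<Sum>a\<in>Z. cnj (u a) * K a f) = cnj (\<Sum>a\<in>Z. K f a * u a)" for Z and u :: "'a \<Rightarrow> complex"
  proof -
    have "cnj (\<Sum>a\<in>Z. K f a * u a) = (\<Sum>a\<in>Z. cnj (u a) * cnj (K f a))" by (simp add: mult.commute)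
    also have "\<dots> = (\<Sum>a\<in>Z. cnj (u a) * K a f)"
      by (intro sum.cong refl arg_cong2[of _ _ _ _ "(*)"] Kh[symmetric])
    finally show ?thesis by simp
  qed
  have ins: "hform K' (insert f Z) u u = of_real ((cmod (u f))\<^sup>2) * K' f f
      + (cnj (u f) * (\<Sum>a\<in>Z. K f a * u a) + cnj (cnj (u f) * (\<Sum>a\<in>Z. K f a * u a))) + hform K Z u u"
    if "finite Z" "Z \<subseteq> S" "\<And>a b. (a, b) \<noteq> (f, f) \<Longrightarrow> K' a b = K a b" for K' Z u
  proof -
    have fZ: "f \<notin> Z" using that f by auto
    have eqs: "K' a f = K a f" "K' f a = K f a" "K' a b = K a b" if "a \<in> Z" for a b
      by (rule \<open>\<And>a b. (a, b) \<noteq> (f, f) \<Longrightarrow> K' a b = K a b\<close>, use that fZ in blast)+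
    hence "hform K' Z u u = hform K Z u u" "(\<Sum>a\<in>Z. K' f a * u a) = (\<Sum>a\<in>Z. K f a * u a)"
       "(\<Sum>a\<in>Z. cnj (u a) * K' a f) = (\<Sum>a\<in>Z. cnj (u a) * K a f)"
      by (auto intro!: hform_cong sum.cong)
    thus ?thesis unfolding hform_insert[OF that(1) fZ] sum_cnj
      by (simp add: mult.commute[of "cnj (u f)"] mult_cnj_eq mult.assoc[symmetric])
  qed
  have up: "x \<le> Re (K f f)" if x: "x \<in> V" for x
  proof -
    obtain Z u where Z: "finite Z" "Z \<subseteq> S" "x = g Z u" using x unfolding V_def by blast
    define u' where "u' = u(f := 1)"
    have eq: "hform K Z u' u' = hform K Z u u" "(\<Sum>a\<in>Z. K f a * u' a) = (\<Sum>a\<in>Z. K f a * u a)"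
      using Z f by (auto simp: u'_def intro!: hform_cong sum.cong)
    have "0 \<le> Re (hform K (insert f Z) u' u')" using psd Z by (auto simp: psd_on_def)
    also have "\<dots> = Re (K f f) - x"
      unfolding ins[OF Z(1,2) refl] eq Z(3) g_def by (simp add: u'_def)
    finally show ?thesis by simp
  qed
  have 0: "0 \<in> V" unfolding V_def by (intro CollectI exI[of _ "{}"]) (auto simp: g_def hform_def)
  have bdd: "bdd_above V" using up by (auto simp: bdd_above_def)
  \<comment> \<open>The least diagonal entry at \<open>f\<close> that keeps the form nonnegative;
    the empty \<open>Z\<close> shows that it is not negative.\<close>
  define A where "A = Sup V"
  have A0: "0 \<le> A" unfolding A_def by (rule cSup_upper[OF 0 bdd])
  have A1: "A \<le> Re (K f f)" unfolding A_def by (rule cSup_least) (use 0 up in auto)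
  have gA: "g Z u \<le> A" if "finite Z" "Z \<subseteq> S" for Z u
    unfolding A_def by (rule cSup_upper[OF _ bdd]) (use that in \<open>auto simp: V_def\<close>)
  define K' where "K' a b = (if a = f \<and> b = f then of_real A else K a b)" for a b
  have K'h: "herm K'"
  proof -
    have "K' b a = cnj (K' a b)" for a b
      using Kh[of b a] by (cases "a = f"; cases "b = f") (simp_all add: K'_def)
    thus ?thesis unfolding herm_def by blast
  qed
  have K'K: "K' a b = K a b" if "(a, b) \<noteq> (f, f)" for a b using that by (auto simp: K'_def)
  have ins': "hform K' (insert f Z) u u = of_real ((cmod (u f))\<^sup>2) * of_real A
      + (cnj (u f) * (\<Sum>a\<in>Z. K f a * u a) + cnj (cnj (u f) * (\<Sum>a\<in>Z. K f a * u a))) + hform K Z u u"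
    if "finite Z" "Z \<subseteq> S" for Z u
    by (subst ins[of Z K', OF that K'K]) (simp_all add: K'_def)
  have psd': "0 \<le> Re (hform K' (insert f Z) u u)" if Z: "finite Z" "Z \<subseteq> S" for Z u
  proof (cases "u f = 0")
    case True
    have "0 \<le> Re (hform K Z u u)" using psd Z by (auto simp: psd_on_def)
    thus ?thesis unfolding ins'[OF Z] True by simp
  next
    case False
    define v where "v a = u a / u f" for a
    have u: "u a = u f * v a" for a using False by (simp add: v_def)
    have 1: "hform K Z u u = of_real ((cmod (u f))\<^sup>2) * hform K Z v v"
    proof -
      have "hform K Z u u = hform K Z (\<lambda>a. u f * v a) (\<lambda>a. u f * v a)" by (rule hform_cong) (auto simp: u[symmetric])
      also have "\<dots> = (u f * cnj (u f)) * hform K Z v v" by (simp add: hform_scale_left hform_scale_right)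
      finally show ?thesis by (simp add: mult_cnj_eq)
    qed
    have 2: "cnj (u f) * (\<Sum>a\<in>Z. K f a * u a) = of_real ((cmod (u f))\<^sup>2) * (\<Sum>a\<in>Z. K f a * v a)"
    proof -
      have "(\<Sum>a\<in>Z. K f a * u a) = u f * (\<Sum>a\<in>Z. K f a * v a)"
        unfolding sum_distrib_left by (intro sum.cong) (auto simp: v_def False)
      hence "cnj (u f) * (\<Sum>a\<in>Z. K f a * u a) = (u f * cnj (u f)) * (\<Sum>a\<in>Z. K f a * v a)"
        by (simp add: mult_ac)
      thus ?thesis by (simp add: mult_cnj_eq)
    qed
    have "Re (hform K' (insert f Z) u u) = (cmod (u f))\<^sup>2 * (A - g Z v)"
      unfolding ins'[OF Z] 1 2 by (simp add: K'_def g_def algebra_simps)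
    also have "\<dots> \<ge> 0" using gA[OF Z] by simp
    finally show ?thesis .
  qed
  have main: "\<exists>Z u. finite Z \<and> Z \<subseteq> S \<and>
       (\<forall>z\<in>S. (cmod (K f z + (\<Sum>a\<in>Z. cnj (u a) * K a z)))\<^sup>2 \<le> \<epsilon> * Re (K z z)) \<and>
       (cmod (of_real A + (\<Sum>a\<in>Z. cnj (u a) * K a f)))\<^sup>2 \<le> \<epsilon> * A" if "\<epsilon> > 0" for \<epsilon>
  proof -
    have "A - \<epsilon> < Sup V" using that by (simp add: A_def)
    then obtain x where "x \<in> V" "A - \<epsilon> < x" using less_cSup_iff[OF _ bdd] 0 by blast
    then obtain Z u where Z: "finite Z" "Z \<subseteq> S" and gu: "A - \<epsilon> < g Z u" unfolding V_def by blast
    have fZ: "f \<notin> Z" using Z f by auto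
    \<comment> \<open>The unit vector at \<open>f\<close> plus \<open>u\<close>. Its square in
      \<open>K'\<close> is \<open>A - g Z u < \<epsilon>\<close>, so Cauchy-Schwarz against the unit
      vector at any \<open>b\<close>, with \<open>b = f\<close> included, gives all the required
      estimates.\<close>
    define v where "v a = (if a = f then 1 else if a \<in> Z then u a else 0)" for a
    have vf: "v f = 1" by (simp add: v_def)
    have Zv: "finite Z'" "Z' \<subseteq> S" "Z \<subseteq> Z'" if "Z' = Z \<or> (\<exists>z\<in>S. Z' = insert z Z)" for Z'
      using that Z by auto
    have norm: "Re (hform K' (insert f Z') v v) = A - g Z u"
      and row: "\<And>b. (\<Sum>a\<in>insert f Z'. cnj (v a) * K' a b) = K' f b + (\<Sum>a\<in>Z. cnj (u a) * K' a b)"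
      if Z': "finite Z'" "Z' \<subseteq> S" "Z \<subseteq> Z'" for Z'
    proof -
      have f': "f \<notin> Z'" using Z' f by auto
      have r: "hform K Z' v v = hform K Z' (\<lambda>i. if i \<in> Z then u i else 0) (\<lambda>i. if i \<in> Z then u i else 0)"
        using f' by (intro hform_cong) (auto simp: v_def)
      have s: "(\<Sum>a\<in>Z'. h a * v a) = (\<Sum>a\<in>Z. h a * u a)" for h :: "'a \<Rightarrow> complex"
        using Z' f' by (intro sum.mono_neutral_cong_right) (auto simp: v_def)
      show "Re (hform K' (insert f Z') v v) = A - g Z u"
        unfolding ins'[OF Z'(1,2)] r hform_restrict[OF Z'(1,3)] s vf by (simp add: g_def K'_def)
      fix b
      have "(\<Sum>a\<in>Z'. cnj (v a) * K' a b) = (\<Sum>a\<in>Z. cnj (u a) * K' a b)"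
        using Z' f' by (intro sum.mono_neutral_cong_right) (auto simp: v_def)
      thus "(\<Sum>a\<in>insert f Z'. cnj (v a) * K' a b) = K' f b + (\<Sum>a\<in>Z. cnj (u a) * K' a b)"
        using Z'(1) f' by (simp add: vf)
    qed
    have CS: "(cmod (K' f b + (\<Sum>a\<in>Z. cnj (u a) * K' a b)))\<^sup>2 \<le> \<epsilon> * Re (K' b b)"
      if b: "b \<in> insert f S" for b
    proof -
      define Z' where "Z' = (if b = f then Z else insert b Z)"
      have Z': "finite Z'" "Z' \<subseteq> S" "Z \<subseteq> Z'" "b \<in> insert f Z'" using b Z by (auto simp: Z'_def)
      have fin: "finite (insert f Z')" using Z' by simp
      have "(cmod (hform K' (insert f Z') v (\<lambda>i. if i = b then 1 else 0)))\<^sup>2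
          \<le> Re (hform K' (insert f Z') v v) * Re (hform K' (insert f Z') (\<lambda>i. if i = b then 1 else 0) (\<lambda>i. if i = b then 1 else 0))"
        by (rule psd_Cauchy_Schwarz[OF K'h psd'[OF Z'(1,2)]])
      hence "(cmod (K' f b + (\<Sum>a\<in>Z. cnj (u a) * K' a b)))\<^sup>2 \<le> (A - g Z u) * Re (K' b b)"
        unfolding hform_delta[OF fin Z'(4) Z'(4)] hform_delta_right[OF fin Z'(4)] norm[OF Z'(1-3)] row[OF Z'(1-3)] .
      also have "\<dots> \<le> \<epsilon> * Re (K' b b)"
      proof (rule mult_right_mono)
        show "0 \<le> Re (K' b b)"
          using psd'[OF Z'(1,2), of "\<lambda>i. if i = b then 1 else 0"] unfolding hform_delta[OF fin Z'(4) Z'(4)] .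
      qed (use gu in simp)
      finally show ?thesis .
    qed
    have eqs: "K' a b = K a b" if "a \<in> Z \<or> b \<in> S" for a b using that fZ f by (intro K'K) auto
    have s1: "(\<Sum>a\<in>Z. cnj (u a) * K' a b) = (\<Sum>a\<in>Z. cnj (u a) * K a b)" for b
      by (intro sum.cong) (auto simp: eqs)
    show ?thesis
    proof (intro exI[of _ Z] exI[of _ u] conjI ballI Z)
      fix z assume "z \<in> S"
      thus "(cmod (K f z + (\<Sum>a\<in>Z. cnj (u a) * K a z)))\<^sup>2 \<le> \<epsilon> * Re (K z z)"
        using CS[of z] unfolding s1 by (simp add: eqs)
    next
      show "(cmod (of_real A + (\<Sum>a\<in>Z. cnj (u a) * K a f)))\<^sup>2 \<le> \<epsilon> * A"
        using CS[of f] unfolding s1 by (simp add: K'_def)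
    qed
  qed
  show ?thesis using that[OF A0 A1 main] .
qed

text \<open>Here \<open>r\<close> is bounded by the square root of an expression linear in
  \<open>r\<close> itself. With \<open>D = A * \<kappa> + A * E + 1\<close>, completing the square
  gives \<open>k \<le> r / 2 + D * W\<close>, hence \<open>r \<le> 2 * (D + B) * W\<close>; the part
  \<open>r * \<delta>\<close> of \<open>W\<close> is absorbed because \<delta> is small. The summand
  1 ensures \<open>D \<le> D * D\<close>.\<close>

lemma absorb_bound:
  fixes r V \<delta> k A \<kappa> E B :: real
  assumes nonneg: "0 \<le> r" "0 \<le> V" "0 \<le> \<delta>" "0 \<le> A" "0 \<le> \<kappa>" "0 \<le> E" "0 \<le> B"
    and W: "W = r * \<delta> + V"
    and k: "k\<^sup>2 \<le> A * (\<kappa> * r * V + E * W\<^sup>2)" and r: "r \<le> k + B * W"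
    and small: "2 * (A * \<kappa> + A * E + 1 + B) * \<delta> \<le> 1 / 2"
  shows "r \<le> 4 * (A * \<kappa> + A * E + 1 + B) * V"
proof -
  define D where "D = A * \<kappa> + A * E + 1"
  have W0: "0 \<le> W" "V \<le> W" using nonneg by (auto simp: W)
  have D: "1 \<le> D" "A * \<kappa> \<le> D" "A * E \<le> D" using nonneg by (auto simp: D_def)
  have "k\<^sup>2 \<le> (r / 2 + D * W)\<^sup>2"
  proof -
    have "A * (\<kappa> * r * V) \<le> D * r * W"
      using D W0 nonneg by (simp add: mult_mono mult.assoc[symmetric])
    moreover have "A * E * W\<^sup>2 \<le> D * D * W\<^sup>2"
    proof (rule mult_right_mono)
      have "D \<le> D * D" using mult_left_mono[of 1 D D] D by simp
      thus "A * E \<le> D * D" using D by linarith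
    qed simp
    ultimately have "k\<^sup>2 \<le> D * r * W + D * D * W\<^sup>2" using k by (simp add: distrib_left mult.assoc)
    moreover have "(r / 2 + D * W)\<^sup>2 = (r / 2)\<^sup>2 + D * r * W + D * D * W\<^sup>2"
      by (simp add: power2_eq_square algebra_simps)
    ultimately show ?thesis by (smt (verit) zero_le_power2)
  qed
  moreover have "0 \<le> r / 2 + D * W" using nonneg D W0 by simp
  ultimately have "k \<le> r / 2 + D * W" by (rule power2_le_imp_le)
  hence "r \<le> 2 * (D + B) * W" using r by (simp add: algebra_simps)
  also have "\<dots> = (2 * (D + B) * \<delta>) * r + 2 * (D + B) * V" by (simp add: W algebra_simps)
  also have "\<dots> \<le> 1 / 2 * r + 2 * (D + B) * V"
    using small nonneg by (intro add_right_mono mult_right_mono) (auto simp: D_def)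
  finally have "r \<le> 1 / 2 * r + 2 * ((D + B) * V)" by (simp only: mult.assoc)
  hence "r \<le> 4 * ((D + B) * V)" by linarith
  thus ?thesis by (simp only: D_def mult.assoc)
qed

section \<open>Estimates at a node that adds no negative square\<close>

lemma stolz_norm_le:
  assumes "z \<in> stolz_angle x0 a"
  shows "cmod (z - of_real x0) \<le> (a + 1) * Im z" "0 < Im z"
proof -
  have "cmod (z - of_real x0) \<le> \<bar>Re (z - of_real x0)\<bar> + \<bar>Im (z - of_real x0)\<bar>" by (rule cmod_le)
  thus "cmod (z - of_real x0) \<le> (a + 1) * Im z" "0 < Im z"
    using assms by (auto simp: stolz_angle_def algebra_simps)
qed

text \<open>The number \<open>m\<close> bounds the negative squares with the node \<open>f\<close>
  and is attained on a finite set without it.\<close>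

locale boundary_node = interpolation_data +
  fixes w :: "complex \<Rightarrow> complex" and f :: nat and T :: "nat set"
    and I0 :: "(nat + complex) set" and m :: nat and v :: "nat \<Rightarrow> nat + complex \<Rightarrow> complex"
  assumes fin: "finite (upper_half_plane - analyticity_domain w)"
    and T: "T \<subseteq> {..<n_pts \<Omega>}" and f: "f < n_pts \<Omega>" "f \<notin> T"
    and le: "neg_le_on (fmi \<Omega> w) (nodes_and (insert f T) w) m"
    and sys: "neg_system (fmi \<Omega> w) I0 m v" "finite I0" "I0 \<subseteq> nodes_and T w"
begin

text \<open>A real symplectic change of the projective coordinates moves the value at the node \<open>f\<close> to
  \<open>(0, 1)\<close>, so that regular and singular nodes can be treated alike.\<close>

definition tU :: "nat + complex \<Rightarrow> complex" where
  "tU a = (if f < n_reg \<Omega> then pt_fst \<Omega> w a - c f * pt_snd \<Omega> a else - c f * pt_snd \<Omega> a)"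

definition tV :: "nat + complex \<Rightarrow> complex" where
  "tV a = (if f < n_reg \<Omega> then pt_snd \<Omega> a else pt_fst \<Omega> w a / c f)"

abbreviation "H \<equiv> fmi \<Omega> w"
abbreviation "S0 \<equiv> nodes_and T w"
abbreviation "U z \<equiv> tU (Inr z)"
abbreviation "V z \<equiv> tV (Inr z)"

definition K where "K = schur_kernel H I0 m v"

definition phi :: "nat \<Rightarrow> nat + complex \<Rightarrow> complex" where
  "phi j b = (\<Sum>i\<in>I0. cnj (v j i) * H i b)"

text \<open>\<open>al\<close> and \<open>be\<close> are rational in \<open>z\<close>, with poles at
  nodes other than \<open>f\<close> or in the lower half plane, hence continuous at
  \<open>f\<close>; see \<open>phi_Inr\<close>.\<close>

definition al :: "nat \<Rightarrow> complex \<Rightarrow> complex" where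
  "al j z = (\<Sum>i\<in>I0. cnj (v j i) * cnj (tV i) / (z - cnj (pt_pos \<Omega> i)))"

definition be :: "nat \<Rightarrow> complex \<Rightarrow> complex" where
  "be j z = (\<Sum>i\<in>I0. cnj (v j i) * cnj (tU i) / (z - cnj (pt_pos \<Omega> i)))"

lemma cf_nonzero: "\<not> f < n_reg \<Omega> \<Longrightarrow> c f \<noteq> 0"
  using valid f by (auto simp: valid_data_def data_fst_def)

lemma H_eq:
  assumes "\<not> (a = b \<and> isl a)"
  shows "H a b = (tU b * cnj (tV a) - tV b * cnj (tU a)) / (pt_pos \<Omega> b - cnj (pt_pos \<Omega> a))"
proof -
  have "tU b * cnj (tV a) - tV b * cnj (tU a) = pt_fst \<Omega> w b * cnj (pt_snd \<Omega> a) - pt_snd \<Omega> b * cnj (pt_fst \<Omega> w a)"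
    using cf_nonzero by (auto simp: tU_def tV_def algebra_simps)
  thus ?thesis using assms unfolding fmi_def by auto
qed

lemma tUf: "tU (Inl f) = 0" and tVf: "tV (Inl f) = 1"
  using cf_nonzero by (auto simp: tU_def tV_def pt_fst_def pt_snd_def data_snd_def)

lemma posf: "pt_pos \<Omega> (Inl f) = x f" and posr: "pt_pos \<Omega> (Inr z) = z"
  by (simp_all add: pt_pos_def x_def)

lemma cnj_xf: "cnj (x i) = x i" by (simp add: x_def)

lemma f_notin: "Inl f \<notin> S0" using f by (auto simp: nodes_and_def)

lemma pos_neq: "a \<in> S0 \<Longrightarrow> x f - cnj (pt_pos \<Omega> a) \<noteq> 0"
proof (cases a)
  fix i assume "a \<in> S0" "a = Inl i"
  hence "i < n" "i \<noteq> f" using T f by (auto simp: nodes_and_def)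
  thus ?thesis using x_neq[of f i] f \<open>a = Inl i\<close> by (auto simp: pt_pos_def x_def)
qed (auto simp: nodes_and_def pt_pos_def x_def analyticity_domain_def upper_half_plane_def complex_eq_iff)

lemma H_aInr: "H a (Inr z) = (U z * cnj (tV a) - V z * cnj (tU a)) / (z - cnj (pt_pos \<Omega> a))"
  by (subst H_eq) (auto simp: posr)

lemma H_fInr: "H (Inl f) (Inr z) = U z / (z - x f)"
  by (simp add: H_aInr tUf tVf posf cnj_xf)

lemma H_af: "a \<in> S0 \<Longrightarrow> H a (Inl f) = - cnj (tU a) / (x f - cnj (pt_pos \<Omega> a))"
  using f_notin by (subst H_eq) (auto simp: tUf tVf posf)

lemma phi_Inr: "phi j (Inr z) = al j z * U z - be j z * V z"
  unfolding phi_def al_def be_def H_aInr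
  by (simp add: sum_distrib_left sum_distrib_right sum_subtractf[symmetric] diff_divide_distrib algebra_simps)

lemma phi_f: "phi j (Inl f) = - be j (x f)"
  unfolding phi_def be_def sum_negf[symmetric] using sys(3) by (intro sum.cong) (auto simp: H_af)

lemma K_eq: "K a b = H a b + (\<Sum>j<m. cnj (phi j a) * phi j b)"
  by (simp add: K_def schur_kernel_def phi_def)

lemma herm_K: "herm K" unfolding K_def by (rule herm_schur[OF herm_fmi])

lemma nodes_insert: "nodes_and (insert f T) w = insert (Inl f) S0"
  by (auto simp: nodes_and_def)

lemma psd_K: "psd_on K (insert (Inl f) S0)"
  unfolding K_def nodes_insert[symmetric]
  by (rule psd_schur_kernel[OF herm_fmi sys(2) _ sys(1) le]) (use sys(3) in \<open>auto simp: nodes_and_def\<close>)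

lemma al_tendsto: "((\<lambda>z. al j z) \<longlongrightarrow> al j (x f)) (at (x f) within A)"
  and be_tendsto: "((\<lambda>z. be j z) \<longlongrightarrow> be j (x f)) (at (x f) within A)"
  unfolding al_def be_def using pos_neq sys(3) by (auto intro!: tendsto_intros)

lemma K_diag: "Im z \<noteq> 0 \<Longrightarrow> Re (K (Inr z) (Inr z)) = Im (U z * cnj (V z)) / Im z + (\<Sum>j<m. (cmod (phi j (Inr z)))\<^sup>2)"
proof -
  assume z: "Im z \<noteq> 0"
  define X where "X = U z * cnj (V z)"
  have "X - cnj X = 2 * \<i> * of_real (Im X)" "z - cnj z = 2 * \<i> * of_real (Im z)"
    by (simp_all add: complex_eq_iff)
  moreover have "H (Inr z) (Inr z) = (X - cnj X) / (z - cnj z)"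
    by (simp add: H_aInr posr X_def mult.commute)
  ultimately have "H (Inr z) (Inr z) = of_real (Im X / Im z)" using z by simp
  moreover have "(\<Sum>j<m. cnj (phi j (Inr z)) * phi j (Inr z)) = of_real (\<Sum>j<m. (cmod (phi j (Inr z)))\<^sup>2)"
    by (simp add: mult_cnj_eq mult.commute[of "cnj _"])
  ultimately show ?thesis unfolding K_eq X_def[symmetric] by (simp flip: of_real_power)
qed

lemma Im_bound: "0 < Im z \<Longrightarrow> Im (U z * cnj (V z)) / Im z \<le> cmod (U z) * cmod (V z) / Im z"
  using abs_Im_le_cmod[of "U z * cnj (V z)"] by (intro divide_right_mono) (auto simp: norm_mult)

abbreviation F :: "real \<Rightarrow> complex filter" where
  "F a \<equiv> at (x f) within stolz_angle (node \<Omega> f) a"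

lemma eventually_domain: "\<forall>\<^sub>F z in F a. z \<in> analyticity_domain w"
  using eventually_analyticity_domain[OF fin, of "node \<Omega> f"] at_within_stolz_le[of "x f" "node \<Omega> f" a]
  by (simp add: le_filter_def x_def)

lemma eventually_stolz: "\<forall>\<^sub>F z in F a. z \<in> stolz_angle (node \<Omega> f) a \<and> z \<noteq> x f"
  by (simp add: eventually_at_filter)

text \<open>The kernel between \<open>f\<close> and \<open>z\<close> is \<open>U/(z - x f)\<close>
  up to terms of size \<open>|U| + |V|\<close>. Cauchy-Schwarz bounds it by the diagonal at
  \<open>z\<close>, which in a Stolz angle is itself controlled by
  \<open>|U| |V| / |z - x f|\<close> and the square of \<open>|U| + |V|\<close>.
  \<open>absorb_bound\<close> resolves this circular estimate.\<close>

lemma numerator_bound: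
  assumes a: "a > 0"
  obtains M where "M \<ge> 0" "\<forall>\<^sub>F z in F a. cmod (U z) \<le> M * cmod (z - x f) * cmod (V z)"
proof -
  define B where "B = 1 + (\<Sum>j<m. cmod (al j (x f)) + cmod (be j (x f)))"
  have B: "B \<ge> 0" unfolding B_def by (intro add_nonneg_nonneg sum_nonneg) auto
  have evB: "\<forall>\<^sub>F z in F a. \<forall>j\<in>{..<m}. cmod (al j z) \<le> B \<and> cmod (be j z) \<le> B"
  proof (intro eventually_ball_finite ballI)
    fix j assume "j \<in> {..<m}"
    hence "cmod (al j (x f)) + cmod (be j (x f)) \<le> (\<Sum>j<m. cmod (al j (x f)) + cmod (be j (x f)))"
      by (intro member_le_sum) auto
    hence lt: "cmod (al j (x f)) < B" "cmod (be j (x f)) < B"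
      unfolding B_def using norm_ge_zero[of "al j (x f)"] norm_ge_zero[of "be j (x f)"] by linarith+
    have "\<forall>\<^sub>F z in F a. cmod (al j z) < B" "\<forall>\<^sub>F z in F a. cmod (be j z) < B"
      using order_tendstoD(2)[OF tendsto_norm[OF al_tendsto] lt(1)]
            order_tendstoD(2)[OF tendsto_norm[OF be_tendsto] lt(2)] by auto
    thus "\<forall>\<^sub>F z in F a. cmod (al j z) \<le> B \<and> cmod (be j z) \<le> B" by eventually_elim auto
  qed simp
  define A where "A = Re (K (Inl f) (Inl f))"
  have A: "A \<ge> 0" unfolding A_def by (rule psd_entries[OF herm_K psd_K]) auto
  define C where "C = (\<Sum>j<m. cmod (phi j (Inl f))) * B"
  have C: "C \<ge> 0" unfolding C_def using B by (intro mult_nonneg_nonneg sum_nonneg) auto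
  define E where "E = real m * B\<^sup>2"
  have E: "E \<ge> 0" by (simp add: E_def)
  \<comment> \<open>The constant of \<open>absorb_bound\<close> for aperture factor
    \<open>a + 1\<close>; its smallness condition holds at distance at most
    \<open>1 / (4 * N)\<close> from the node.\<close>
  define N where "N = A * (a + 1) + A * E + 1 + C"
  have N: "N > 0" unfolding N_def using A E C a by (intro add_pos_nonneg add_nonneg_pos) auto
  have "\<forall>\<^sub>F z in F a. dist z (x f) < 1 / (4 * N)"
    by (rule tendstoD) (use N in \<open>auto intro: tendsto_ident_at\<close>)
  hence "\<forall>\<^sub>F z in F a. cmod (U z) \<le> (4 * N) * cmod (z - x f) * cmod (V z)"
    using evB eventually_domain[of a] eventually_stolz[of a]
  proof eventually_elim
    case (elim z)
    define \<delta> where "\<delta> = cmod (z - x f)"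
    have \<delta>: "\<delta> > 0" using elim by (simp add: \<delta>_def)
    define r where "r = cmod (U z) / \<delta>"
    have Ur: "cmod (U z) = r * \<delta>" using \<delta> by (simp add: r_def)
    have r0: "r \<ge> 0" using \<delta> by (simp add: r_def)
    define W where "W = r * \<delta> + cmod (V z)"
    have W0: "W \<ge> 0" unfolding W_def using r0 \<delta> by simp
    have im: "0 < Im z" "\<delta> \<le> (a + 1) * Im z"
      using stolz_norm_le[of z "node \<Omega> f" a] elim by (auto simp: \<delta>_def x_def)
    have phi: "cmod (phi j (Inr z)) \<le> B * W" if "j < m" for j
    proof -
      have "cmod (phi j (Inr z)) \<le> cmod (al j z) * cmod (U z) + cmod (be j z) * cmod (V z)"
        unfolding phi_Inr by (metis norm_mult norm_triangle_ineq4)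
      also have "\<dots> \<le> B * cmod (U z) + B * cmod (V z)"
        using elim(2) that by (intro add_mono mult_right_mono) auto
      finally show ?thesis by (simp add: W_def Ur distrib_left)
    qed
    define k where "k = cmod (K (Inl f) (Inr z))"
    have "k\<^sup>2 \<le> A * Re (K (Inr z) (Inr z))"
      unfolding k_def A_def by (rule psd_entries[OF herm_K psd_K]) (use elim in \<open>auto simp: nodes_and_def\<close>)
    also have "\<dots> \<le> A * ((a + 1) * r * cmod (V z) + E * W\<^sup>2)"
    proof (rule mult_left_mono[OF _ A])
      have "cmod (U z) * cmod (V z) / Im z \<le> (a + 1) * r * cmod (V z)"
      proof -
        have "r * \<delta> * cmod (V z) \<le> r * ((a + 1) * Im z) * cmod (V z)"
          using im r0 by (intro mult_right_mono mult_left_mono) auto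
        thus ?thesis using im(1) by (simp add: Ur field_simps)
      qed
      moreover have "(\<Sum>j<m. (cmod (phi j (Inr z)))\<^sup>2) \<le> (\<Sum>j<m. (B * W)\<^sup>2)"
        using phi by (intro sum_mono power_mono) auto
      moreover have "(\<Sum>j<m. (B * W)\<^sup>2) = E * W\<^sup>2" by (simp add: E_def power_mult_distrib)
      ultimately show "Re (K (Inr z) (Inr z)) \<le> (a + 1) * r * cmod (V z) + E * W\<^sup>2"
        using K_diag[of z] Im_bound[OF im(1)] im(1) by linarith
    qed
    finally have kb: "k\<^sup>2 \<le> A * ((a + 1) * r * cmod (V z) + E * W\<^sup>2)" .
    have "r = cmod (K (Inl f) (Inr z) - (\<Sum>j<m. cnj (phi j (Inl f)) * phi j (Inr z)))"
      by (simp add: K_eq H_fInr norm_divide r_def \<delta>_def)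
    also have "\<dots> \<le> k + cmod (\<Sum>j<m. cnj (phi j (Inl f)) * phi j (Inr z))"
      unfolding k_def by (rule norm_triangle_ineq4)
    also have "cmod (\<Sum>j<m. cnj (phi j (Inl f)) * phi j (Inr z)) \<le> (\<Sum>j<m. cmod (phi j (Inl f)) * (B * W))"
      by (intro order_trans[OF norm_sum] sum_mono) (auto simp: norm_mult intro!: mult_left_mono phi)
    also have "\<dots> = C * W" by (simp add: C_def sum_distrib_right mult.assoc)
    finally have rb: "r \<le> k + C * W" by simp
    have "4 * N * \<delta> \<le> 1" using elim(1) N by (simp add: \<delta>_def dist_norm field_simps)
    hence small: "2 * (A * (a + 1) + A * E + 1 + C) * \<delta> \<le> 1 / 2" unfolding N_def[symmetric] by simp
    have "r \<le> 4 * (A * (a + 1) + A * E + 1 + C) * cmod (V z)"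
      by (rule absorb_bound[OF r0 _ _ A _ E C W_def kb rb small]) (use a \<delta> in auto)
    hence "r \<le> 4 * N * cmod (V z)" by (simp only: N_def)
    hence "r * \<delta> \<le> 4 * N * cmod (V z) * \<delta>" using \<delta> by (intro mult_right_mono) auto
    thus ?case by (simp add: Ur \<delta>_def mult_ac)
  qed
  thus ?thesis using that[of "4 * N"] N by auto
qed

text \<open>Where \<open>V\<close> vanishes, the bound makes \<open>U\<close> vanish as well; but
  \<open>(U, V)\<close> is the image of \<open>(w z, 1)\<close> under an invertible real
  matrix.\<close>

lemma V_nonzero:
  assumes "a > 0"
  shows "\<forall>\<^sub>F z in F a. V z \<noteq> 0"
proof -
  obtain M where "\<forall>\<^sub>F z in F a. cmod (U z) \<le> M * cmod (z - x f) * cmod (V z)"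
    using numerator_bound[OF assms] by blast
  thus ?thesis
  proof eventually_elim
    case (elim z)
    show ?case
    proof
      assume V: "V z = 0"
      hence "U z = 0" using elim by simp
      with V show False using cf_nonzero by (auto simp: tU_def tV_def pt_snd_def split: if_splits)
    qed
  qed
qed

definition quot :: "complex \<Rightarrow> complex" where
  "quot z = U z / V z / (z - x f)"

text \<open>Up to an explicit term with limit \<open>s\<close>, \<open>quot\<close> is the kernel
  between \<open>f\<close> and \<open>z\<close> divided by \<open>V\<close>. The extremal kernel
  replaces the row of \<open>f\<close> by rows of other indices, and those have limits at
  \<open>f\<close>. The replacement error is uniform because the diagonal divided by the square of
  \<open>|V|\<close> stays bounded in a Stolz angle. The limit is \<open>A - s\<close>, where
  \<open>A\<close> is the extremal diagonal entry.\<close>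

lemma quotient_limit:
  obtains d :: real where "d \<le> Re (fmi_diag \<Omega> f)" "\<And>a. a > 0 \<Longrightarrow> (quot \<longlongrightarrow> of_real d) (F a)"
proof -
  obtain A :: real where A: "0 \<le> A" "A \<le> Re (K (Inl f) (Inl f))"
    and app: "\<And>\<epsilon>. \<epsilon> > 0 \<Longrightarrow> \<exists>Z u. finite Z \<and> Z \<subseteq> S0 \<and>
       (\<forall>z\<in>S0. (cmod (K (Inl f) z + (\<Sum>a\<in>Z. cnj (u a) * K a z)))\<^sup>2 \<le> \<epsilon> * Re (K z z)) \<and>
       (cmod (of_real A + (\<Sum>a\<in>Z. cnj (u a) * K a (Inl f))))\<^sup>2 \<le> \<epsilon> * A"
    using extremal_kernel[OF herm_K psd_K f_notin] by blast
  define s where "s = (\<Sum>j<m. (cmod (phi j (Inl f)))\<^sup>2)"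
  have s: "(\<Sum>j<m. cnj (phi j (Inl f)) * phi j (Inl f)) = of_real s"
    by (simp add: s_def mult_cnj_eq mult.commute[of "cnj _"])
  have "A - s \<le> Re (fmi_diag \<Omega> f)"
    using A(2) unfolding K_eq s by (simp add: fmi_def)
  moreover have "(quot \<longlongrightarrow> of_real (A - s)) (F a)" if a: "a > 0" for a
  proof -
    obtain M where M: "M \<ge> 0" "\<forall>\<^sub>F z in F a. cmod (U z) \<le> M * cmod (z - x f) * cmod (V z)"
      using numerator_bound[OF a] by blast
    have z0: "((\<lambda>z. z - x f) \<longlongrightarrow> 0) (F a)"
      by (rule tendsto_eq_intros tendsto_ident_at refl)+ simp
    have h0: "((\<lambda>z. U z / V z) \<longlongrightarrow> 0) (F a)"
    proof (rule Lim_null_comparison)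
      show "\<forall>\<^sub>F z in F a. norm (U z / V z) \<le> M * cmod (z - x f)"
        using M(2) V_nonzero[OF a] by eventually_elim (simp add: norm_divide field_simps)
      show "((\<lambda>z. M * cmod (z - x f)) \<longlongrightarrow> 0) (F a)"
        using tendsto_mult[OF tendsto_const tendsto_norm[OF z0], of M] by simp
    qed
    have phiV: "((\<lambda>z. phi j (Inr z) / V z) \<longlongrightarrow> phi j (Inl f)) (F a)" for j
    proof (rule Lim_transform_eventually)
      show "((\<lambda>z. al j z * (U z / V z) - be j z) \<longlongrightarrow> phi j (Inl f)) (F a)"
        using tendsto_diff[OF tendsto_mult[OF al_tendsto h0] be_tendsto] by (simp add: phi_f)
      show "\<forall>\<^sub>F z in F a. al j z * (U z / V z) - be j z = phi j (Inr z) / V z"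
        using V_nonzero[OF a] by eventually_elim (simp add: phi_Inr field_simps)
    qed
    have HV: "((\<lambda>z. H b (Inr z) / V z) \<longlongrightarrow> H b (Inl f)) (F a)" if b: "b \<in> S0" for b
    proof (rule Lim_transform_eventually)
      show "((\<lambda>z. (U z / V z * cnj (tV b) - cnj (tU b)) / (z - cnj (pt_pos \<Omega> b))) \<longlongrightarrow> H b (Inl f)) (F a)"
        unfolding H_af[OF b]
        by (rule tendsto_eq_intros h0 refl tendsto_ident_at pos_neq[OF b])+ simp
      show "\<forall>\<^sub>F z in F a. (U z / V z * cnj (tV b) - cnj (tU b)) / (z - cnj (pt_pos \<Omega> b)) = H b (Inr z) / V z"
        using V_nonzero[OF a] by eventually_elim (simp add: H_aInr divide_simps)
    qed
    have KV: "((\<lambda>z. K b (Inr z) / V z) \<longlongrightarrow> K b (Inl f)) (F a)" if b: "b \<in> S0" for b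
    proof -
      have "((\<lambda>z. H b (Inr z) / V z + (\<Sum>j<m. cnj (phi j b) * (phi j (Inr z) / V z))) \<longlongrightarrow> K b (Inl f)) (F a)"
        unfolding K_eq by (intro tendsto_intros HV[OF b] phiV)
      thus ?thesis by (simp add: K_eq add_divide_distrib sum_divide_distrib)
    qed
    have KfV: "((\<lambda>z. K (Inl f) (Inr z) / V z - quot z) \<longlongrightarrow> of_real s) (F a)"
    proof -
      have "((\<lambda>z. \<Sum>j<m. cnj (phi j (Inl f)) * (phi j (Inr z) / V z)) \<longlongrightarrow> of_real s) (F a)"
        unfolding s[symmetric] by (intro tendsto_intros phiV)
      moreover have "K (Inl f) (Inr z) / V z - quot z = (\<Sum>j<m. cnj (phi j (Inl f)) * (phi j (Inr z) / V z))" for z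
        by (simp add: K_eq H_fInr quot_def add_divide_distrib sum_divide_distrib mult.commute)
      ultimately show ?thesis by simp
    qed
    \<comment> \<open>Bounds the diagonal of \<open>K\<close> divided by the square of
      \<open>|V|\<close>: the kernel part contributes \<open>(a + 1) * M\<close>, and the sum of
      squares has limit \<open>s\<close>, so it is eventually below \<open>s + 1\<close>.\<close>
    define C where "C = (a + 1) * M + s + 1"
    have s0: "s \<ge> 0" by (simp add: s_def sum_nonneg)
    have C: "C \<ge> 0" using a M(1) s0 by (simp add: C_def)
    have KC: "\<forall>\<^sub>F z in F a. Re (K (Inr z) (Inr z)) \<le> C * (cmod (V z))\<^sup>2"
    proof -
      have "((\<lambda>z. \<Sum>j<m. (cmod (phi j (Inr z) / V z))\<^sup>2) \<longlongrightarrow> s) (F a)"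
        unfolding s_def by (intro tendsto_intros phiV)
      hence "\<forall>\<^sub>F z in F a. (\<Sum>j<m. (cmod (phi j (Inr z) / V z))\<^sup>2) < s + 1"
        by (rule order_tendstoD) simp
      thus ?thesis using M(2) V_nonzero[OF a] eventually_stolz[of a]
      proof eventually_elim
        case (elim z)
        have im: "0 < Im z" "cmod (z - x f) \<le> (a + 1) * Im z"
          using stolz_norm_le[of z "node \<Omega> f" a] elim by (auto simp: x_def)
        have "cmod (U z) \<le> M * ((a + 1) * Im z) * cmod (V z)"
          using elim(2) by (rule order_trans) (intro mult_right_mono mult_left_mono im M(1), auto)
        hence "cmod (U z) * cmod (V z) \<le> M * ((a + 1) * Im z) * cmod (V z) * cmod (V z)"
          by (rule mult_right_mono) simp
        hence 1: "cmod (U z) * cmod (V z) / Im z \<le> (a + 1) * M * (cmod (V z))\<^sup>2"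
          using im(1) by (simp add: field_simps power2_eq_square)
        have "(\<Sum>j<m. (cmod (phi j (Inr z)))\<^sup>2) = (\<Sum>j<m. (cmod (phi j (Inr z) / V z))\<^sup>2) * (cmod (V z))\<^sup>2"
          using elim(3) by (simp add: sum_distrib_right norm_divide power_divide)
        also have "\<dots> \<le> (s + 1) * (cmod (V z))\<^sup>2"
          using elim(1) by (intro mult_right_mono) auto
        finally show ?case
          using K_diag[of z] Im_bound[OF im(1)] 1 im(1) by (simp add: C_def algebra_simps)
      qed
    qed
    show ?thesis
    proof (rule tendstoI)
      fix r :: real assume r: "r > 0"
      \<comment> \<open>Chosen so that \<open>\<epsilon> * C\<close> and
        \<open>\<epsilon> * A\<close> are both at most the square of \<open>r / 4\<close>.\<close>
      define \<epsilon> where "\<epsilon> = (r / 4)\<^sup>2 / (1 + C + A)"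
      have den: "1 + C + A > 0" using C A by simp
      have \<epsilon>: "\<epsilon> > 0" using r den by (simp add: \<epsilon>_def)
      have \<epsilon>b: "\<epsilon> * t \<le> (r / 4)\<^sup>2" if "0 \<le> t" "t \<le> 1 + C + A" for t
      proof -
        have "\<epsilon> * t \<le> \<epsilon> * (1 + C + A)" using that \<epsilon> by (intro mult_left_mono) auto
        thus ?thesis using den by (simp add: \<epsilon>_def)
      qed
      obtain Z u where Z: "finite Z" "Z \<subseteq> S0"
        and Zz: "\<And>z. z \<in> S0 \<Longrightarrow> (cmod (K (Inl f) z + (\<Sum>a\<in>Z. cnj (u a) * K a z)))\<^sup>2 \<le> \<epsilon> * Re (K z z)"
        and ZA: "(cmod (of_real A + (\<Sum>a\<in>Z. cnj (u a) * K a (Inl f))))\<^sup>2 \<le> \<epsilon> * A"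
        using app[OF \<epsilon>] by blast
      have ZA': "cmod (of_real A + (\<Sum>a\<in>Z. cnj (u a) * K a (Inl f))) \<le> r / 4"
        by (rule power2_le_imp_le[OF order_trans[OF ZA \<epsilon>b]]) (use A C r in auto)
      have "((\<lambda>z. \<Sum>a\<in>Z. cnj (u a) * (K a (Inr z) / V z)) \<longlongrightarrow> (\<Sum>a\<in>Z. cnj (u a) * K a (Inl f))) (F a)"
        using Z by (intro tendsto_intros KV) auto
      from tendstoD[OF this, of "r / 8"] tendstoD[OF KfV, of "r / 8"]
      have "\<forall>\<^sub>F z in F a. dist (\<Sum>a\<in>Z. cnj (u a) * (K a (Inr z) / V z)) (\<Sum>a\<in>Z. cnj (u a) * K a (Inl f)) < r / 8"
        "\<forall>\<^sub>F z in F a. dist (K (Inl f) (Inr z) / V z - quot z) (of_real s) < r / 8" using r by auto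
      thus "\<forall>\<^sub>F z in F a. dist (quot z) (of_real (A - s)) < r"
        using KC V_nonzero[OF a] eventually_domain[of a]
      proof eventually_elim
        case (elim z)
        define P Q R where "P = K (Inl f) (Inr z) / V z" and "Q = (\<Sum>a\<in>Z. cnj (u a) * (K a (Inr z) / V z))"
          and "R = (\<Sum>a\<in>Z. cnj (u a) * K a (Inl f))"
        have 1: "cmod (Q - R) < r / 8" "cmod (P - quot z - of_real s) < r / 8"
          using elim(1,2) by (simp_all add: P_def Q_def R_def dist_norm)
        have "(cmod (K (Inl f) (Inr z) + (\<Sum>a\<in>Z. cnj (u a) * K a (Inr z))))\<^sup>2 \<le> \<epsilon> * Re (K (Inr z) (Inr z))"
          by (rule Zz) (use elim(5) in \<open>auto simp: nodes_and_def\<close>)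
        also have "\<dots> \<le> \<epsilon> * (C * (cmod (V z))\<^sup>2)" using elim(3) \<epsilon> by (intro mult_left_mono) auto
        also have "K (Inl f) (Inr z) + (\<Sum>a\<in>Z. cnj (u a) * K a (Inr z)) = (P + Q) * V z"
          using elim(4) by (simp add: P_def Q_def distrib_right sum_distrib_right)
        finally have "(cmod (P + Q))\<^sup>2 * (cmod (V z))\<^sup>2 \<le> (\<epsilon> * C) * (cmod (V z))\<^sup>2"
          by (simp add: norm_mult power_mult_distrib)
        hence "(cmod (P + Q))\<^sup>2 \<le> \<epsilon> * C" using elim(4) by simp
        hence "(cmod (P + Q))\<^sup>2 \<le> (r / 4)\<^sup>2" using \<epsilon>b[of C] C A by simp
        hence 2: "cmod (P + Q) \<le> r / 4" by (rule power2_le_imp_le) (use r in simp)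
        have 3: "cmod (of_real A + R) \<le> r / 4" using ZA' by (simp add: R_def)
        \<comment> \<open>Four errors: the replacement at \<open>z\<close>, the two limits at the
          node, and the replacement at the node; they add up to at most three quarters of
          \<open>r\<close>.\<close>
        have "quot z - of_real (A - s) = (P + Q) - (P - quot z - of_real s) - (Q - R) - (of_real A + R)" by simp
        also have "cmod \<dots> \<le> cmod (P + Q) + cmod (P - quot z - of_real s) + cmod (Q - R) + cmod (of_real A + R)"
          by (meson norm_triangle_ineq4 order_trans add_right_mono)
        also have "\<dots> < r" using 1 2 3 r by linarith
        finally show ?case by (simp add: dist_norm)
      qed
    qed
  qed
  ultimately show ?thesis using that by blast
qed

end

text \<open>Cauchy's estimate for \<open>w\<close> minus its linear approximation on the disc of
  radius \<open>Im z / 2\<close>. The disc stays in the wider Stolz angle of aperture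
  \<open>2 * a + 1\<close>, where the difference quotient is already known to converge.\<close>

lemma nontangential_derivative:
  assumes fin: "finite (upper_half_plane - analyticity_domain w)"
    and q: "\<And>a. a > 0 \<Longrightarrow> ((\<lambda>z. (w z - v) / (z - of_real x0)) \<longlongrightarrow> d) (at (of_real x0) within stolz_angle x0 a)"
  shows "nontangential_limit (deriv w) x0 (nhds d)"
  unfolding nontangential_limit_def
proof (intro allI impI tendstoI)
  fix a r :: real assume a: "a > 0" and r: "r > 0"
  let ?x = "complex_of_real x0"
  \<comment> \<open>On the disc the distance to the node is at most \<open>(a + 2) * Im z\<close>;
    division by the radius doubles \<open>\<epsilon> * (a + 2)\<close> to
    \<open>r / 2\<close>.\<close>
  define \<epsilon> where "\<epsilon> = r / (4 * (a + 2))"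
  have \<epsilon>: "\<epsilon> > 0" using a r by (simp add: \<epsilon>_def)
  have "2 * a + 1 > 0" using a by simp
  from tendstoD[OF q[OF this] \<epsilon>] obtain \<delta>1 where \<delta>1: "\<delta>1 > 0"
    "\<And>\<zeta>. \<zeta> \<in> stolz_angle x0 (2 * a + 1) \<Longrightarrow> \<zeta> \<noteq> ?x \<Longrightarrow> dist \<zeta> ?x < \<delta>1 \<Longrightarrow> dist ((w \<zeta> - v) / (\<zeta> - ?x)) d < \<epsilon>"
    unfolding eventually_at by blast
  from eventually_analyticity_domain[OF fin, of x0] obtain \<delta>2 where \<delta>2: "\<delta>2 > 0"
    "\<And>\<zeta>. \<zeta> \<in> upper_half_plane \<Longrightarrow> \<zeta> \<noteq> ?x \<Longrightarrow> dist \<zeta> ?x < \<delta>2 \<Longrightarrow> \<zeta> \<in> analyticity_domain w"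
    unfolding eventually_at by blast
  \<comment> \<open>Halved because points of the disc may be up to twice as far from the node as its
    centre.\<close>
  define \<delta> where "\<delta> = min \<delta>1 \<delta>2 / 2"
  have \<delta>: "\<delta> > 0" using \<delta>1 \<delta>2 by (simp add: \<delta>_def)
  show "\<forall>\<^sub>F z in at ?x within stolz_angle x0 a. dist (deriv w z) d < r"
    unfolding eventually_at
  proof (intro exI[of _ \<delta>] conjI ballI impI \<delta>)
    fix z assume z: "z \<in> stolz_angle x0 a" "z \<noteq> ?x \<and> dist z ?x < \<delta>"
    define \<rho> where "\<rho> = Im z / 2"
    have Im: "Im z > 0" "cmod (z - ?x) \<le> (a + 1) * Im z" using stolz_norm_le[OF z(1)] by auto
    have \<rho>: "\<rho> > 0" using Im by (simp add: \<rho>_def)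
    have disc: "\<zeta> \<in> analyticity_domain w \<and> cmod (w \<zeta> - v - d * (\<zeta> - ?x)) \<le> \<epsilon> * ((a + 2) * Im z)"
      if "\<zeta> \<in> cball z \<rho>" for \<zeta>
    proof -
      have n: "cmod (\<zeta> - z) \<le> \<rho>" using that by (simp add: dist_norm norm_minus_commute)
      have re: "\<bar>Re \<zeta> - Re z\<bar> \<le> \<rho>" using abs_Re_le_cmod[of "\<zeta> - z"] n by simp
      have im: "\<bar>Im \<zeta> - Im z\<bar> \<le> \<rho>" using abs_Im_le_cmod[of "\<zeta> - z"] n by simp
      have im': "Im z \<le> 2 * Im \<zeta>" "0 < Im \<zeta>" using im Im(1) unfolding \<rho>_def by linarith+
      have "\<bar>Re \<zeta> - x0\<bar> \<le> a * Im z + \<rho>" using re z(1) by (auto simp: stolz_angle_def)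
      also have "\<dots> \<le> a * (2 * Im \<zeta>) + Im \<zeta>"
        using im' a by (intro add_mono mult_left_mono) (auto simp: \<rho>_def)
      finally have st: "\<zeta> \<in> stolz_angle x0 (2 * a + 1)"
        using im' by (simp add: stolz_angle_def algebra_simps)
      have ne: "\<zeta> \<noteq> ?x" using im' by auto
      have "cmod (\<zeta> - ?x) \<le> cmod (\<zeta> - z) + cmod (z - ?x)"
        using norm_triangle_ineq[of "\<zeta> - z" "z - ?x"] by simp
      hence nx: "cmod (\<zeta> - ?x) \<le> cmod (z - ?x) + \<rho>" using n by linarith
      have "\<rho> \<le> cmod (z - ?x)" using abs_Im_le_cmod[of "z - ?x"] Im by (simp add: \<rho>_def)
      hence "dist \<zeta> ?x < 2 * \<delta>" using nx z(2) by (simp add: dist_norm)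
      hence ds: "dist \<zeta> ?x < \<delta>1" "dist \<zeta> ?x < \<delta>2" by (auto simp: \<delta>_def)
      have an: "\<zeta> \<in> analyticity_domain w"
        using im' by (intro \<delta>2(2) ne ds) (auto simp: upper_half_plane_def)
      have "cmod ((w \<zeta> - v) / (\<zeta> - ?x) - d) \<le> \<epsilon>" using \<delta>1(2)[OF st ne ds(1)] by (simp add: dist_norm)
      hence "cmod ((w \<zeta> - v) / (\<zeta> - ?x) - d) * cmod (\<zeta> - ?x) \<le> \<epsilon> * cmod (\<zeta> - ?x)"
        by (rule mult_right_mono) simp
      also have "cmod ((w \<zeta> - v) / (\<zeta> - ?x) - d) * cmod (\<zeta> - ?x) = cmod (w \<zeta> - v - d * (\<zeta> - ?x))"
      proof -
        have "(t / h - d) * h = t - d * h" if "h \<noteq> 0" for t h using that by (simp add: left_diff_distrib)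
        from this[of "\<zeta> - ?x"] ne show ?thesis unfolding norm_mult[symmetric] by simp
      qed
      also have "\<epsilon> * cmod (\<zeta> - ?x) \<le> \<epsilon> * ((a + 2) * Im z)"
        using nx Im \<epsilon> by (intro mult_left_mono) (auto simp: \<rho>_def algebra_simps)
      finally show ?thesis using an by simp
    qed
    define g where "g \<zeta> = w \<zeta> - v - d * (\<zeta> - ?x)" for \<zeta>
    have "g analytic_on {\<zeta>}" if "\<zeta> \<in> cball z \<rho>" for \<zeta>
      unfolding g_def using disc[OF that] by (auto simp: analyticity_domain_def intro!: analytic_intros)
    hence "g analytic_on cball z \<rho>" using analytic_on_analytic_at by blast
    hence hol: "g holomorphic_on cball z \<rho>" by (rule analytic_imp_holomorphic)
    have "cmod ((deriv ^^ 1) g z) \<le> fact 1 * (\<epsilon> * ((a + 2) * Im z)) / \<rho> ^ 1"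
    proof (rule Cauchy_inequality)
      show "g holomorphic_on ball z \<rho>" using hol by (rule holomorphic_on_subset) auto
      show "continuous_on (cball z \<rho>) g" using hol by (rule holomorphic_on_imp_continuous_on)
      show "cmod (g \<zeta>) \<le> \<epsilon> * ((a + 2) * Im z)" if "cmod (z - \<zeta>) = \<rho>" for \<zeta>
        using disc[of \<zeta>] that by (simp add: g_def dist_norm)
    qed (use \<rho> in auto)
    also have "\<dots> = r / 2"
    proof -
      have "r / (4 * t) * t = r / 4" if "t \<noteq> 0" for t using that by simp
      from this[of "a + 2"] have "\<epsilon> * (a + 2) = r / 4" unfolding \<epsilon>_def using a by linarith
      hence eq: "\<epsilon> * ((a + 2) * Im z) = r / 4 * Im z" by (simp only: mult.assoc[symmetric])
      show ?thesis unfolding eq using Im(1) by (simp add: \<rho>_def)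
    qed
    finally have "cmod (deriv g z) \<le> r / 2" by simp
    moreover have "deriv g z = deriv w z - d"
    proof -
      have "w analytic_on {z}" using disc[of z] \<rho> by (auto simp: analyticity_domain_def)
      hence "(w has_field_derivative deriv w z) (at z)"
        by (intro field_differentiable_derivI analytic_on_imp_differentiable_at) auto
      hence "(g has_field_derivative deriv w z - d) (at z)"
        unfolding g_def by (auto intro!: derivative_eq_intros)
      thus ?thesis by (rule DERIV_imp_deriv)
    qed
    ultimately show "dist (deriv w z) d < r" using r by (simp add: dist_norm)
  qed
qed

section \<open>The interpolation condition at the node\<close>

context boundary_node
begin

lemma quot_regular: "f < n_reg \<Omega> \<Longrightarrow> quot z = (w z - of_real (val \<Omega> f)) / (z - of_real (node \<Omega> f))"
  by (simp add: quot_def tU_def tV_def pt_fst_def pt_snd_def data_fst_def x_def)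

lemma quot_singular:
  "\<not> f < n_reg \<Omega> \<Longrightarrow> quot z = - of_real ((resid \<Omega> f)\<^sup>2) / ((z - of_real (node \<Omega> f)) * w z)"
  by (simp add: quot_def tU_def tV_def pt_fst_def pt_snd_def data_fst_def x_def power2_eq_square mult_ac)

theorem interp_cond_holds: "interp_cond \<Omega> w f"
proof -
  obtain d :: real where d: "d \<le> Re (fmi_diag \<Omega> f)" "\<And>a. a > 0 \<Longrightarrow> (quot \<longlongrightarrow> of_real d) (F a)"
    using quotient_limit by blast
  let ?x = "complex_of_real (node \<Omega> f)"
  have F: "F a = at ?x within stolz_angle (node \<Omega> f) a" for a by (simp add: x_def)
  show ?thesis
  proof (cases "f < n_reg \<Omega>")
    case True
    have q: "((\<lambda>z. (w z - of_real (val \<Omega> f)) / (z - ?x)) \<longlongrightarrow> of_real d) (at ?x within stolz_angle (node \<Omega> f) a)"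
      if "a > 0" for a
      using d(2)[OF that] unfolding F quot_regular[OF True, abs_def] .
    have "nontangential_limit (deriv w) (node \<Omega> f) (nhds (of_real d))"
      by (rule nontangential_derivative[OF fin q])
    moreover have "nontangential_limit w (node \<Omega> f) (nhds (of_real (val \<Omega> f)))"
      unfolding nontangential_limit_def
    proof (intro allI impI)
      fix a :: real assume a: "a > 0"
      have "((\<lambda>z. z - ?x) \<longlongrightarrow> 0) (at ?x within stolz_angle (node \<Omega> f) a)"
        by (rule tendsto_eq_intros tendsto_ident_at refl)+ simp
      from tendsto_add[OF tendsto_mult[OF q[OF a] this] tendsto_const[of "of_real (val \<Omega> f)"]]
      have "((\<lambda>z. (w z - of_real (val \<Omega> f)) / (z - ?x) * (z - ?x) + of_real (val \<Omega> f)) \<longlongrightarrow> of_real (val \<Omega> f))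
         (at ?x within stolz_angle (node \<Omega> f) a)" by simp
      thus "(w \<longlongrightarrow> of_real (val \<Omega> f)) (at ?x within stolz_angle (node \<Omega> f) a)"
        by (rule Lim_transform_eventually) (simp add: eventually_at_filter)
    qed
    ultimately show ?thesis using d(1) True by (auto simp: interp_cond_def Let_def fmi_diag_def)
  next
    case False
    let ?\<xi> = "resid \<Omega> f"
    have xi: "?\<xi> \<noteq> 0" using cf_nonzero[OF False] False by (simp add: data_fst_def)
    have dle: "d \<le> - ?\<xi>" using d(1) False by (simp add: fmi_diag_def)
    \<comment> \<open>The residue function is recovered from the reciprocal of \<open>quot\<close>;
      thus \<open>d = 0\<close> is the case of an infinite limit, and otherwise the limit is minus
      the square of \<xi> divided by \<open>d\<close>.\<close>
    have ev: "\<forall>\<^sub>F z in F a. quot z \<noteq> 0 \<and> - of_real (?\<xi>\<^sup>2) * inverse (quot z) = (z - ?x) * w z" if "a > 0" for a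
      using V_nonzero[OF that] eventually_stolz[of a]
    proof eventually_elim
      case (elim z)
      have "w z \<noteq> 0" "z - ?x \<noteq> 0" using elim False by (auto simp: tV_def pt_fst_def x_def)
      thus ?case using xi by (simp add: quot_singular[OF False])
    qed
    show ?thesis
    proof (cases "d = 0")
      case True
      have "nontangential_limit (\<lambda>z. (z - ?x) * w z) (node \<Omega> f) at_infinity"
        unfolding nontangential_limit_def
      proof (intro allI impI)
        fix a :: real assume a: "a > 0"
        have "filterlim quot (at 0) (F a)"
          using d(2)[OF a] ev[OF a] True unfolding filterlim_at by (auto elim: eventually_mono)
        hence "filterlim (\<lambda>z. inverse (quot z)) at_infinity (F a)"
          by (rule filterlim_compose[OF filterlim_inverse_at_infinity])
        hence "filterlim (\<lambda>z. - complex_of_real (?\<xi>\<^sup>2) * inverse (quot z)) at_infinity (F a)"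
          using xi by (intro tendsto_mult_filterlim_at_infinity[OF tendsto_const]) auto
        moreover have "\<forall>\<^sub>F z in F a. - of_real (?\<xi>\<^sup>2) * inverse (quot z) = (z - ?x) * w z"
          using ev[OF a] by eventually_elim auto
        ultimately show "filterlim (\<lambda>z. (z - ?x) * w z) at_infinity (at ?x within stolz_angle (node \<Omega> f) a)"
          unfolding F by (subst (asm) filterlim_cong[OF refl refl]) auto
      qed
      moreover have "0 \<le> - 1 / ?\<xi>" using dle True xi by (simp add: field_simps)
      ultimately show ?thesis using False by (auto simp: interp_cond_def Let_def)
    next
      case d0: False
      define r where "r = - ?\<xi>\<^sup>2 / d"
      have "nontangential_limit (\<lambda>z. (z - ?x) * w z) (node \<Omega> f) (nhds (of_real r))"
        unfolding nontangential_limit_def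
      proof (intro allI impI)
        fix a :: real assume a: "a > 0"
        have "((\<lambda>z. - of_real (?\<xi>\<^sup>2) * inverse (quot z)) \<longlongrightarrow> - of_real (?\<xi>\<^sup>2) * inverse (of_real d)) (F a)"
          using d0 by (intro tendsto_intros d(2) a) auto
        moreover have "\<forall>\<^sub>F z in F a. - of_real (?\<xi>\<^sup>2) * inverse (quot z) = (z - ?x) * w z"
          using ev[OF a] by eventually_elim auto
        moreover have "- of_real (?\<xi>\<^sup>2) * inverse (of_real d) = complex_of_real r"
          by (simp add: r_def field_simps)
        ultimately show "((\<lambda>z. (z - ?x) * w z) \<longlongrightarrow> of_real r) (at ?x within stolz_angle (node \<Omega> f) a)"
          unfolding F using Lim_transform_eventually by fastforce
      qed
      moreover have "r \<noteq> 0" using xi d0 by (simp add: r_def)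
      moreover have "- 1 / r \<le> - 1 / ?\<xi>"
      proof -
        have "- 1 / r = d / ?\<xi>\<^sup>2" using d0 xi by (simp add: r_def field_simps)
        also have "\<dots> \<le> - ?\<xi> / ?\<xi>\<^sup>2" using dle by (intro divide_right_mono) auto
        also have "\<dots> = - 1 / ?\<xi>" using xi by (simp add: power2_eq_square)
        finally show ?thesis .
      qed
      ultimately show ?thesis using False by (auto simp: interp_cond_def Let_def)
    qed
  qed
qed

end

context interpolation_data
begin

subsection \<open>Counting the violated conditions\<close>

text \<open>A system of \<open>m\<close> negative vectors without \<open>f\<close> would provide a
  \<open>boundary_node\<close> and hence the condition at \<open>f\<close>. So no such system
  exists, which is the bound \<open>m - 1\<close>; the value \<open>m = 0\<close> is excluded by the
  empty system.\<close>

lemma drop_failing_node: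
  assumes fin: "finite (upper_half_plane - analyticity_domain w)"
    and T: "T \<subseteq> {..<n}" "f < n" "f \<notin> T"
    and le: "neg_le_on (fmi \<Omega> w) (nodes_and (insert f T) w) m"
    and fail: "\<not> interp_cond \<Omega> w f"
  shows "m \<ge> 1 \<and> neg_le_on (fmi \<Omega> w) (nodes_and T w) (m - 1)"
proof -
  have no: "\<not> neg_system (fmi \<Omega> w) I m v" if "finite I" "I \<subseteq> nodes_and T w" for I v
  proof
    assume "neg_system (fmi \<Omega> w) I m v"
    then interpret boundary_node \<Omega> w f T I m v
      using fin T le that by unfold_locales auto
    show False using interp_cond_holds fail by simp
  qed
  have m: "m \<ge> 1"
  proof (rule ccontr)
    assume "\<not> m \<ge> 1"
    hence "neg_system (fmi \<Omega> w) {} m (\<lambda>_ _. 0)" by (simp add: neg_system_def)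
    thus False using no[of "{}"] by simp
  qed
  moreover have "neg_le (fmi \<Omega> w) I (m - 1)" if "finite I" "I \<subseteq> nodes_and T w" for I
    unfolding neg_le_iff[OF herm_fmi] using no[OF that] m by simp
  ultimately show ?thesis by (auto simp: neg_le_on_def)
qed

lemma drop_failing_nodes:
  assumes fin: "finite (upper_half_plane - analyticity_domain w)"
    and le: "neg_le_on (fmi \<Omega> w) (nodes_and {..<n} w) k"
    and G: "finite G" "G \<subseteq> {i. i < n \<and> \<not> interp_cond \<Omega> w i}"
  shows "card G \<le> k \<and> neg_le_on (fmi \<Omega> w) (nodes_and ({..<n} - G) w) (k - card G)"
  using G
proof (induction G rule: finite_induct)
  case empty
  thus ?case using le by simp
next
  case (insert g G)
  have IH: "card G \<le> k" "neg_le_on (fmi \<Omega> w) (nodes_and ({..<n} - G) w) (k - card G)"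
    using insert by auto
  have eq: "{..<n} - G = insert g ({..<n} - insert g G)" using insert by auto
  have "k - card G \<ge> 1 \<and> neg_le_on (fmi \<Omega> w) (nodes_and ({..<n} - insert g G) w) (k - card G - 1)"
    using insert.prems IH(2) by (intro drop_failing_node[OF fin, of _ g]) (auto simp flip: eq)
  thus ?case using insert.hyps by auto
qed

lemma gen_nevanlinna_index_le:
  assumes "w \<in> gen_nevanlinna k" "neg_le_on (nk w) (analyticity_domain w) k'"
  shows "k \<le> k'"
  using assms(1) assms(2)[unfolded sq_neg_all_iff[symmetric]] unfolding gen_nevanlinna_def by blast

lemma fmi_imp_nk:
  assumes "neg_le_on (fmi \<Omega> w) (nodes_and T w) k"
  shows "neg_le_on (nk w) (analyticity_domain w) k"
  unfolding neg_le_on_def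
proof (intro allI impI, elim conjE)
  fix Z assume Z: "finite Z" "Z \<subseteq> analyticity_domain w"
  have "neg_le (\<lambda>s t. fmi \<Omega> w (Inr s) (Inr t)) Z k"
    by (rule neg_le_family[OF assms Z(1)]) (use Z in \<open>auto simp: nodes_and_def\<close>)
  thus "neg_le (nk w) Z k" unfolding fmi_Inr_Inr by (simp add: eta_contract_eq)
qed

theorem master_solution_iff_fmi:
  assumes w: "w nicely_meromorphic_on upper_half_plane"
  shows "master_solution \<Omega> w \<longleftrightarrow> neg_le_on (fmi \<Omega> w) (nodes_and {..<n} w) neg"
proof
  define G where "G = {i. i < n \<and> \<not> interp_cond \<Omega> w i}"
  have G: "finite G" "G \<subseteq> {..<n}" by (auto simp: G_def)
  have solved: "neg_le_on (fmi \<Omega> w) (nodes_and {..<n} w) (k + card G)" if "w \<in> gen_nevanlinna k" for k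
    by (intro nodes_split_neg_le solution_neg_le that G) (auto simp: G_def)
  {
    assume "master_solution \<Omega> w"
    then obtain k where k: "k \<le> neg" "w \<in> gen_nevanlinna k" "card G = neg - k"
      by (auto simp: master_solution_def Let_def neg_def G_def)
    show "neg_le_on (fmi \<Omega> w) (nodes_and {..<n} w) neg" using solved[OF k(2)] k by simp
  }
  {
    assume le: "neg_le_on (fmi \<Omega> w) (nodes_and {..<n} w) neg"
    have nk: "neg_le_on (nk w) (analyticity_domain w) neg" by (rule fmi_imp_nk[OF le])
    obtain k where k: "k \<le> neg" "w \<in> gen_nevanlinna k" using gen_nevanlinna_exists[OF w nk] .
    have "card G \<le> neg \<and> neg_le_on (fmi \<Omega> w) (nodes_and ({..<n} - G) w) (neg - card G)"
      by (rule drop_failing_nodes[OF finite_poles[OF w nk] le G(1)]) (simp add: G_def)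
    hence "card G \<le> neg" "k \<le> neg - card G"
      using gen_nevanlinna_index_le[OF k(2)] fmi_imp_nk by blast+
    \<comment> \<open>The opposite inequality: bordering by all nodes costs at most
      \<open>card G\<close> beyond \<open>k\<close>, while the block \<open>P\<close> already has
      \<open>neg\<close> negative squares.\<close>
    moreover have "neg \<le> k + card G" by (rule neg_bound[OF solved[OF k(2)]])
    ultimately have "card G = neg - k" by linarith
    thus "master_solution \<Omega> w"
      using k by (auto simp: master_solution_def Let_def neg_def G_def)
  }
qed

end

theorem theorem2p2:
  fixes \<Omega> :: interp_data and w :: "complex \<Rightarrow> complex"
  assumes "valid_data \<Omega>"
    and "w nicely_meromorphic_on upper_half_plane"
    and "invertible_mat (pick_matrix \<Omega>)"
  shows "master_solution \<Omega> w \<longleftrightarrow> (\<exists>\<phi>\<in>ext_gen_nevanlinna 0. is_lft w (Theta \<Omega>) \<phi>)"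
proof -
  interpret interpolation_data \<Omega> using assms(1,3) by unfold_locales
  show ?thesis using master_solution_iff_fmi[OF assms(2)] lft_iff_fmi[OF assms(2)] by simp
qed

end
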